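(* With the objects defined in the context, assume that the closed-loop semigroup satisfies $$\|S_{\mathrm{cl}}(t)\|_{\mathcal L(\mathcal X)}\le K_0e^{-\alpha t},\qquad t\ge0,$$ for some $K_0\ge1$ and $\alpha>0$. If $$\frac{K_0}{\alpha}\,\|B\|_{\mathcal L(\mathbb{R}^M,\mathcal X)}\,\|U_N\|_{\mathcal L(X_N,\mathbb{R}^M)}<1,$$ then, for every $y_r\in X_N$, the fixed-point problem $(I+T_N)y^\star=y_r$ in $X_N$, with $T_N=P_NR_{\mathrm{cl}}Q_NBU_N$, has a unique solution and the Picard iteration $y^{(\ell+1)}:=y_r-T_Ny^{(\ell)}$ converges to it.
   Context: $\Omega\subset\mathbb{R}^3$ is a bounded connected $C^2$ domain, $\kappa_m>0$, $H=L^2(\Omega)$; $A_0=\kappa_m\Delta$ with homogeneous Neumann boundary condition, $D(A_0)=\{y\in H^2(\Omega):\partial_\nu y=0\}$; $\mathcal A=I-A_0$, $D(\mathcal A)=D(A_0)$; $\mathcal X=D(\mathcal A)'$ with norm $\|\eta\|_{\mathcal X}=\|\mathcal A^{-1}\eta\|_H$. $\{\varphi_k\}_{k\ge1}$ is an $L^2$-orthonormal basis of Neumann eigenfunctions of $-\Delta$ with eigenvalues $0=\lambda_1\le\lambda_2\le\cdots$; $X_N=\mathrm{span}\{\varphi_1,\dots,\varphi_N\}$, with the norm inherited from $\mathcal X$; $P_N$ is the spectral projector onto $X_N$ ($H$-orthogonal, extended to $\mathcal X$ by $P_N\eta=\sum_{k\le N}\langle\eta,\varphi_k\rangle\varphi_k$)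 and $Q_N=I-P_N$. For points $x_1,\dots,x_M\in\Omega$, $B:\mathbb{R}^M\to\mathcal X$, $Bu=\sum_ju_j\delta_{x_j}$. The closed-loop generator is $A_{\mathrm{cl}}z=A_0z-\lambda\sum_{j=1}^M(\mathcal A^{-1}z)(x_j)\delta_{x_j}$ with gain $\lambda>0$, $S_{\mathrm{cl}}(t)=e^{tA_{\mathrm{cl}}}$, and $R_{\mathrm{cl}}:=\int_0^\infty S_{\mathrm{cl}}(t)\,dt$. $U_N:X_N\to\mathbb{R}^M$ is linear and satisfies $P_N(A_0y+BU_Ny)=0$ for all $y\in X_N$. *)

theory Defs
  imports "HOL-Analysis.Analysis" "HOL-Library.Function_Algebras"
begin

text \<open>Pointwise real vector space structure on functions; it is used for the functionals
  that make up the extrapolation space \<open>\<X>\<close>.\<close>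

instantiation "fun" :: (type, real_vector) real_vector
begin

definition scaleR_fun :: "real \<Rightarrow> ('a \<Rightarrow> 'b) \<Rightarrow> 'a \<Rightarrow> 'b"
  where "scaleR_fun c f = (\<lambda>x. c *\<^sub>R f x)"

instance
  by standard (auto simp: scaleR_fun_def plus_fun_def scaleR_add_right scaleR_add_left)

end

type_synonym sfun = "real^3 \<Rightarrow> real"
type_synonym functional = "sfun \<Rightarrow> real"


section \<open>Domains of class \<open>C\<^sup>2\<close>\<close>

primrec Ck_on :: "nat \<Rightarrow> 'a::euclidean_space set \<Rightarrow> ('a \<Rightarrow> real) \<Rightarrow> bool" where
  "Ck_on 0 S f \<longleftrightarrow> continuous_on S f"
| "Ck_on (Suc n) S f \<longleftrightarrow> (\<forall>x\<in>S. f differentiable (at x)) \<and>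
     (\<forall>i\<in>Basis. Ck_on n S (\<lambda>x. frechet_derivative f (at x) i))"

text \<open>Near each boundary point the domain is, in suitable orthonormal coordinates, the strict
  epigraph of a \<open>C\<^sup>2\<close> function.\<close>

definition C2_domain :: "(real^3) set \<Rightarrow> bool" where
  "C2_domain \<Omega> \<longleftrightarrow> open \<Omega> \<and> connected \<Omega> \<and> \<Omega> \<noteq> {} \<and>
     (\<forall>p\<in>frontier \<Omega>. \<exists>r>0. \<exists>(L :: real^3 \<Rightarrow> real^3) (\<gamma> :: real \<times> real \<Rightarrow> real).
        orthogonal_transformation L \<and> Ck_on 2 UNIV \<gamma> \<and>
        \<Omega> \<inter> ball p r = {x \<in> ball p r. L x $ 3 > \<gamma> (L x $ 1, L x $ 2)})"


section \<open>Lebesgue and Sobolev spaces\<close>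

text \<open>Elements of \<open>L\<^sup>2(\<Omega>)\<close> are represented by functions; values outside \<open>\<Omega>\<close> and on null sets
  are irrelevant.\<close>

definition L2 :: "(real^3) set \<Rightarrow> sfun set" where
  "L2 \<Omega> = {f. f \<in> borel_measurable (lebesgue_on \<Omega>) \<and> integrable (lebesgue_on \<Omega>) (\<lambda>x. (f x)\<^sup>2)}"

definition l2_inner :: "(real^3) set \<Rightarrow> sfun \<Rightarrow> sfun \<Rightarrow> real" where
  "l2_inner \<Omega> f g = (\<integral>x. f x * g x \<partial>lebesgue_on \<Omega>)"

definition l2_norm :: "(real^3) set \<Rightarrow> sfun \<Rightarrow> real" where
  "l2_norm \<Omega> f = sqrt (l2_inner \<Omega> f f)"

definition test_functions :: "(real^3) set \<Rightarrow> sfun set" where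
  "test_functions \<Omega> = {\<psi>. (\<forall>n. Ck_on n UNIV \<psi>) \<and>
     compact (closure {x. \<psi> x \<noteq> 0}) \<and> closure {x. \<psi> x \<noteq> 0} \<subseteq> \<Omega>}"

definition has_weak_deriv :: "(real^3) set \<Rightarrow> real^3 \<Rightarrow> sfun \<Rightarrow> sfun \<Rightarrow> bool" where
  "has_weak_deriv \<Omega> i u g \<longleftrightarrow> (\<forall>\<psi>\<in>test_functions \<Omega>.
     l2_inner \<Omega> u (\<lambda>x. frechet_derivative \<psi> (at x) i) = - l2_inner \<Omega> g \<psi>)"

definition weak_deriv :: "(real^3) set \<Rightarrow> real^3 \<Rightarrow> sfun \<Rightarrow> sfun" where
  "weak_deriv \<Omega> i u = (SOME g. g \<in> L2 \<Omega> \<and> has_weak_deriv \<Omega> i u g)"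

definition H1 :: "(real^3) set \<Rightarrow> sfun set" where
  "H1 \<Omega> = {u \<in> L2 \<Omega>. \<forall>i\<in>Basis. \<exists>g\<in>L2 \<Omega>. has_weak_deriv \<Omega> i u g}"

definition H2 :: "(real^3) set \<Rightarrow> sfun set" where
  "H2 \<Omega> = {u \<in> H1 \<Omega>. \<forall>i\<in>Basis. weak_deriv \<Omega> i u \<in> H1 \<Omega>}"

definition laplacian :: "(real^3) set \<Rightarrow> sfun \<Rightarrow> sfun" where
  "laplacian \<Omega> u = (\<lambda>x. \<Sum>i\<in>Basis. weak_deriv \<Omega> i (weak_deriv \<Omega> i u) x)"

text \<open>The normal trace \<open>\<partial>\<^sub>\<nu>y \<in> H\<^sup>-\<^sup>1\<^sup>/\<^sup>2(\<partial>\<Omega>)\<close> of the field \<open>\<nabla>y \<in> H(div)\<close>: its pairing with the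
  boundary values of \<open>v \<in> H\<^sup>1(\<Omega>)\<close>, given by Green's formula
  \<open>\<langle>\<partial>\<^sub>\<nu>y, v\<rangle> = \<integral>\<^sub>\<Omega> \<nabla>y \<cdot> \<nabla>v + \<integral>\<^sub>\<Omega> (\<Delta>y) v\<close>.\<close>

definition normal_trace :: "(real^3) set \<Rightarrow> sfun \<Rightarrow> sfun \<Rightarrow> real" where
  "normal_trace \<Omega> y v =
     (\<Sum>i\<in>Basis. l2_inner \<Omega> (weak_deriv \<Omega> i y) (weak_deriv \<Omega> i v)) + l2_inner \<Omega> (laplacian \<Omega> y) v"

text \<open>The value at \<open>x\<close> of the continuous representative of \<open>f\<close>.\<close>

definition point_value :: "(real^3) set \<Rightarrow> sfun \<Rightarrow> real^3 \<Rightarrow> real" where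
  "point_value \<Omega> f x =
     (SOME g. continuous_on \<Omega> g \<and> (AE y in lebesgue_on \<Omega>. g y = f y)) x"


section \<open>The Neumann operator and the extrapolation space\<close>

definition dom_A0 :: "(real^3) set \<Rightarrow> sfun set" where
  "dom_A0 \<Omega> = {y \<in> H2 \<Omega>. \<forall>v\<in>H1 \<Omega>. normal_trace \<Omega> y v = 0}"

definition A0 :: "(real^3) set \<Rightarrow> real \<Rightarrow> sfun \<Rightarrow> sfun" where
  "A0 \<Omega> \<kappa> y = (\<lambda>x. \<kappa> * laplacian \<Omega> y x)"

definition calA :: "(real^3) set \<Rightarrow> real \<Rightarrow> sfun \<Rightarrow> sfun" where
  "calA \<Omega> \<kappa> y = (\<lambda>x. y x - A0 \<Omega> \<kappa> y x)"

text \<open>\<open>\<X> = D(\<A>)'\<close>: linear functionals on \<open>D(\<A>) = D(A\<^sub>0)\<close> that are bounded in the graph norm.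
  So that equality of functions is equality in \<open>\<X>\<close>, they are set to \<open>0\<close> off \<open>D(\<A>)\<close>.\<close>

definition X_space :: "(real^3) set \<Rightarrow> real \<Rightarrow> functional set" where
  "X_space \<Omega> \<kappa> = {\<eta>. (\<forall>v. v \<notin> dom_A0 \<Omega> \<longrightarrow> \<eta> v = 0) \<and>
     (\<forall>v\<in>dom_A0 \<Omega>. \<forall>w\<in>dom_A0 \<Omega>. \<eta> (v + w) = \<eta> v + \<eta> w) \<and>
     (\<forall>c. \<forall>v\<in>dom_A0 \<Omega>. \<eta> (c *\<^sub>R v) = c * \<eta> v) \<and>
     (\<exists>C. \<forall>v\<in>dom_A0 \<Omega>. \<bar>\<eta> v\<bar> \<le> C * (l2_norm \<Omega> v + l2_norm \<Omega> (calA \<Omega> \<kappa> v)))}"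

text \<open>\<open>dual_ext \<Omega> L : H \<rightarrow> D(\<A>)'\<close> is \<open>z \<mapsto> \<langle>z, L \<cdot>\<rangle>\<^sub>H\<close>. For symmetric \<open>L\<close> on \<open>D(\<A>)\<close> it is the
  extension of \<open>L\<close> to \<open>H\<close>; for the identity it is the embedding of \<open>H\<close> into \<open>\<X>\<close>.\<close>

definition dual_ext :: "(real^3) set \<Rightarrow> (sfun \<Rightarrow> sfun) \<Rightarrow> sfun \<Rightarrow> functional" where
  "dual_ext \<Omega> L z = (\<lambda>v. if v \<in> dom_A0 \<Omega> then l2_inner \<Omega> z (L v) else 0)"

definition embed_X :: "(real^3) set \<Rightarrow> sfun \<Rightarrow> functional" where
  "embed_X \<Omega> = dual_ext \<Omega> (\<lambda>v. v)"

definition calA_inv :: "(real^3) set \<Rightarrow> real \<Rightarrow> functional \<Rightarrow> sfun" where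
  "calA_inv \<Omega> \<kappa> \<eta> = (SOME w. w \<in> L2 \<Omega> \<and> dual_ext \<Omega> (calA \<Omega> \<kappa>) w = \<eta>)"

definition X_norm :: "(real^3) set \<Rightarrow> real \<Rightarrow> functional \<Rightarrow> real" where
  "X_norm \<Omega> \<kappa> \<eta> = l2_norm \<Omega> (calA_inv \<Omega> \<kappa> \<eta>)"

definition delta :: "(real^3) set \<Rightarrow> real^3 \<Rightarrow> functional" where
  "delta \<Omega> x = (\<lambda>v. if v \<in> dom_A0 \<Omega> then point_value \<Omega> v x else 0)"

definition B_op :: "(real^3) set \<Rightarrow> ('m::finite \<Rightarrow> real^3) \<Rightarrow> real^'m \<Rightarrow> functional" where
  "B_op \<Omega> xs u = (\<Sum>j\<in>UNIV. (u $ j) *\<^sub>R delta \<Omega> (xs j))"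


section \<open>Neumann eigenbasis and spectral projectors\<close>

text \<open>Indices start at \<open>1\<close>; \<open>\<phi> 0\<close> and \<open>lam 0\<close> play no role.\<close>

definition neumann_eigenbasis :: "(real^3) set \<Rightarrow> (nat \<Rightarrow> sfun) \<Rightarrow> (nat \<Rightarrow> real) \<Rightarrow> bool" where
  "neumann_eigenbasis \<Omega> \<phi> lam \<longleftrightarrow>
     (\<forall>k\<ge>1. \<phi> k \<in> dom_A0 \<Omega> \<and> (AE x in lebesgue_on \<Omega>. - laplacian \<Omega> (\<phi> k) x = lam k * \<phi> k x)) \<and>
     lam 1 = 0 \<and> (\<forall>j\<ge>1. \<forall>k\<ge>j. lam j \<le> lam k) \<and>
     (\<forall>j\<ge>1. \<forall>k\<ge>1. l2_inner \<Omega> (\<phi> j) (\<phi> k) = (if j = k then 1 else 0)) \<and>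
     (\<forall>f\<in>L2 \<Omega>. (\<lambda>n. l2_norm \<Omega> (\<lambda>x. f x - (\<Sum>k=1..n. l2_inner \<Omega> f (\<phi> k) * \<phi> k x)))
        \<longlonglongrightarrow> 0)"

definition X_N :: "(real^3) set \<Rightarrow> (nat \<Rightarrow> sfun) \<Rightarrow> nat \<Rightarrow> functional set" where
  "X_N \<Omega> \<phi> N = span ((\<lambda>k. embed_X \<Omega> (\<phi> k)) ` {1..N})"

definition P_N :: "(real^3) set \<Rightarrow> (nat \<Rightarrow> sfun) \<Rightarrow> nat \<Rightarrow> functional \<Rightarrow> functional" where
  "P_N \<Omega> \<phi> N \<eta> = (\<Sum>k=1..N. \<eta> (\<phi> k) *\<^sub>R embed_X \<Omega> (\<phi> k))"

definition Q_N :: "(real^3) set \<Rightarrow> (nat \<Rightarrow> sfun) \<Rightarrow> nat \<Rightarrow> functional \<Rightarrow> functional" where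
  "Q_N \<Omega> \<phi> N \<eta> = \<eta> - P_N \<Omega> \<phi> N \<eta>"


section \<open>Operators and semigroups on a normed space given by a carrier and a norm\<close>

text \<open>The operator norm takes values in \<open>[0, \<infinity>]\<close>, so that it is meaningful for unbounded operators.\<close>

definition op_norm :: "'v set \<Rightarrow> ('v \<Rightarrow> real) \<Rightarrow> ('w \<Rightarrow> real) \<Rightarrow> ('v \<Rightarrow> 'w) \<Rightarrow> ennreal" where
  "op_norm V nV nW F = (SUP u\<in>{u\<in>V. nV u \<le> 1}. ennreal (nW (F u)))"

definition linear_from :: "'v::real_vector set \<Rightarrow> ('v \<Rightarrow> 'w::real_vector) \<Rightarrow> bool" where
  "linear_from V F \<longleftrightarrow> (\<forall>x\<in>V. \<forall>y\<in>V. F (x + y) = F x + F y) \<and> (\<forall>c. \<forall>x\<in>V. F (c *\<^sub>R x) = c *\<^sub>R F x)"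

definition C0_semigroup ::
    "'v::real_vector set \<Rightarrow> ('v \<Rightarrow> real) \<Rightarrow> (real \<Rightarrow> 'v \<Rightarrow> 'v) \<Rightarrow> bool" where
  "C0_semigroup V nrm S \<longleftrightarrow>
     (\<forall>t\<ge>0. S t ` V \<subseteq> V \<and> linear_from V (S t) \<and> op_norm V nrm nrm (S t) < \<infinity>) \<and>
     (\<forall>x\<in>V. S 0 x = x) \<and>
     (\<forall>s\<ge>0. \<forall>t\<ge>0. \<forall>x\<in>V. S (s + t) x = S s (S t x)) \<and>
     (\<forall>x\<in>V. ((\<lambda>t. nrm (S t x - x)) \<longlongrightarrow> 0) (at_right 0))"

definition generator ::
    "'v::real_vector set \<Rightarrow> ('v \<Rightarrow> real) \<Rightarrow> (real \<Rightarrow> 'v \<Rightarrow> 'v) \<Rightarrow> ('v \<times> 'v) set" where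
  "generator V nrm S = {(x, y). x \<in> V \<and> y \<in> V \<and>
     ((\<lambda>t. nrm ((1 / t) *\<^sub>R (S t x - x) - y)) \<longlongrightarrow> 0) (at_right 0)}"

text \<open>Riemann integral over \<open>[a, b]\<close> with respect to the norm \<open>nrm\<close>, and the improper integral
  over \<open>[0, \<infinity>)\<close>.\<close>

definition has_riemann_integral ::
    "'v::real_vector set \<Rightarrow> ('v \<Rightarrow> real) \<Rightarrow> (real \<Rightarrow> 'v) \<Rightarrow> real \<Rightarrow> real \<Rightarrow> 'v \<Rightarrow> bool" where
  "has_riemann_integral V nrm f a b y \<longleftrightarrow> y \<in> V \<and>
     (\<forall>e>0. \<exists>d>0. \<forall>p. p tagged_division_of {a..b} \<and> (\<lambda>x. ball x d) fine p \<longrightarrow>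
        nrm ((\<Sum>(x, k)\<in>p. measure lborel k *\<^sub>R f x) - y) < e)"

definition has_improper_integral ::
    "'v::real_vector set \<Rightarrow> ('v \<Rightarrow> real) \<Rightarrow> (real \<Rightarrow> 'v) \<Rightarrow> 'v \<Rightarrow> bool" where
  "has_improper_integral V nrm f y \<longleftrightarrow> y \<in> V \<and>
     (\<exists>J. (\<forall>b\<ge>0. has_riemann_integral V nrm f 0 b (J b)) \<and>
          ((\<lambda>b. nrm (J b - y)) \<longlongrightarrow> 0) at_top)"


section \<open>The closed loop\<close>

text \<open>Graph of \<open>A\<^sub>c\<^sub>l\<close> in \<open>\<X> \<times> \<X>\<close>, with domain \<open>H\<close>; there \<open>A\<^sub>0\<close> denotes its extension \<open>H \<rightarrow> \<X>\<close>.\<close>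

definition A_cl ::
    "(real^3) set \<Rightarrow> real \<Rightarrow> ('m::finite \<Rightarrow> real^3) \<Rightarrow> real \<Rightarrow> (functional \<times> functional) set" where
  "A_cl \<Omega> \<kappa> xs gain = (\<lambda>z. (embed_X \<Omega> z,
      dual_ext \<Omega> (A0 \<Omega> \<kappa>) z -
      gain *\<^sub>R (\<Sum>j\<in>UNIV. point_value \<Omega> (calA_inv \<Omega> \<kappa> (embed_X \<Omega> z)) (xs j) *\<^sub>R delta \<Omega> (xs j)))) ` L2 \<Omega>"

text \<open>\<open>S\<close> is the semigroup \<open>e\<^sup>t\<^sup>A\<close> with \<open>A = A\<^sub>c\<^sub>l\<close>; a strongly continuous semigroup is determined by
  its generator.\<close>

definition closed_loop_semigroup ::
    "(real^3) set \<Rightarrow> real \<Rightarrow> ('m::finite \<Rightarrow> real^3) \<Rightarrow> real \<Rightarrow> (real \<Rightarrow> functional \<Rightarrow> functional) \<Rightarrow> bool"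
  where "closed_loop_semigroup \<Omega> \<kappa> xs gain S \<longleftrightarrow>
     C0_semigroup (X_space \<Omega> \<kappa>) (X_norm \<Omega> \<kappa>) S \<and>
     generator (X_space \<Omega> \<kappa>) (X_norm \<Omega> \<kappa>) S = A_cl \<Omega> \<kappa> xs gain"

definition R_cl ::
    "(real^3) set \<Rightarrow> real \<Rightarrow> (real \<Rightarrow> functional \<Rightarrow> functional) \<Rightarrow> functional \<Rightarrow> functional" where
  "R_cl \<Omega> \<kappa> S \<eta> =
     (THE r. has_improper_integral (X_space \<Omega> \<kappa>) (X_norm \<Omega> \<kappa>) (\<lambda>t. S t \<eta>) r)"

definition T_N ::
    "(real^3) set \<Rightarrow> real \<Rightarrow> (nat \<Rightarrow> sfun) \<Rightarrow> nat \<Rightarrow> ('m::finite \<Rightarrow> real^3) \<Rightarrow>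
     (real \<Rightarrow> functional \<Rightarrow> functional) \<Rightarrow> (functional \<Rightarrow> real^'m) \<Rightarrow> functional \<Rightarrow> functional" where
  "T_N \<Omega> \<kappa> \<phi> N xs S U y =
     P_N \<Omega> \<phi> N (R_cl \<Omega> \<kappa> S (Q_N \<Omega> \<phi> N (B_op \<Omega> xs (U y))))"

end

theory Submission
  imports Defs
begin

text \<open>\<open>\<X>\<close> is a Hilbert space: mapping \<open>\<eta>\<close> to the Fourier coefficients of \<open>\<A>\<^sup>-\<^sup>1 \<eta>\<close> in the eigenbasis
  identifies it isometrically with \<open>\<ell>\<^sup>2\<close>, and in these coordinates \<open>P\<^sub>N\<close> and \<open>Q\<^sub>N\<close> are coordinate
  projections, hence contractions. Exponential decay makes \<open>R\<^sub>c\<^sub>l\<close> a bounded operator of norm at most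
  \<open>K\<^sub>0 / \<alpha>\<close>, so \<open>T\<^sub>N\<close> has norm at most \<open>(K\<^sub>0 / \<alpha>) \<parallel>B\<parallel> \<parallel>U\<^sub>N\<parallel> < 1\<close> on \<open>X\<^sub>N\<close> and Banach's fixed point
  theorem applies. Linearity of the weak Laplacian needs uniqueness of weak derivatives, that is, the
  fundamental lemma of the calculus of variations. Neither elliptic regularity nor a Sobolev
  embedding is needed: that the range of \<open>B\<close> lies in \<open>\<X>\<close> is read off from the generator of the
  closed loop.\<close>


section \<open>The Hilbert space of square-summable sequences\<close>

text \<open>The statement speaks of a set of functions whose norm is defined through a choice,
  whereas Henstock-Kurzweil integration and Banach's fixed point theorem live on Banach space types.
  This is why \<open>ell2\<close> is a type of its own and why the analysis is transported to it
  along \<open>X_coords\<close>. The eigenbasis diagonalizes \<A> by Green's formula, which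
  \<open>dom_A0\<close> encodes as a vanishing normal trace; the coordinates of \<eta> are therefore
  its values at the eigenfunctions divided by the eigenvalues of \<A>. The norm
  \<open>X_norm\<close> gets its meaning only when every functional in \<open>X_space\<close> is
  known to come from some w in L2, and producing w from its coefficients is the Riesz-Fischer
  theorem. Functions are not identified modulo null sets, so statements about L2 hold almost
  everywhere or are phrased through Fourier coefficients, where equality is genuine. Operator norms
  stay in \<open>ennreal\<close> until the last estimate, because the hypothesis bounds their
  product and not the single factors.\<close>

typedef ell2 = "{a :: nat \<Rightarrow> real. summable (\<lambda>n. (a n)\<^sup>2)}"
  morphisms ell2_nth Abs_ell2
  by (rule exI[of _ "\<lambda>_. 0"]) simp

lemma summable_ell2_nth_square: "summable (\<lambda>n. (ell2_nth a n)\<^sup>2)"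
  using ell2_nth[of a] by simp

lemma ell2_nth_Abs [simp]: "summable (\<lambda>n. (a n)\<^sup>2) \<Longrightarrow> ell2_nth (Abs_ell2 a) = a"
  by (simp add: Abs_ell2_inverse)

lemma ell2_eqI: "(\<And>n. ell2_nth a n = ell2_nth b n) \<Longrightarrow> a = b"
  by (metis ell2_nth_inject ext)

lemma summable_mult_of_squares:
  fixes a b :: "nat \<Rightarrow> real"
  assumes "summable (\<lambda>n. (a n)\<^sup>2)" "summable (\<lambda>n. (b n)\<^sup>2)"
  shows "summable (\<lambda>n. a n * b n)"
proof (rule summable_comparison_test')
  show "summable (\<lambda>n. (a n)\<^sup>2 + (b n)\<^sup>2)"
    using assms by (rule summable_add)
  show "norm (a n * b n) \<le> (a n)\<^sup>2 + (b n)\<^sup>2" for n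
  proof -
    have "0 \<le> (\<bar>a n\<bar> - \<bar>b n\<bar>)\<^sup>2" "0 \<le> \<bar>a n\<bar> * \<bar>b n\<bar>" by auto
    then have "\<bar>a n\<bar> * \<bar>b n\<bar> \<le> (a n)\<^sup>2 + (b n)\<^sup>2"
      unfolding power2_diff power2_abs by linarith
    then show ?thesis by (simp add: abs_mult)
  qed
qed

lemma summable_square_lincomb:
  fixes a b :: "nat \<Rightarrow> real"
  assumes "summable (\<lambda>n. (a n)\<^sup>2)" "summable (\<lambda>n. (b n)\<^sup>2)"
  shows "summable (\<lambda>n. (c * a n + d * b n)\<^sup>2)"
proof -
  have "summable (\<lambda>n. c\<^sup>2 * (a n)\<^sup>2 + d\<^sup>2 * (b n)\<^sup>2 + 2 * c * d * (a n * b n))"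
    by (intro summable_add summable_mult assms summable_mult_of_squares)
  then show ?thesis
    by (rule summable_cong[THEN iffD1, rotated]) (simp add: power2_eq_square algebra_simps)
qed

instantiation ell2 :: real_inner
begin

definition zero_ell2 :: ell2 where "0 = Abs_ell2 (\<lambda>_. 0)"
definition plus_ell2 :: "ell2 \<Rightarrow> ell2 \<Rightarrow> ell2"
  where "a + b = Abs_ell2 (\<lambda>n. ell2_nth a n + ell2_nth b n)"
definition minus_ell2 :: "ell2 \<Rightarrow> ell2 \<Rightarrow> ell2"
  where "a - b = Abs_ell2 (\<lambda>n. ell2_nth a n - ell2_nth b n)"
definition uminus_ell2 :: "ell2 \<Rightarrow> ell2"
  where "- a = Abs_ell2 (\<lambda>n. - ell2_nth a n)"
definition scaleR_ell2 :: "real \<Rightarrow> ell2 \<Rightarrow> ell2"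
  where "c *\<^sub>R a = Abs_ell2 (\<lambda>n. c * ell2_nth a n)"
definition inner_ell2 :: "ell2 \<Rightarrow> ell2 \<Rightarrow> real"
  where "a \<bullet> b = (\<Sum>n. ell2_nth a n * ell2_nth b n)"
definition norm_ell2 :: "ell2 \<Rightarrow> real" where "norm a = sqrt (a \<bullet> (a :: ell2))"
definition sgn_ell2 :: "ell2 \<Rightarrow> ell2" where "sgn a = inverse (norm a) *\<^sub>R (a :: ell2)"
definition dist_ell2 :: "ell2 \<Rightarrow> ell2 \<Rightarrow> real" where "dist a b = norm (a - b :: ell2)"
definition uniformity_ell2 :: "(ell2 \<times> ell2) filter"
  where "uniformity = (INF e\<in>{0<..}. principal {(a :: ell2, b). dist a b < e})"
definition open_ell2 :: "ell2 set \<Rightarrow> bool"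
  where "open U = (\<forall>x\<in>U. \<forall>\<^sub>F (x', y) in uniformity. x' = x \<longrightarrow> y \<in> (U :: ell2 set))"

lemma ell2_nth_zero [simp]: "ell2_nth 0 n = 0"
  and ell2_nth_add [simp]: "ell2_nth (a + b) n = ell2_nth a n + ell2_nth b n"
  and ell2_nth_diff [simp]: "ell2_nth (a - b) n = ell2_nth a n - ell2_nth b n"
  and ell2_nth_uminus [simp]: "ell2_nth (- a) n = - ell2_nth a n"
  and ell2_nth_scaleR [simp]: "ell2_nth (c *\<^sub>R a) n = c * ell2_nth a n"
  using summable_square_lincomb[OF summable_ell2_nth_square[of a] summable_ell2_nth_square[of b], of 1 1]
    summable_square_lincomb[OF summable_ell2_nth_square[of a] summable_ell2_nth_square[of b], of 1 "-1"]
    summable_ell2_nth_square[of a] summable_mult[OF summable_ell2_nth_square[of a], of "c\<^sup>2"]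
  by (simp_all add: zero_ell2_def plus_ell2_def minus_ell2_def uminus_ell2_def scaleR_ell2_def
      power_mult_distrib)

instance
proof
  fix a b c :: ell2 and r s :: real
  note summ = summable_mult_of_squares[OF summable_ell2_nth_square summable_ell2_nth_square]
  show "a + b + c = a + (b + c)" "a + b = b + a" "0 + a = a" "- a + a = 0" "a - b = a + - b"
    "r *\<^sub>R (a + b) = r *\<^sub>R a + r *\<^sub>R b" "(r + s) *\<^sub>R a = r *\<^sub>R a + s *\<^sub>R a"
    "r *\<^sub>R s *\<^sub>R a = (r * s) *\<^sub>R a" "1 *\<^sub>R a = a"
    by (auto intro!: ell2_eqI simp: algebra_simps)
  show "a \<bullet> b = b \<bullet> a"
    by (simp add: inner_ell2_def mult.commute)
  show "(a + b) \<bullet> c = a \<bullet> c + b \<bullet> c"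
    using summ by (simp add: inner_ell2_def algebra_simps suminf_add)
  show "(r *\<^sub>R a) \<bullet> b = r * (a \<bullet> b)"
    using summ by (simp add: inner_ell2_def algebra_simps suminf_mult)
  show "0 \<le> a \<bullet> a"
    using summ by (simp add: inner_ell2_def suminf_nonneg)
  show "(a \<bullet> a = 0) = (a = 0)"
    using suminf_eq_zero_iff[OF summ[of a a]] by (auto simp: inner_ell2_def intro!: ell2_eqI)
qed (auto simp: norm_ell2_def sgn_ell2_def dist_ell2_def uniformity_ell2_def open_ell2_def)

end

lemma norm_ell2_square: "(norm a)\<^sup>2 = (\<Sum>n. (ell2_nth a n)\<^sup>2)"
  by (simp add: power2_norm_eq_inner) (simp add: inner_ell2_def power2_eq_square)

lemma ell2_nth_sums_inner: "(\<lambda>n. ell2_nth a n * ell2_nth b n) sums (a \<bullet> b)"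
  using summable_mult_of_squares[OF summable_ell2_nth_square summable_ell2_nth_square]
  by (simp add: inner_ell2_def summable_sums)

lemma ell2_nth_square_sums: "(\<lambda>n. (ell2_nth a n)\<^sup>2) sums (norm a)\<^sup>2"
  by (simp add: norm_ell2_square summable_sums summable_ell2_nth_square)

lemma sum_ell2_nth_square_le: "(\<Sum>n<m. (ell2_nth a n)\<^sup>2) \<le> (norm a)\<^sup>2"
  unfolding norm_ell2_square by (rule sum_le_suminf) (auto simp: summable_ell2_nth_square)

lemma abs_ell2_nth_le: "\<bar>ell2_nth a n\<bar> \<le> norm a"
proof -
  have "(ell2_nth a n)\<^sup>2 \<le> (\<Sum>k<Suc n. (ell2_nth a k)\<^sup>2)"
    by (rule member_le_sum) auto
  also have "\<dots> \<le> (norm a)\<^sup>2"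
    by (rule sum_ell2_nth_square_le)
  finally show ?thesis
    using abs_le_square_iff[of "ell2_nth a n" "norm a"] by simp
qed

lemma bounded_linear_ell2_nth: "bounded_linear (\<lambda>a. ell2_nth a n)"
  by (rule bounded_linear_intro[of _ 1]) (auto simp: abs_ell2_nth_le)

text \<open>Domination in each coordinate is the form in which contractivity of the projectors and
  the bound of a function by its image under \<A> are obtained.\<close>

lemma norm_ell2_mono:
  assumes "\<And>n. \<bar>ell2_nth a n\<bar> \<le> \<bar>ell2_nth b n\<bar>"
  shows "norm a \<le> norm b"
proof -
  have "(norm a)\<^sup>2 \<le> (norm b)\<^sup>2"
    unfolding norm_ell2_square
    by (intro suminf_le summable_ell2_nth_square abs_le_square_iff[THEN iffD1] assms)
  then show ?thesis by (rule power2_le_imp_le) simp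
qed

lemma summable_square_bounded:
  fixes a :: "nat \<Rightarrow> real"
  assumes "\<And>m. (\<Sum>n<m. (a n)\<^sup>2) \<le> C"
  shows "summable (\<lambda>n. (a n)\<^sup>2)" "(\<Sum>n. (a n)\<^sup>2) \<le> C"
proof -
  show s: "summable (\<lambda>n. (a n)\<^sup>2)"
  proof (rule bounded_imp_summable[of _ C])
    fix n
    show "(\<Sum>k\<le>n. (a k)\<^sup>2) \<le> C"
      using assms[of "Suc n"] by (simp add: lessThan_Suc_atMost)
  qed simp
  show "(\<Sum>n. (a n)\<^sup>2) \<le> C"
    by (rule suminf_le_const[OF s assms])
qed

instance ell2 :: banach
proof
  fix X :: "nat \<Rightarrow> ell2"
  assume X: "Cauchy X"
  have "convergent (\<lambda>m. ell2_nth (X m) k)" for k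
    using bounded_linear.Cauchy[OF bounded_linear_ell2_nth X] by (simp add: Cauchy_convergent_iff)
  then obtain a where a: "(\<lambda>m. ell2_nth (X m) k) \<longlonglongrightarrow> a k" for k
    unfolding convergent_def by metis
  \<comment> \<open>Only finite partial sums are compared, since there the limit in n may be taken
    termwise. A bound uniform in K then yields both the summability of \<open>a\<close> and
    convergence in norm.\<close>
  have *: "\<exists>M. \<forall>m\<ge>M. \<forall>K. (\<Sum>k<K. (ell2_nth (X m) k - a k)\<^sup>2) \<le> e\<^sup>2" if "e > 0" for e
  proof -
    obtain M where M: "\<And>m n. m \<ge> M \<Longrightarrow> n \<ge> M \<Longrightarrow> norm (X m - X n) < e"
      using X[unfolded Cauchy_iff, rule_format, OF \<open>e > 0\<close>] by blast
    show ?thesis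
    proof (intro exI[of _ M] allI impI)
      fix m K assume "m \<ge> M"
      have "(\<lambda>n. \<Sum>k<K. (ell2_nth (X m) k - ell2_nth (X n) k)\<^sup>2)
          \<longlonglongrightarrow> (\<Sum>k<K. (ell2_nth (X m) k - a k)\<^sup>2)"
        by (intro tendsto_intros a)
      moreover have "\<forall>\<^sub>F n in sequentially. (\<Sum>k<K. (ell2_nth (X m) k - ell2_nth (X n) k)\<^sup>2) \<le> e\<^sup>2"
        using eventually_ge_at_top[of M]
      proof eventually_elim
        case (elim n)
        have "(\<Sum>k<K. (ell2_nth (X m) k - ell2_nth (X n) k)\<^sup>2) \<le> (norm (X m - X n))\<^sup>2"
          using sum_ell2_nth_square_le[of "X m - X n" K] by simp
        also have "\<dots> \<le> e\<^sup>2"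
          using M[OF \<open>m \<ge> M\<close> elim] by (intro power_mono) auto
        finally show ?case .
      qed
      ultimately show "(\<Sum>k<K. (ell2_nth (X m) k - a k)\<^sup>2) \<le> e\<^sup>2"
        by (rule tendsto_upperbound) simp
    qed
  qed
  have "summable (\<lambda>k. (a k)\<^sup>2)"
  proof -
    obtain M where M: "\<And>K. (\<Sum>k<K. (ell2_nth (X M) k - a k)\<^sup>2) \<le> 1"
      using *[of 1] by auto
    show ?thesis
      using summable_square_lincomb[OF summable_ell2_nth_square[of "X M"]
          summable_square_bounded(1)[OF M], of 1 "-1"]
      by simp
  qed
  then have nth: "ell2_nth (Abs_ell2 a) = a"
    by simp
  have "X \<longlonglongrightarrow> Abs_ell2 a"
  proof (rule LIMSEQ_I)
    fix r :: real assume "r > 0"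
    then obtain M where M: "\<And>m K. m \<ge> M \<Longrightarrow> (\<Sum>k<K. (ell2_nth (X m) k - a k)\<^sup>2) \<le> (r/2)\<^sup>2"
      using *[of "r/2"] by auto
    have "norm (X m - Abs_ell2 a) < r" if "m \<ge> M" for m
    proof -
      have "(norm (X m - Abs_ell2 a))\<^sup>2 \<le> (r/2)\<^sup>2"
        unfolding norm_ell2_square by (simp add: nth summable_square_bounded(2)[OF M[OF that]])
      then have "norm (X m - Abs_ell2 a) \<le> r/2"
        by (rule power2_le_imp_le) (use \<open>r > 0\<close> in simp)
      then show ?thesis using \<open>r > 0\<close> by simp
    qed
    then show "\<exists>no. \<forall>n\<ge>no. norm (X n - Abs_ell2 a) < r" by blast
  qed
  then show "convergent X"
    by (auto simp: convergent_def)
qed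


section \<open>Bump functions and the fundamental lemma of the calculus of variations\<close>

lemma Ck_on_continuous: "Ck_on n S f \<Longrightarrow> continuous_on S f"
  by (cases n) (auto intro!: continuous_at_imp_continuous_on differentiable_imp_continuous_within)

lemma Ck_on_SucD: "Ck_on (Suc n) S f \<Longrightarrow> Ck_on n S f"
proof (induction n arbitrary: f)
  case 0
  then show ?case using Ck_on_continuous[OF 0] by simp
qed auto

lemma Ck_on_const: "Ck_on n UNIV (\<lambda>_. c)"
  by (induction n arbitrary: c) auto

lemma Ck_on_add:
  assumes "Ck_on n UNIV f" "Ck_on n UNIV g"
  shows "Ck_on n UNIV (\<lambda>x. f x + g x)"
  using assms
proof (induction n arbitrary: f g)
  case 0
  then show ?case by (auto intro: continuous_on_add)
next
  case (Suc n)
  have "frechet_derivative (\<lambda>x. f x + g x) (at x) i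
      = frechet_derivative f (at x) i + frechet_derivative g (at x) i" for x i
    using Suc.prems by (subst frechet_derivative_at[symmetric])
      (auto intro!: derivative_eq_intros simp: frechet_derivative_works)
  then show ?case using Suc by auto
qed

lemma Ck_on_mult:
  assumes "Ck_on n UNIV f" "Ck_on n UNIV g"
  shows "Ck_on n UNIV (\<lambda>x. f x * g x)"
  using assms
proof (induction n arbitrary: f g)
  case 0
  then show ?case by (auto intro: continuous_on_mult)
next
  case (Suc n)
  have "frechet_derivative (\<lambda>x. f x * g x) (at x) i
      = f x * frechet_derivative g (at x) i + frechet_derivative f (at x) i * g x" for x i
    using Suc.prems by (subst frechet_derivative_at[symmetric])
      (auto intro!: derivative_eq_intros simp: frechet_derivative_works)
  then show ?case
    using Suc.prems Ck_on_SucD[OF Suc.prems(1)] Ck_on_SucD[OF Suc.prems(2)]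
    by (auto intro!: Ck_on_add Suc.IH)
qed

lemma Ck_on_prod: "(\<And>i. i \<in> I \<Longrightarrow> Ck_on n UNIV (f i)) \<Longrightarrow> Ck_on n UNIV (\<lambda>x. \<Prod>i\<in>I. f i x)"
  by (induction I rule: infinite_finite_induct) (auto intro: Ck_on_mult Ck_on_const)

text \<open>A whole family closed under differentiation is needed: a partial derivative of
  \<open>G k\<close> composed with p is \<open>G (Suc k)\<close> composed with p, times a derivative
  of p, so the induction must leave k arbitrary.\<close>

lemma Ck_on_compose_real:
  fixes G :: "nat \<Rightarrow> real \<Rightarrow> real"
  assumes G: "\<And>k t. (G k has_real_derivative G (Suc k) t) (at t)"
    and p: "\<And>m. m \<le> n \<Longrightarrow> Ck_on m UNIV p"
  shows "Ck_on n UNIV (\<lambda>x. G k (p x))"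
  using p
proof (induction n arbitrary: k)
  case 0
  have "continuous_on UNIV (G k)"
    using G by (meson DERIV_isCont continuous_at_imp_continuous_on)
  then show ?case
    using 0 continuous_on_compose2[of UNIV "G k" UNIV p] by auto
next
  case (Suc n)
  have p: "p differentiable (at x)" for x
    using Suc.prems[of "Suc n"] by simp
  have d: "((\<lambda>x. G k (p x)) has_derivative (\<lambda>h. G (Suc k) (p x) * frechet_derivative p (at x) h)) (at x)" for x
    using has_derivative_compose[OF p[of x, unfolded frechet_derivative_works]
        G[of k "p x", unfolded has_field_derivative_def]] .
  have "frechet_derivative (\<lambda>x. G k (p x)) (at x) i = G (Suc k) (p x) * frechet_derivative p (at x) i" for x i
    using frechet_derivative_at[OF d[of x]] by metis
  moreover have "(\<lambda>x. G k (p x)) differentiable (at x)" for x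
    using d[of x] by (rule differentiableI)
  moreover have "Ck_on n UNIV (\<lambda>x. G (Suc k) (p x))"
    by (rule Suc.IH) (use Suc.prems in auto)
  moreover have "\<forall>i\<in>Basis. Ck_on n UNIV (\<lambda>x. frechet_derivative p (at x) i)"
    using Suc.prems[of "Suc n"] by simp
  ultimately show ?case
    by (auto intro!: Ck_on_mult)
qed

lemma Ck_on_affine: "Ck_on n UNIV (\<lambda>x. c * (x \<bullet> i) + d)"
proof (cases n)
  case (Suc m)
  have d: "((\<lambda>x. c * (x \<bullet> i) + d) has_derivative (\<lambda>h. c * (h \<bullet> i))) (at x)" for x
    by (auto intro!: derivative_eq_intros)
  have "frechet_derivative (\<lambda>x. c * (x \<bullet> i) + d) (at x) j = c * (j \<bullet> i)" for x j
    using frechet_derivative_at[OF d[of x]] by metis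
  moreover have "(\<lambda>x. c * (x \<bullet> i) + d) differentiable (at x)" for x
    using d[of x] by (rule differentiableI)
  ultimately show ?thesis
    using Suc by (auto simp: Ck_on_const)
qed (auto intro!: continuous_intros)

text \<open>All derivatives of \<open>exp (-1/t)\<close>, extended by \<open>0\<close> to \<open>t \<le> 0\<close>, are of this form.\<close>

definition flat_exp :: "real poly \<Rightarrow> real \<Rightarrow> real" where
  "flat_exp P t = (if t \<le> 0 then 0 else poly P (1 / t) * exp (- (1 / t)))"

lemma tendsto_poly_mult_exp_minus: "((\<lambda>t :: real. poly P t * exp (- t)) \<longlongrightarrow> 0) at_top"
proof -
  have "((\<lambda>t. \<Sum>i\<le>degree P. coeff P i * (t ^ i / exp t)) \<longlongrightarrow> (\<Sum>i\<le>degree P. coeff P i * 0)) at_top"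
    by (intro tendsto_intros tendsto_power_div_exp_0)
  then show ?thesis
    by (simp add: poly_altdef sum_distrib_right exp_minus divide_inverse mult.assoc)
qed

lemma flat_exp_tendsto_0: "(flat_exp P \<longlongrightarrow> 0) (at_right 0)"
proof -
  have "((\<lambda>t. poly P (inverse t) * exp (- inverse t)) \<longlongrightarrow> 0) (at_right 0)"
    by (rule filterlim_compose[OF tendsto_poly_mult_exp_minus filterlim_inverse_at_top_right])
  moreover have "\<forall>\<^sub>F t in at_right 0. poly P (inverse t) * exp (- inverse t) = flat_exp P t"
    using eventually_at_right_less[of "0::real"]
    by eventually_elim (simp add: flat_exp_def divide_inverse)
  ultimately show ?thesis
    by (rule Lim_transform_eventually)
qed

text \<open>With s = 1/t one has ds/dt = -s^2, so the derivative of P(s) exp(-s) is s^2 (P(s) -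
  P'(s)) exp(-s); the factor s^2 is \<open>[:0, 0, 1:]\<close>. At t = 0 the right difference
  quotient is s P(s) exp(-s), again a \<open>flat_exp\<close>, which tends to 0.\<close>

lemma flat_exp_has_derivative:
  "(flat_exp P has_real_derivative flat_exp ([:0, 0, 1:] * (P - pderiv P)) t) (at t)"
proof -
  consider "t < 0" | "t = 0" | "t > 0" by linarith
  then show ?thesis
  proof cases
    case 1
    have "((\<lambda>_. 0) has_real_derivative flat_exp ([:0, 0, 1:] * (P - pderiv P)) t) (at t)"
      using 1 by (simp add: flat_exp_def)
    then show ?thesis
      by (rule has_field_derivative_transform_within_open[where S = "{..<0}"])
        (use 1 in \<open>auto simp: flat_exp_def\<close>)
  next
    case 2
    have "((\<lambda>h. (flat_exp P h - flat_exp P 0) / (h - 0)) \<longlongrightarrow> 0) (at 0)"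
    proof (rule filterlim_split_at)
      have "\<forall>\<^sub>F h in at_left 0. 0 = (flat_exp P h - flat_exp P 0) / (h - 0)"
        using eventually_at_left_real[of "-1" "0::real"]
        by (rule eventually_mono) (auto simp: flat_exp_def)
      then show "((\<lambda>h. (flat_exp P h - flat_exp P 0) / (h - 0)) \<longlongrightarrow> 0) (at_left 0)"
        by (rule Lim_transform_eventually[OF tendsto_const])
      have "\<forall>\<^sub>F h in at_right 0. flat_exp ([:0, 1:] * P) h = (flat_exp P h - flat_exp P 0) / (h - 0)"
        using eventually_at_right_less[of "0::real"]
        by (rule eventually_mono) (auto simp: flat_exp_def)
      then show "((\<lambda>h. (flat_exp P h - flat_exp P 0) / (h - 0)) \<longlongrightarrow> 0) (at_right 0)"
        by (rule Lim_transform_eventually[OF flat_exp_tendsto_0])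
    qed
    then show ?thesis
      using 2 by (simp add: has_field_derivative_iff flat_exp_def)
  next
    case 3
    have "((\<lambda>t. poly P (1 / t) * exp (- (1 / t))) has_real_derivative
        flat_exp ([:0, 0, 1:] * (P - pderiv P)) t) (at t)"
      using 3 by (auto intro!: derivative_eq_intros
          simp: flat_exp_def field_simps power2_eq_square)
    then show ?thesis
      by (rule has_field_derivative_transform_within_open[where S = "{0<..}"])
        (use 3 in \<open>auto simp: flat_exp_def\<close>)
  qed
qed

text \<open>Iterates the derivative rule, so that \<open>flat_exp (flat_exp_poly k)\<close> is the
  k-th derivative of \<open>flat_exp 1\<close>; this is the family that
  \<open>Ck_on_compose_real\<close> asks for.\<close>

primrec flat_exp_poly :: "nat \<Rightarrow> real poly" where
  "flat_exp_poly 0 = 1"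
| "flat_exp_poly (Suc k) = [:0, 0, 1:] * (flat_exp_poly k - pderiv (flat_exp_poly k))"

definition bump :: "'a::euclidean_space \<Rightarrow> 'a \<Rightarrow> 'a \<Rightarrow> real" where
  "bump a b x = (\<Prod>i\<in>Basis. flat_exp 1 (x \<bullet> i - a \<bullet> i) * flat_exp 1 (b \<bullet> i - x \<bullet> i))"

lemma flat_exp_1_eq_0_iff: "flat_exp 1 t = 0 \<longleftrightarrow> t \<le> 0"
  and flat_exp_1_nonneg: "flat_exp 1 t \<ge> 0"
  by (auto simp: flat_exp_def)

lemma bump_nonneg: "bump a b x \<ge> 0"
  by (auto simp: bump_def intro!: prod_nonneg mult_nonneg_nonneg flat_exp_1_nonneg)

lemma bump_eq_0_iff: "bump a b x = 0 \<longleftrightarrow> x \<notin> box a b"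
  by (auto simp: bump_def mem_box flat_exp_1_eq_0_iff not_less)

lemma Ck_on_bump: "Ck_on n UNIV (bump a b)"
proof -
  have *: "Ck_on n UNIV (\<lambda>x. flat_exp (flat_exp_poly 0) (c * (x \<bullet> i) + d))" for c d and i :: 'a
    by (rule Ck_on_compose_real[where G = "\<lambda>k. flat_exp (flat_exp_poly k)"])
      (auto intro: Ck_on_affine flat_exp_has_derivative simp del: mult_pCons_left)
  show ?thesis
    unfolding bump_def
    using *[of 1 _ "- (a \<bullet> _)"] *[of "-1" _ "b \<bullet> _"]
    by (intro Ck_on_prod Ck_on_mult) simp_all
qed

text \<open>As m grows these functions increase to the indicator of the open box, with values in
  [0, 1] and support in the fixed closed box. Dominated convergence thus turns integrals against
  test functions into integrals over boxes.\<close>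

definition plateau :: "nat \<Rightarrow> 'a::euclidean_space \<Rightarrow> 'a \<Rightarrow> 'a \<Rightarrow> real" where
  "plateau m a b x = 1 - exp (- (real m * bump a b x))"

lemma Ck_on_plateau: "Ck_on n UNIV (plateau m a b)"
proof -
  \<comment> \<open>The index 0 is separate because the constant 1 disappears at the first
    differentiation.\<close>
  define G where "G k t = (if k = 0 then 1 - exp (- (real m * t)) else - ((- real m) ^ k * exp (- (real m * t))))"
    for k t
  have "(G k has_real_derivative G (Suc k) t) (at t)" for k t
    by (cases "k = 0") (auto simp: G_def[abs_def] intro!: derivative_eq_intros)
  then have "Ck_on n UNIV (\<lambda>x. G 0 (bump a b x))"
    by (rule Ck_on_compose_real) (rule Ck_on_bump)
  then show ?thesis by (simp add: G_def plateau_def[abs_def])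
qed

lemma plateau_bounds: "0 \<le> plateau m a b x" "plateau m a b x \<le> 1"
  using bump_nonneg[of a b x] by (auto simp: plateau_def)

lemma plateau_outside: "x \<notin> box a b \<Longrightarrow> plateau m a b x = 0"
  by (simp add: plateau_def bump_eq_0_iff[symmetric])

lemma plateau_tendsto: "(\<lambda>m. plateau m a b x) \<longlonglongrightarrow> indicat_real (box a b) x"
proof (cases "x \<in> box a b")
  case True
  then have "bump a b x > 0"
    using bump_nonneg[of a b x] bump_eq_0_iff[of a b x] by linarith
  then have "(\<lambda>m. exp (- bump a b x) ^ m) \<longlonglongrightarrow> 0"
    by (auto intro: LIMSEQ_power_zero)
  then have "(\<lambda>m. 1 - exp (- bump a b x) ^ m) \<longlonglongrightarrow> 1 - 0"
    by (rule tendsto_diff[OF tendsto_const])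
  then show ?thesis
    using True by (simp add: plateau_def exp_of_nat_mult[symmetric])
qed (simp add: plateau_outside)

lemma plateau_test_function:
  assumes "cbox a b \<subseteq> \<Omega>"
  shows "plateau m a b \<in> test_functions \<Omega>"
proof -
  have "closure {x. plateau m a b x \<noteq> 0} \<subseteq> closure (box a b)"
    by (rule closure_mono) (use plateau_outside in blast)
  also have "\<dots> \<subseteq> cbox a b"
    by (intro closure_minimal box_subset_cbox closed_cbox)
  finally have "closure {x. plateau m a b x \<noteq> 0} \<subseteq> cbox a b" .
  then show ?thesis
    using assms compact_Int_closed[OF compact_cbox[of a b] closed_closure, of "{x. plateau m a b x \<noteq> 0}"]
    by (auto simp: test_functions_def Ck_on_plateau Int_absorb1)
qed

section \<open>Functions determined by their integrals over sets\<close>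

lemma AE_zero_of_null_integrals:
  fixes g :: "'a \<Rightarrow> real"
  assumes g: "integrable M g"
    and null: "\<And>A. A \<in> sets M \<Longrightarrow> (\<integral>x. indicat_real A x * g x \<partial>M) = 0"
  shows "AE x in M. g x = 0"
proof -
  \<comment> \<open>The sign c selects the positive or the negative part of g; each is the integrand
    over the measurable set where c g is positive.\<close>
  have 1: "AE x in M. max 0 (c * g x) = 0" if "c = 1 \<or> c = -1" for c
  proof -
    let ?A = "{x \<in> space M. 0 < c * g x}"
    have A: "?A \<in> sets M" using g by measurable
    have eq: "c * (indicat_real ?A x * g x) = max 0 (c * g x)" if "x \<in> space M" for x
      using that by (auto simp: indicator_def)
    have "(\<integral>x. c * (indicat_real ?A x * g x) \<partial>M) = c * 0"
      using null[OF A] by (subst integral_mult_right_zero) simp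
    then have "(\<integral>x. max 0 (c * g x) \<partial>M) = 0"
      using Bochner_Integration.integral_cong[OF refl eq, of M] by (simp del: integral_mult_right_zero)
    moreover have "integrable M (\<lambda>x. max 0 (c * g x))"
      using g by auto
    ultimately show ?thesis
      by (subst (asm) integral_nonneg_eq_0_iff_AE) auto
  qed
  show ?thesis
    using 1[of 1, simplified] 1[of "-1", simplified] by eventually_elim auto
qed

text \<open>Dynkin's argument: open boxes are stable under intersection and generate the Borel sets,
  and the sets over which g has integral zero are closed under complements and countable disjoint
  unions.\<close>

lemma AE_zero_of_null_box_integrals:
  fixes g :: "'a::euclidean_space \<Rightarrow> real"
  assumes g: "integrable lborel g"
    and null: "\<And>a b. (\<integral>x. indicat_real (box a b) x * g x \<partial>lborel) = 0"
  shows "AE x in lborel. g x = 0"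
proof (rule AE_zero_of_null_integrals[OF g])
  fix A :: "'a set" assume "A \<in> sets lborel"
  then have A: "A \<in> sigma_sets UNIV (range (\<lambda>(a, b). box a b))"
    by (simp add: borel_eq_box)
  have stable: "Int_stable (range (\<lambda>(a, b). box a b :: 'a set))"
    by (auto simp: Int_stable_def box_Int_box)
  have sets: "B \<in> sets borel" if "B \<in> sigma_sets UNIV (range (\<lambda>(a, b). box a b))" for B :: "'a set"
    using that by (simp add: borel_eq_box)
  have int: "integrable lborel (\<lambda>x. indicat_real B x * g x)" if "B \<in> sets borel" for B
    using integrable_mult_indicator[OF _ g, of B] that by simp
  \<comment> \<open>Complements require the integral over the whole space to vanish; it is the limit
    of the integrals over growing cubes.\<close>
  have whole: "(\<integral>x. g x \<partial>lborel) = 0"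
  proof (rule LIMSEQ_unique)
    let ?B = "\<lambda>n::nat. box (- real n *\<^sub>R One) (real n *\<^sub>R One) :: 'a set"
    show "(\<lambda>n. \<integral>x. indicat_real (?B n) x * g x \<partial>lborel) \<longlonglongrightarrow> (\<integral>x. g x \<partial>lborel)"
    proof (rule integral_dominated_convergence[where w = "\<lambda>x. \<bar>g x\<bar>"])
      show "AE x in lborel. (\<lambda>n. indicat_real (?B n) x * g x) \<longlonglongrightarrow> g x"
      proof (rule AE_I2)
        fix x :: 'a
        obtain m :: nat where m: "norm x < real m"
          using reals_Archimedean2 by blast
        have inB: "x \<in> ?B n" if "n \<ge> m" for n
        proof -
          have "\<bar>x \<bullet> i\<bar> < real n" if "i \<in> Basis" for i
            using Basis_le_norm[OF that, of x] m \<open>n \<ge> m\<close> by linarith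
          then show ?thesis by (force simp: mem_box abs_less_iff)
        qed
        have "\<forall>\<^sub>F n in sequentially. g x = indicat_real (?B n) x * g x"
          using eventually_ge_at_top[of m] by eventually_elim (simp only: inB indicator_simps mult_1)
        then show "(\<lambda>n. indicat_real (?B n) x * g x) \<longlonglongrightarrow> g x"
          by (rule Lim_transform_eventually[OF tendsto_const])
      qed
      show "AE x in lborel. norm (indicat_real (?B n) x * g x) \<le> \<bar>g x\<bar>" for n
        by (auto simp: indicator_def)
      show "integrable lborel (\<lambda>x. \<bar>g x\<bar>)" using g by simp
      show "(\<lambda>x. indicat_real (?B n) x * g x) \<in> borel_measurable lborel" for n
        using int[of "?B n"] by auto
    qed (use g in auto)
    show "(\<lambda>n. \<integral>x. indicat_real (?B n) x * g x \<partial>lborel) \<longlonglongrightarrow> 0"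
      by (simp add: null)
  qed
  show "(\<integral>x. indicat_real A x * g x \<partial>lborel) = 0"
    using stable subset_UNIV[THEN PowI[THEN subsetI]] A
  proof (induction rule: sigma_sets_induct_disjoint[consumes 3])
    case (basic B)
    then show ?case using null by auto
  next
    case empty
    then show ?case by simp
  next
    case (compl B)
    have "(\<integral>x. indicat_real (UNIV - B) x * g x \<partial>lborel) = (\<integral>x. g x - indicat_real B x * g x \<partial>lborel)"
      by (intro Bochner_Integration.integral_cong) (auto simp: indicator_def)
    also have "\<dots> = (\<integral>x. g x \<partial>lborel) - (\<integral>x. indicat_real B x * g x \<partial>lborel)"
      by (rule Bochner_Integration.integral_diff[OF g int[OF sets[OF compl.hyps]]])
    finally show ?case using compl whole by simp
  next
    case (union B)
    have B: "B i \<in> sets lborel" for i using union(2) sets by auto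
    have si: "set_integrable lborel (\<Union>i. B i) g"
      unfolding set_integrable_def using int[OF sets.countable_UN[of B UNIV borel]] B
      by (auto simp: image_subset_iff)
    have "(\<integral>x. indicat_real (\<Union>i. B i) x * g x \<partial>lborel) = (LINT x:(\<Union>i. B i)|lborel. g x)"
      by (simp add: set_lebesgue_integral_def)
    also have "\<dots> = (\<Sum>i. (LINT x:(B i)|lborel. g x))"
      by (rule lebesgue_integral_countable_add[OF B _ si])
        (use union(1) in \<open>auto simp: disjoint_family_on_def\<close>)
    also have "\<dots> = 0"
      using union(3) by (simp add: set_lebesgue_integral_def)
    finally show ?case .
  qed
qed

lemma integral_lebesgue_on_indicator:
  fixes f :: "'a::euclidean_space \<Rightarrow> real"
  assumes "\<Omega> \<in> sets lebesgue"
  shows "(\<integral>x. f x \<partial>lebesgue_on \<Omega>) = (\<integral>x. indicat_real \<Omega> x * f x \<partial>lebesgue)"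
  using assms by (simp add: integral_restrict_space)

text \<open>Plateaus give vanishing integrals only over boxes whose closure lies in \<Omega>, so the
  box criterion is applied locally and the results are glued along a countable cover of
  \<Omega>.\<close>

theorem fundamental_lemma_variations:
  fixes \<Omega> :: "(real^3) set"
  assumes "open \<Omega>" and h: "integrable (lebesgue_on \<Omega>) h"
    and null: "\<And>\<psi>. \<psi> \<in> test_functions \<Omega> \<Longrightarrow> l2_inner \<Omega> h \<psi> = 0"
  shows "AE x in lebesgue_on \<Omega>. h x = 0"
proof -
  have \<Omega>: "\<Omega> \<in> sets lebesgue" using \<open>open \<Omega>\<close> by auto
  define g where "g x = indicat_real \<Omega> x * h x" for x
  have g: "integrable lebesgue g"
    using h \<Omega> by (simp add: g_def[abs_def] integrable_restrict_space)
  \<comment> \<open>The Dynkin argument runs over Borel sets, while h is only Lebesgue measurable;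
    g' is a Borel version of its extension by zero.\<close>
  obtain g' where g': "g' \<in> borel_measurable lborel" and ae: "AE x in lborel. g x = g' x"
    using completion_ex_borel_measurable_real[OF borel_measurable_integrable[OF g]] by blast
  have ae': "AE x in lebesgue. g x = g' x"
    using ae by (rule AE_completion)
  have "integrable lebesgue g'"
    using g ae' g' by (subst integrable_cong_AE[symmetric, of g]) (auto simp: measurable_completion)
  then have g'_int: "integrable lborel g'"
    using g' by (simp add: integrable_completion)
  have box_null: "(\<integral>x. indicat_real (box a b) x * g' x \<partial>lborel) = 0" if ab: "cbox a b \<subseteq> \<Omega>" for a b
  proof (rule LIMSEQ_unique)
    have meas: "plateau n a b \<in> borel_measurable borel" for n
      using Ck_on_continuous[OF Ck_on_plateau[of 0 n a b]] by (rule borel_measurable_continuous_onI)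
    show "(\<lambda>n. \<integral>x. plateau n a b x * g' x \<partial>lborel) \<longlonglongrightarrow> (\<integral>x. indicat_real (box a b) x * g' x \<partial>lborel)"
    proof (rule integral_dominated_convergence[where w = "\<lambda>x. \<bar>g' x\<bar>"])
      show "AE x in lborel. (\<lambda>n. plateau n a b x * g' x) \<longlonglongrightarrow> indicat_real (box a b) x * g' x"
        by (intro AE_I2 tendsto_intros plateau_tendsto)
      show "AE x in lborel. norm (plateau n a b x * g' x) \<le> \<bar>g' x\<bar>" for n
        using plateau_bounds[of n a b] by (intro AE_I2) (simp add: abs_mult mult_left_le_one_le)
      show "integrable lborel (\<lambda>x. \<bar>g' x\<bar>)" using g'_int by simp
    qed (use g' meas in auto)
    have "(\<integral>x. plateau n a b x * g' x \<partial>lborel) = 0" for n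
    proof -
      have "(\<integral>x. plateau n a b x * g' x \<partial>lborel) = (\<integral>x. plateau n a b x * g' x \<partial>lebesgue)"
        using g' meas by (subst integral_completion) auto
      also have "\<dots> = (\<integral>x. g x * plateau n a b x \<partial>lebesgue)"
        using ae' g' meas borel_measurable_integrable[OF g]
        by (intro integral_cong_AE borel_measurable_times) (auto simp: measurable_completion elim!: eventually_mono)
      also have "\<dots> = (\<integral>x. indicat_real \<Omega> x * (h x * plateau n a b x) \<partial>lebesgue)"
        by (simp add: g_def mult.assoc)
      also have "\<dots> = l2_inner \<Omega> h (plateau n a b)"
        using \<Omega> by (simp add: l2_inner_def integral_lebesgue_on_indicator)
      also have "\<dots> = 0"
        by (rule null[OF plateau_test_function[OF ab]])
      finally show ?thesis .
    qed
    then show "(\<lambda>n. \<integral>x. plateau n a b x * g' x \<partial>lborel) \<longlonglongrightarrow> 0"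
      by simp
  qed
  have on_box: "AE x in lborel. x \<in> box c d \<longrightarrow> g' x = 0" if cd: "cbox c d \<subseteq> \<Omega>" for c d
  proof -
    have "AE x in lborel. indicat_real (box c d) x * g' x = 0"
    proof (rule AE_zero_of_null_box_integrals)
      show "integrable lborel (\<lambda>x. indicat_real (box c d) x * g' x)"
        using integrable_mult_indicator[OF _ g'_int, of "box c d"] by simp
      fix a b
      \<comment> \<open>The same corners describe the open and the closed intersection, so the
        closed box stays inside \<Omega> and \<open>box_null\<close> applies to it.\<close>
      obtain a' b' where *: "box a b \<inter> box c d = box a' b'" "cbox a b \<inter> cbox c d = cbox a' b'"
        by (simp add: box_Int_box Int_interval)
      then have "(\<integral>x. indicat_real (box a' b') x * g' x \<partial>lborel) = 0"
        using cd by (intro box_null) auto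
      then show "(\<integral>x. indicat_real (box a b) x * (indicat_real (box c d) x * g' x) \<partial>lborel) = 0"
        by (simp add: *(1)[symmetric] indicator_inter_arith mult.assoc)
    qed
    then show ?thesis by (auto elim!: eventually_mono simp: indicator_def split: if_splits)
  qed
  have "AE x in lborel. x \<in> \<Omega> \<longrightarrow> g' x = 0"
  proof -
    obtain D where D: "countable D" "D \<subseteq> Pow \<Omega>" "\<And>X. X \<in> D \<Longrightarrow> \<exists>a b. X = cbox a b" "\<Union>D = \<Omega>"
      using open_countable_Union_open_cbox[OF \<open>open \<Omega>\<close>] by metis
    have "AE x in lborel. x \<in> X \<longrightarrow> g' x = 0" if "X \<in> D" for X
    proof -
      obtain a b where X: "X = cbox a b" using D(3)[OF \<open>X \<in> D\<close>] by blast
      \<comment> \<open>The cover consists of closed boxes but g' is known to vanish on open ones;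
        the difference is a null set.\<close>
      have "cbox a b - box a b \<in> null_sets lborel"
        using negligible_frontier_interval[of a b]
        by (simp add: negligible_iff_null_sets null_sets_completion_iff)
      then have "AE x in lborel. x \<notin> cbox a b - box a b"
        by (rule AE_not_in)
      moreover have "AE x in lborel. x \<in> box a b \<longrightarrow> g' x = 0"
        using on_box[of a b] D(2) \<open>X \<in> D\<close> X by auto
      ultimately show ?thesis
        by eventually_elim (auto simp: X)
    qed
    then have "AE x in lborel. \<forall>X\<in>D. x \<in> X \<longrightarrow> g' x = 0"
      using D(1) by (subst AE_ball_countable) auto
    then show ?thesis
      by eventually_elim (use D(4) in auto)
  qed
  then have "AE x in lebesgue. x \<in> \<Omega> \<longrightarrow> g' x = 0"
    by (rule AE_completion)
  then have "AE x in lebesgue. x \<in> \<Omega> \<longrightarrow> h x = 0"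
    using ae' by eventually_elim (auto simp: g_def)
  then show ?thesis
    using \<Omega> by (simp add: AE_restrict_space_iff)
qed


section \<open>Square-integrable functions and the Riesz-Fischer theorem\<close>

lemma L2_borel_measurable: "f \<in> L2 \<Omega> \<Longrightarrow> f \<in> borel_measurable (lebesgue_on \<Omega>)"
  and L2_integrable_square: "f \<in> L2 \<Omega> \<Longrightarrow> integrable (lebesgue_on \<Omega>) (\<lambda>x. (f x)\<^sup>2)"
  by (auto simp: L2_def)

lemma L2_integrable_mult:
  assumes f: "f \<in> L2 \<Omega>" and g: "g \<in> L2 \<Omega>"
  shows "integrable (lebesgue_on \<Omega>) (\<lambda>x. f x * g x)"
proof (rule Bochner_Integration.integrable_bound)
  show "integrable (lebesgue_on \<Omega>) (\<lambda>x. (f x)\<^sup>2 + (g x)\<^sup>2)"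
    using f g by (intro Bochner_Integration.integrable_add L2_integrable_square)
  show "(\<lambda>x. f x * g x) \<in> borel_measurable (lebesgue_on \<Omega>)"
    using f g by (intro borel_measurable_times L2_borel_measurable)
  show "AE x in lebesgue_on \<Omega>. norm (f x * g x) \<le> norm ((f x)\<^sup>2 + (g x)\<^sup>2)"
  proof (rule AE_I2)
    fix x
    have "0 \<le> (\<bar>f x\<bar> - \<bar>g x\<bar>)\<^sup>2" "0 \<le> \<bar>f x\<bar> * \<bar>g x\<bar>" by auto
    then have "\<bar>f x\<bar> * \<bar>g x\<bar> \<le> (f x)\<^sup>2 + (g x)\<^sup>2"
      unfolding power2_diff power2_abs by linarith
    then show "norm (f x * g x) \<le> norm ((f x)\<^sup>2 + (g x)\<^sup>2)"
      by (simp add: abs_mult)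
  qed
qed

lemma L2_lincomb:
  assumes f: "f \<in> L2 \<Omega>" and g: "g \<in> L2 \<Omega>"
  shows "(\<lambda>x. c * f x + d * g x) \<in> L2 \<Omega>"
proof -
  have "integrable (lebesgue_on \<Omega>) (\<lambda>x. c\<^sup>2 * (f x)\<^sup>2 + d\<^sup>2 * (g x)\<^sup>2 + 2 * c * d * (f x * g x))"
    using f g by (intro Bochner_Integration.integrable_add integrable_mult_right
        L2_integrable_square L2_integrable_mult)
  also have "(\<lambda>x. c\<^sup>2 * (f x)\<^sup>2 + d\<^sup>2 * (g x)\<^sup>2 + 2 * c * d * (f x * g x))
      = (\<lambda>x. (c * f x + d * g x)\<^sup>2)"
    by (simp add: power2_eq_square algebra_simps)
  finally show ?thesis
    using L2_borel_measurable[OF f] L2_borel_measurable[OF g] by (simp add: L2_def)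
qed

lemma L2_zero: "(\<lambda>x. 0) \<in> L2 \<Omega>"
  by (simp add: L2_def)

lemma L2_add: "f \<in> L2 \<Omega> \<Longrightarrow> g \<in> L2 \<Omega> \<Longrightarrow> (\<lambda>x. f x + g x) \<in> L2 \<Omega>"
  and L2_diff: "f \<in> L2 \<Omega> \<Longrightarrow> g \<in> L2 \<Omega> \<Longrightarrow> (\<lambda>x. f x - g x) \<in> L2 \<Omega>"
  and L2_scale: "f \<in> L2 \<Omega> \<Longrightarrow> (\<lambda>x. c * f x) \<in> L2 \<Omega>"
  using L2_lincomb[of f \<Omega> g 1 1] L2_lincomb[of f \<Omega> g 1 "-1"] L2_lincomb[of f \<Omega> f c 0]
  by simp_all

lemma L2_sum: "(\<And>i. i \<in> I \<Longrightarrow> f i \<in> L2 \<Omega>) \<Longrightarrow> (\<lambda>x. \<Sum>i\<in>I. c i * f i x) \<in> L2 \<Omega>"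
  by (induction I rule: infinite_finite_induct) (auto intro!: L2_zero L2_add L2_scale)

lemma l2_inner_commute: "l2_inner \<Omega> f g = l2_inner \<Omega> g f"
  by (simp add: l2_inner_def mult.commute)

lemma l2_inner_lincomb_left:
  assumes "f \<in> L2 \<Omega>" "g \<in> L2 \<Omega>" "h \<in> L2 \<Omega>"
  shows "l2_inner \<Omega> (\<lambda>x. c * f x + d * g x) h = c * l2_inner \<Omega> f h + d * l2_inner \<Omega> g h"
  using assms by (simp add: l2_inner_def distrib_right mult.assoc L2_integrable_mult)

lemma l2_inner_scale_left: "l2_inner \<Omega> (\<lambda>x. c * f x) g = c * l2_inner \<Omega> f g"
  by (simp add: l2_inner_def mult.assoc)

lemma l2_inner_diff_left:
  "f \<in> L2 \<Omega> \<Longrightarrow> g \<in> L2 \<Omega> \<Longrightarrow> h \<in> L2 \<Omega> \<Longrightarrow>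
    l2_inner \<Omega> (\<lambda>x. f x - g x) h = l2_inner \<Omega> f h - l2_inner \<Omega> g h"
  using l2_inner_lincomb_left[of f \<Omega> g h 1 "-1"] by simp

lemma l2_inner_sum_left:
  assumes "finite I" "\<And>i. i \<in> I \<Longrightarrow> f i \<in> L2 \<Omega>" "h \<in> L2 \<Omega>"
  shows "l2_inner \<Omega> (\<lambda>x. \<Sum>i\<in>I. c i * f i x) h = (\<Sum>i\<in>I. c i * l2_inner \<Omega> (f i) h)"
  using assms(1,2)
proof (induction I)
  case empty
  then show ?case by (simp add: l2_inner_def)
next
  case (insert i I)
  then show ?case
    using l2_inner_lincomb_left[of "f i" \<Omega> "\<lambda>x. \<Sum>i\<in>I. c i * f i x" h "c i" 1] assms(3)
    by (simp add: L2_sum)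
qed

lemma l2_inner_cong_AE:
  assumes "f \<in> L2 \<Omega>" "f' \<in> L2 \<Omega>" "g \<in> L2 \<Omega>" "AE x in lebesgue_on \<Omega>. f x = f' x"
  shows "l2_inner \<Omega> f g = l2_inner \<Omega> f' g"
  unfolding l2_inner_def
  using assms by (intro integral_cong_AE borel_measurable_times L2_borel_measurable) auto

lemma l2_inner_self_nonneg: "0 \<le> l2_inner \<Omega> f f"
  by (simp add: l2_inner_def)

lemma l2_norm_square: "(l2_norm \<Omega> f)\<^sup>2 = l2_inner \<Omega> f f"
  by (simp add: l2_norm_def l2_inner_self_nonneg)

lemma l2_inner_self_eq_0_iff:
  assumes "f \<in> L2 \<Omega>"
  shows "l2_inner \<Omega> f f = 0 \<longleftrightarrow> (AE x in lebesgue_on \<Omega>. f x = 0)"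
  using L2_integrable_mult[OF assms assms] unfolding l2_inner_def
  by (subst integral_nonneg_eq_0_iff_AE) auto

section \<open>Orthonormal systems and the Riesz-Fischer theorem\<close>

locale l2_orthonormal =
  fixes \<Omega> :: "(real^3) set" and e :: "nat \<Rightarrow> sfun"
  assumes e_L2: "e k \<in> L2 \<Omega>"
    and orthonormal: "l2_inner \<Omega> (e j) (e k) = (if j = k then 1 else 0)"
begin

abbreviation fourier_sum :: "(nat \<Rightarrow> real) \<Rightarrow> nat set \<Rightarrow> sfun" where
  "fourier_sum a I \<equiv> \<lambda>x. \<Sum>k\<in>I. a k * e k x"

lemma fourier_sum_L2: "fourier_sum a I \<in> L2 \<Omega>"
  by (intro L2_sum e_L2)

lemma l2_inner_fourier_sum_basis:
  "finite I \<Longrightarrow> l2_inner \<Omega> (fourier_sum a I) (e k) = (if k \<in> I then a k else 0)"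
  by (simp add: l2_inner_sum_left e_L2 orthonormal if_distrib cong: if_cong)

lemma l2_inner_fourier_sum_self:
  "finite I \<Longrightarrow> l2_inner \<Omega> (fourier_sum a I) (fourier_sum a I) = (\<Sum>k\<in>I. (a k)\<^sup>2)"
proof -
  assume "finite I"
  then have "l2_inner \<Omega> (fourier_sum a I) (fourier_sum a I) = (\<Sum>k\<in>I. a k * l2_inner \<Omega> (e k) (fourier_sum a I))"
    by (intro l2_inner_sum_left e_L2 fourier_sum_L2)
  also have "\<dots> = (\<Sum>k\<in>I. (a k)\<^sup>2)"
  proof (rule sum.cong)
    fix k assume "k \<in> I"
    then show "a k * l2_inner \<Omega> (e k) (fourier_sum a I) = (a k)\<^sup>2"
      unfolding l2_inner_commute[of \<Omega> "e k" "fourier_sum a I"]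
      using \<open>finite I\<close> by (simp add: l2_inner_fourier_sum_basis power2_eq_square)
  qed simp
  finally show ?thesis .
qed

text \<open>Pythagoras: the remainder is orthogonal to the Fourier sum. Bessel's inequality and
  Parseval's identity are both read off from it.\<close>

lemma l2_inner_fourier_remainder:
  assumes f: "f \<in> L2 \<Omega>" and I: "finite I"
  defines "r \<equiv> (\<lambda>x. f x - fourier_sum (\<lambda>k. l2_inner \<Omega> f (e k)) I x)"
  shows "l2_inner \<Omega> r r = l2_inner \<Omega> f f - (\<Sum>k\<in>I. (l2_inner \<Omega> f (e k))\<^sup>2)"
proof -
  let ?s = "fourier_sum (\<lambda>k. l2_inner \<Omega> f (e k)) I"
  have r: "r \<in> L2 \<Omega>" unfolding r_def by (intro L2_diff f fourier_sum_L2)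
  have sf: "l2_inner \<Omega> ?s f = (\<Sum>k\<in>I. (l2_inner \<Omega> f (e k))\<^sup>2)"
    by (subst l2_inner_sum_left) (auto simp: I e_L2 f l2_inner_commute[of \<Omega> "e _" f] power2_eq_square)
  have "l2_inner \<Omega> r r = l2_inner \<Omega> f r - l2_inner \<Omega> ?s r"
    unfolding r_def by (intro l2_inner_diff_left f fourier_sum_L2 L2_diff)
  also have "l2_inner \<Omega> f r = l2_inner \<Omega> f f - l2_inner \<Omega> ?s f"
    unfolding r_def by (subst l2_inner_commute) (intro l2_inner_diff_left f fourier_sum_L2)
  also have "l2_inner \<Omega> ?s r = l2_inner \<Omega> r ?s"
    by (rule l2_inner_commute)
  also have "\<dots> = l2_inner \<Omega> f ?s - l2_inner \<Omega> ?s ?s"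
    unfolding r_def by (intro l2_inner_diff_left f fourier_sum_L2)
  also have "l2_inner \<Omega> f ?s = l2_inner \<Omega> ?s f"
    by (rule l2_inner_commute)
  finally show ?thesis
    by (simp add: sf l2_inner_fourier_sum_self I)
qed

lemma bessel: "f \<in> L2 \<Omega> \<Longrightarrow> finite I \<Longrightarrow> (\<Sum>k\<in>I. (l2_inner \<Omega> f (e k))\<^sup>2) \<le> l2_inner \<Omega> f f"
  using l2_inner_fourier_remainder[of f I]
    l2_inner_self_nonneg[of \<Omega> "\<lambda>x. f x - fourier_sum (\<lambda>k. l2_inner \<Omega> f (e k)) I x"]
  by linarith

text \<open>Partial sums are thinned out until their increments decay geometrically in squared norm.
  The thinned sequence then converges almost everywhere, and Fatou's lemma shows that the pointwise
  limit is also the limit in L2.\<close>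

theorem riesz_fischer:
  assumes a: "summable (\<lambda>k. (a k)\<^sup>2)"
  shows "\<exists>w\<in>L2 \<Omega>. \<forall>k. l2_inner \<Omega> w (e k) = a k"
proof -
  let ?M = "lebesgue_on \<Omega>"
  have "\<exists>N. \<forall>m\<ge>N. \<forall>n. (\<Sum>k\<in>{m..<n}. (a k)\<^sup>2) < (1/4) ^ j" for j :: nat
  proof -
    have "(0::real) < (1/4) ^ j" by simp
    then obtain N where "\<forall>m\<ge>N. \<forall>n. norm (\<Sum>k\<in>{m..<n}. (a k)\<^sup>2) < (1/4) ^ j"
      using a unfolding summable_Cauchy by blast
    then show ?thesis
      by (intro exI[of _ N]) (auto simp: abs_of_nonneg sum_nonneg)
  qed
  then obtain N where N: "\<And>j m n. m \<ge> N j \<Longrightarrow> (\<Sum>k\<in>{m..<n}. (a k)\<^sup>2) < (1/4) ^ j"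
    by metis
  \<comment> \<open>The sum makes r monotone and at least \<open>N j\<close>; the added j makes it
    unbounded, so that each index k eventually enters the partial sums.\<close>
  define r where "r j = (\<Sum>i\<le>j. N i) + j" for j
  have r_N: "N j \<le> r j" and r_ge: "j \<le> r j" for j
    using member_le_sum[of j "{..j}" N] by (auto simp: r_def)
  have r_Suc: "r j \<le> r (Suc j)" for j
    by (simp add: r_def)
  then have r_mono: "mono r" by (simp add: incseq_SucI)
  define s where "s j = fourier_sum a {..<r j}" for j
  have s_L2: "s j \<in> L2 \<Omega>" for j
    unfolding s_def by (rule fourier_sum_L2)
  have s_diff: "(\<lambda>x. s j x - s i x) = fourier_sum a {r i..<r j}" if "i \<le> j" for i j
  proof -
    have "{..<r j} = {..<r i} \<union> {r i..<r j}" using monoD[OF r_mono that] by auto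
    moreover have "(\<Sum>k\<in>{..<r i} \<union> {r i..<r j}. a k * e k x)
        = (\<Sum>k\<in>{..<r i}. a k * e k x) + (\<Sum>k\<in>{r i..<r j}. a k * e k x)" for x
      by (intro sum.union_disjoint) auto
    ultimately show ?thesis
      by (simp add: s_def)
  qed
  have s_bound: "(\<integral>\<^sup>+x. ennreal ((s j x - s i x)\<^sup>2) \<partial>?M) \<le> ennreal ((1/4) ^ i)" if "i \<le> j" for i j
  proof -
    have d: "(\<lambda>x. s j x - s i x) \<in> L2 \<Omega>" by (intro L2_diff s_L2)
    have "(\<integral>\<^sup>+x. ennreal ((s j x - s i x)\<^sup>2) \<partial>?M) = ennreal (\<integral>x. (s j x - s i x)\<^sup>2 \<partial>?M)"
      by (rule nn_integral_eq_integral[OF L2_integrable_square[OF d]]) simp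
    also have "(\<integral>x. (s j x - s i x)\<^sup>2 \<partial>?M) = l2_inner \<Omega> (\<lambda>x. s j x - s i x) (\<lambda>x. s j x - s i x)"
      by (simp add: l2_inner_def power2_eq_square)
    also have "\<dots> = (\<Sum>k\<in>{r i..<r j}. (a k)\<^sup>2)"
      unfolding s_diff[OF that] by (rule l2_inner_fourier_sum_self) simp
    also have "\<dots> \<le> (1/4) ^ i"
      using N[OF r_N[of i], of "r j"] by simp
    finally show ?thesis by (simp add: ennreal_leI)
  qed
  define d where "d j x = s (Suc j) x - s j x" for j x
  have meas: "s j \<in> borel_measurable ?M" "d j \<in> borel_measurable ?M" for j
    using L2_borel_measurable[OF s_L2] by (auto simp: d_def[abs_def])
  \<comment> \<open>The weights \<open>2\<^sup>j\<close> still leave a convergent series, while \<open>\<bar>d\<bar> \<le> 2\<^sup>-\<^sup>j + 2\<^sup>j d\<^sup>2\<close> turns its finiteness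
    into absolute convergence.\<close>
  have "(\<integral>\<^sup>+x. (\<Sum>j. ennreal (2 ^ j * (d j x)\<^sup>2)) \<partial>?M) = (\<Sum>j. \<integral>\<^sup>+x. ennreal (2 ^ j * (d j x)\<^sup>2) \<partial>?M)"
    using meas by (intro nn_integral_suminf) auto
  also have "\<dots> \<le> (\<Sum>j. ennreal ((1/2) ^ j))"
  proof (intro suminf_le)
    fix j
    have "(\<integral>\<^sup>+x. ennreal (2 ^ j * (d j x)\<^sup>2) \<partial>?M) = ennreal (2 ^ j) * (\<integral>\<^sup>+x. ennreal ((d j x)\<^sup>2) \<partial>?M)"
      using meas by (simp add: ennreal_mult nn_integral_cmult)
    also have "\<dots> \<le> ennreal (2 ^ j) * ennreal ((1/4) ^ j)"
      unfolding d_def by (intro mult_left_mono s_bound) auto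
    also have "\<dots> = ennreal ((1/2) ^ j)"
      by (simp add: ennreal_mult[symmetric] power_mult_distrib[symmetric])
    finally show "(\<integral>\<^sup>+x. ennreal (2 ^ j * (d j x)\<^sup>2) \<partial>?M) \<le> ennreal ((1/2) ^ j)" .
  qed auto
  also have "\<dots> < \<infinity>"
    by (simp add: suminf_ennreal2 summable_geometric)
  finally have "AE x in ?M. (\<Sum>j. ennreal (2 ^ j * (d j x)\<^sup>2)) \<noteq> \<infinity>"
    using meas by (intro nn_integral_PInf_AE) auto
  then have conv: "AE x in ?M. summable (\<lambda>j. d j x)"
  proof eventually_elim
    case (elim x)
    then have "summable (\<lambda>j. 2 ^ j * (d j x)\<^sup>2)"
      by (intro summable_suminf_not_top) auto
    then have "summable (\<lambda>j. (1/2) ^ j + 2 ^ j * (d j x)\<^sup>2)"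
      by (intro summable_add summable_geometric) auto
    then show ?case
    proof (rule summable_comparison_test')
      fix j
      have "0 \<le> (1/2) ^ j * (1 - 2 ^ j * \<bar>d j x\<bar>)\<^sup>2" by simp
      also have "\<dots> = (1/2) ^ j - 2 * \<bar>d j x\<bar> + 2 ^ j * (d j x)\<^sup>2"
        by (simp add: power2_eq_square field_simps)
      finally show "norm (d j x) \<le> (1/2) ^ j + 2 ^ j * (d j x)\<^sup>2"
        by simp
    qed
  qed
  define w where "w x = (\<Sum>j. d j x) + s 0 x" for x
  have w_meas: "w \<in> borel_measurable ?M"
    unfolding w_def[abs_def] using meas by (intro borel_measurable_add borel_measurable_suminf) auto
  have s_w: "AE x in ?M. (\<lambda>j. s j x) \<longlonglongrightarrow> w x"
    using conv
  proof eventually_elim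
    case (elim x)
    have "(\<Sum>i<j. d i x) + s 0 x = s j x" for j
      by (induction j) (auto simp: d_def)
    then show ?case
      using tendsto_add[OF summable_LIMSEQ[OF elim] tendsto_const[of "s 0 x"]] by (simp add: w_def)
  qed
  \<comment> \<open>Fatou's lemma in j, with i fixed, carries the bound for s_j - s_i over to the
    limit.\<close>
  have tail: "(\<integral>\<^sup>+x. ennreal ((w x - s i x)\<^sup>2) \<partial>?M) \<le> ennreal ((1/4) ^ i)" for i
  proof -
    have "(\<integral>\<^sup>+x. ennreal ((w x - s i x)\<^sup>2) \<partial>?M) = (\<integral>\<^sup>+x. liminf (\<lambda>j. ennreal ((s j x - s i x)\<^sup>2)) \<partial>?M)"
    proof (rule nn_integral_cong_AE)
      show "AE x in ?M. ennreal ((w x - s i x)\<^sup>2) = liminf (\<lambda>j. ennreal ((s j x - s i x)\<^sup>2))"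
        using s_w
      proof eventually_elim
        case (elim x)
        have "(\<lambda>j. ennreal ((s j x - s i x)\<^sup>2)) \<longlonglongrightarrow> ennreal ((w x - s i x)\<^sup>2)"
          by (intro tendsto_ennrealI tendsto_power tendsto_diff tendsto_const elim)
        then show ?case
          by (rule lim_imp_Liminf[symmetric, rotated]) simp
      qed
    qed
    also have "\<dots> \<le> liminf (\<lambda>j. \<integral>\<^sup>+x. ennreal ((s j x - s i x)\<^sup>2) \<partial>?M)"
      using meas by (intro nn_integral_liminf) auto
    also have "\<dots> \<le> ennreal ((1/4) ^ i)"
      by (intro Liminf_le eventually_mono[OF eventually_ge_at_top[of i]] s_bound) simp_all
    finally show ?thesis .
  qed
  have rem_L2: "(\<lambda>x. w x - s i x) \<in> L2 \<Omega>" for i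
  proof -
    have "integrable ?M (\<lambda>x. (w x - s i x)\<^sup>2)"
    proof (rule integrableI_nonneg)
      show "(\<integral>\<^sup>+x. ennreal ((w x - s i x)\<^sup>2) \<partial>?M) < \<infinity>"
        using tail[of i] ennreal_less_top by (simp add: le_less_trans)
    qed (use meas(1)[of i] w_meas in auto)
    then show ?thesis using meas(1) w_meas by (simp add: L2_def)
  qed
  have w: "w \<in> L2 \<Omega>"
    using L2_add[OF rem_L2[of 0] s_L2[of 0]] by simp
  have "l2_inner \<Omega> w (e k) = a k" for k
  proof -
    \<comment> \<open>Once \<open>r i\<close> exceeds k, the k-th coefficient of s_i is exactly
      \<open>a k\<close>, so the error is a single coefficient of the remainder and Bessel bounds it
      by the norm.\<close>
    have *: "(l2_inner \<Omega> w (e k) - a k)\<^sup>2 \<le> (1/4) ^ i" if "i > k" for i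
    proof -
      have "r i > k" using r_ge[of i] that by linarith
      then have "l2_inner \<Omega> (\<lambda>x. w x - s i x) (e k) = l2_inner \<Omega> w (e k) - a k"
        by (subst l2_inner_diff_left[OF w s_L2 e_L2]) (simp add: s_def l2_inner_fourier_sum_basis)
      then have "(l2_inner \<Omega> w (e k) - a k)\<^sup>2 \<le> l2_inner \<Omega> (\<lambda>x. w x - s i x) (\<lambda>x. w x - s i x)"
        using bessel[OF rem_L2[of i], of "{k}"] by simp
      also have "ennreal \<dots> \<le> ennreal ((1/4) ^ i)"
        using tail[of i] nn_integral_eq_integral[OF L2_integrable_square[OF rem_L2[of i]]]
        by (simp add: l2_inner_def power2_eq_square)
      finally show ?thesis by (simp add: ennreal_leI)
    qed
    have "(l2_inner \<Omega> w (e k) - a k)\<^sup>2 \<le> 0"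
    proof (rule tendsto_lowerbound)
      show "(\<lambda>i. (1/4 :: real) ^ i) \<longlonglongrightarrow> 0" by (intro LIMSEQ_power_zero) simp
      show "\<forall>\<^sub>F i in sequentially. (l2_inner \<Omega> w (e k) - a k)\<^sup>2 \<le> (1/4) ^ i"
        using eventually_gt_at_top[of k] by eventually_elim (rule *)
    qed simp
    then show ?thesis by simp
  qed
  with w show ?thesis by blast
qed

end


section \<open>Weak derivatives and the Neumann Laplacian\<close>

lemma continuous_L2:
  assumes "bounded \<Omega>" "open \<Omega>" "continuous_on UNIV f"
  shows "f \<in> L2 \<Omega>"
proof -
  have "compact (f ` closure \<Omega>)"
    using assms by (intro compact_continuous_image) (auto intro: continuous_on_subset compact_closure[THEN iffD2])
  then obtain C where C: "\<And>x. x \<in> closure \<Omega> \<Longrightarrow> \<bar>f x\<bar> \<le> C"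
    using compact_imp_bounded[of "f ` closure \<Omega>"] by (auto simp: bounded_iff)
  have \<Omega>: "\<Omega> \<in> lmeasurable"
    using assms by (intro lmeasurable_open)
  have meas: "f \<in> borel_measurable (lebesgue_on \<Omega>)"
    using assms(3) \<Omega> by (intro continuous_imp_measurable_on_sets_lebesgue) (auto intro: continuous_on_subset fmeasurableD)
  interpret finite_measure "lebesgue_on \<Omega>"
    using \<Omega> by (rule finite_measure_lebesgue_on)
  have "integrable (lebesgue_on \<Omega>) (\<lambda>x. (f x)\<^sup>2)"
  proof (rule integrable_const_bound[where B = "C\<^sup>2"])
    show "AE x in lebesgue_on \<Omega>. norm ((f x)\<^sup>2) \<le> C\<^sup>2"
    proof (rule AE_I2)
      fix x assume "x \<in> space (lebesgue_on \<Omega>)"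
      then have "\<bar>f x\<bar> \<le> C" using C[of x] closure_subset[of \<Omega>] by auto
      then show "norm ((f x)\<^sup>2) \<le> C\<^sup>2"
        using power_mono[of "\<bar>f x\<bar>" C 2] by simp
    qed
  qed (use meas in auto)
  then show ?thesis using meas by (simp add: L2_def)
qed

lemma test_function_L2:
  assumes "bounded \<Omega>" "open \<Omega>" "\<psi> \<in> test_functions \<Omega>"
  shows "\<psi> \<in> L2 \<Omega>"
  using assms Ck_on_continuous[of 0 UNIV \<psi>] by (auto intro!: continuous_L2 simp: test_functions_def)

lemma test_function_deriv:
  assumes \<psi>: "\<psi> \<in> test_functions \<Omega>" and i: "i \<in> Basis"
  shows "(\<lambda>x. frechet_derivative \<psi> (at x) i) \<in> test_functions \<Omega>"
proof -
  let ?d = "\<lambda>x. frechet_derivative \<psi> (at x) i"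
  let ?K = "closure {x. \<psi> x \<noteq> 0}"
  have "Ck_on n UNIV ?d" for n
    using \<psi> i by (auto simp: test_functions_def dest!: spec[of _ "Suc n"])
  moreover have "?d x = 0" if "x \<notin> ?K" for x
  proof -
    have "(\<psi> has_derivative (\<lambda>_. 0)) (at x)"
    proof (rule has_derivative_transform_within_open)
      show "((\<lambda>_. 0) has_derivative (\<lambda>_. 0)) (at x)" by simp
      show "0 = \<psi> y" if "y \<in> - ?K" for y
        using that closure_subset[of "{x. \<psi> x \<noteq> 0}"] by auto
    qed (use that in auto)
    then show ?thesis
      using frechet_derivative_at by metis
  qed
  then have "closure {x. ?d x \<noteq> 0} \<subseteq> ?K"
    by (intro closure_minimal) auto
  ultimately show ?thesis
    using \<psi> compact_Int_closed[of ?K "closure {x. ?d x \<noteq> 0}"]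
    by (auto simp: test_functions_def Int_absorb1)
qed

lemma H1_L2: "u \<in> H1 \<Omega> \<Longrightarrow> u \<in> L2 \<Omega>"
  by (simp add: H1_def)

lemma H2_H1: "u \<in> H2 \<Omega> \<Longrightarrow> u \<in> H1 \<Omega>"
  by (simp add: H2_def)

lemma dom_A0_H2: "u \<in> dom_A0 \<Omega> \<Longrightarrow> u \<in> H2 \<Omega>"
  by (simp add: dom_A0_def)

lemma dom_A0_L2: "u \<in> dom_A0 \<Omega> \<Longrightarrow> u \<in> L2 \<Omega>"
  by (intro H1_L2 H2_H1 dom_A0_H2)

lemma weak_deriv_spec:
  assumes "u \<in> H1 \<Omega>" "i \<in> Basis"
  shows weak_deriv_L2: "weak_deriv \<Omega> i u \<in> L2 \<Omega>"
    and has_weak_deriv_weak_deriv: "has_weak_deriv \<Omega> i u (weak_deriv \<Omega> i u)"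
proof -
  have "\<exists>g. g \<in> L2 \<Omega> \<and> has_weak_deriv \<Omega> i u g"
    using assms by (auto simp: H1_def)
  from someI_ex[OF this]
  show "weak_deriv \<Omega> i u \<in> L2 \<Omega>" "has_weak_deriv \<Omega> i u (weak_deriv \<Omega> i u)"
    by (simp_all add: weak_deriv_def)
qed

lemma laplacian_L2:
  assumes "u \<in> H2 \<Omega>"
  shows "laplacian \<Omega> u \<in> L2 \<Omega>"
proof -
  have "weak_deriv \<Omega> i (weak_deriv \<Omega> i u) \<in> L2 \<Omega>" if "i \<in> Basis" for i
    using assms that by (auto simp: H2_def intro!: weak_deriv_L2)
  then show ?thesis
    unfolding laplacian_def
    using L2_sum[of Basis "\<lambda>i. weak_deriv \<Omega> i (weak_deriv \<Omega> i u)" \<Omega> "\<lambda>_. 1"] by simp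
qed

text \<open>Both normal traces vanish, so each side is the negative of the Dirichlet form, which is
  symmetric in u and v.\<close>

lemma laplacian_symmetric:
  assumes "u \<in> dom_A0 \<Omega>" "v \<in> dom_A0 \<Omega>"
  shows "l2_inner \<Omega> (laplacian \<Omega> u) v = l2_inner \<Omega> u (laplacian \<Omega> v)"
proof -
  have "u \<in> H1 \<Omega>" "v \<in> H1 \<Omega>"
    using assms by (auto intro: H2_H1 dom_A0_H2)
  then have "normal_trace \<Omega> u v = 0" "normal_trace \<Omega> v u = 0"
    using assms by (auto simp: dom_A0_def)
  then show ?thesis
    unfolding normal_trace_def
    by (simp add: l2_inner_commute[of \<Omega> "weak_deriv \<Omega> _ u"] l2_inner_commute[of \<Omega> u "laplacian \<Omega> v"])
qed

section \<open>Uniqueness and linearity of weak derivatives\<close>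

locale bounded_open =
  fixes \<Omega> :: "(real^3) set"
  assumes bounded: "bounded \<Omega>" and "open": "open \<Omega>"
begin

lemma test_L2: "\<psi> \<in> test_functions \<Omega> \<Longrightarrow> \<psi> \<in> L2 \<Omega>"
  by (rule test_function_L2[OF bounded "open"])

lemma test_deriv_L2:
  "\<psi> \<in> test_functions \<Omega> \<Longrightarrow> i \<in> Basis \<Longrightarrow> (\<lambda>x. frechet_derivative \<psi> (at x) i) \<in> L2 \<Omega>"
  by (intro test_L2 test_function_deriv)

lemma L2_integrable: "f \<in> L2 \<Omega> \<Longrightarrow> integrable (lebesgue_on \<Omega>) f"
  using L2_integrable_mult[of f \<Omega> "\<lambda>_. 1"] continuous_L2[OF bounded "open", of "\<lambda>_. 1"] by simp

text \<open>This makes the choice in \<open>weak_deriv\<close> determinate up to null sets, and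
  every linearity statement about derivatives rests on it.\<close>

lemma weak_deriv_unique:
  assumes "g \<in> L2 \<Omega>" "g' \<in> L2 \<Omega>" "has_weak_deriv \<Omega> i u g" "has_weak_deriv \<Omega> i u g'"
  shows "AE x in lebesgue_on \<Omega>. g x = g' x"
proof -
  have "AE x in lebesgue_on \<Omega>. g x - g' x = 0"
  proof (rule fundamental_lemma_variations[OF "open"])
    show "integrable (lebesgue_on \<Omega>) (\<lambda>x. g x - g' x)"
      using assms by (intro L2_integrable L2_diff)
    fix \<psi> assume "\<psi> \<in> test_functions \<Omega>"
    with assms show "l2_inner \<Omega> (\<lambda>x. g x - g' x) \<psi> = 0"
      by (simp add: l2_inner_diff_left test_L2 has_weak_deriv_def)
  qed
  then show ?thesis by simp
qed

lemma has_weak_deriv_lincomb: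
  assumes "u \<in> L2 \<Omega>" "v \<in> L2 \<Omega>" "g \<in> L2 \<Omega>" "h \<in> L2 \<Omega>" "i \<in> Basis"
    "has_weak_deriv \<Omega> i u g" "has_weak_deriv \<Omega> i v h"
  shows "has_weak_deriv \<Omega> i (\<lambda>x. c * u x + d * v x) (\<lambda>x. c * g x + d * h x)"
  using assms by (simp add: has_weak_deriv_def l2_inner_lincomb_left test_L2 test_deriv_L2)

text \<open>Second derivatives are taken of a chosen first derivative, which is known only almost
  everywhere; hence weak derivatives, \<open>H1\<close> and \<open>weak_deriv\<close> must respect
  almost everywhere equality.\<close>

lemma has_weak_deriv_cong_AE:
  assumes "u \<in> L2 \<Omega>" "v \<in> L2 \<Omega>" "AE x in lebesgue_on \<Omega>. u x = v x" "i \<in> Basis" "has_weak_deriv \<Omega> i u g"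
  shows "has_weak_deriv \<Omega> i v g"
  using assms l2_inner_cong_AE[OF assms(1,2) test_deriv_L2 assms(3)]
  by (simp add: has_weak_deriv_def)

lemma H1_cong_AE:
  assumes "u \<in> H1 \<Omega>" "v \<in> L2 \<Omega>" "AE x in lebesgue_on \<Omega>. u x = v x"
  shows "v \<in> H1 \<Omega>"
  using assms has_weak_deriv_cong_AE[OF H1_L2[OF assms(1)] assms(2,3)]
  unfolding H1_def by blast

lemma weak_deriv_cong_AE:
  assumes "u \<in> H1 \<Omega>" "v \<in> H1 \<Omega>" "AE x in lebesgue_on \<Omega>. u x = v x" "i \<in> Basis"
  shows "AE x in lebesgue_on \<Omega>. weak_deriv \<Omega> i u x = weak_deriv \<Omega> i v x"
proof (rule weak_deriv_unique)
  show "has_weak_deriv \<Omega> i v (weak_deriv \<Omega> i u)"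
    by (rule has_weak_deriv_cong_AE[of u]) (use assms in \<open>simp_all add: H1_L2 has_weak_deriv_weak_deriv\<close>)
qed (use assms in \<open>auto intro: weak_deriv_L2 has_weak_deriv_weak_deriv\<close>)

lemma H1_lincomb:
  assumes "u \<in> H1 \<Omega>" "v \<in> H1 \<Omega>"
  shows "(\<lambda>x. c * u x + d * v x) \<in> H1 \<Omega>"
proof -
  have "has_weak_deriv \<Omega> i (\<lambda>x. c * u x + d * v x) (\<lambda>x. c * weak_deriv \<Omega> i u x + d * weak_deriv \<Omega> i v x)"
    if "i \<in> Basis" for i
    by (rule has_weak_deriv_lincomb) (use assms that in \<open>simp_all add: H1_L2 weak_deriv_spec\<close>)
  moreover have "(\<lambda>x. c * weak_deriv \<Omega> i u x + d * weak_deriv \<Omega> i v x) \<in> L2 \<Omega>" if "i \<in> Basis" for i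
    by (rule L2_lincomb) (use assms that in \<open>simp_all add: weak_deriv_L2\<close>)
  ultimately show ?thesis
    using L2_lincomb[OF assms[THEN H1_L2]] unfolding H1_def by blast
qed

lemma weak_deriv_lincomb:
  assumes "u \<in> H1 \<Omega>" "v \<in> H1 \<Omega>" "i \<in> Basis"
  shows "AE x in lebesgue_on \<Omega>. weak_deriv \<Omega> i (\<lambda>x. c * u x + d * v x) x
    = c * weak_deriv \<Omega> i u x + d * weak_deriv \<Omega> i v x"
proof (rule weak_deriv_unique)
  show "has_weak_deriv \<Omega> i (\<lambda>x. c * u x + d * v x) (\<lambda>x. c * weak_deriv \<Omega> i u x + d * weak_deriv \<Omega> i v x)"
    by (rule has_weak_deriv_lincomb) (use assms in \<open>simp_all add: H1_L2 weak_deriv_spec\<close>)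
  show "(\<lambda>x. c * weak_deriv \<Omega> i u x + d * weak_deriv \<Omega> i v x) \<in> L2 \<Omega>"
    by (rule L2_lincomb) (use assms in \<open>simp_all add: weak_deriv_L2\<close>)
qed (use assms in \<open>simp_all add: H1_lincomb weak_deriv_spec\<close>)

lemma
  assumes u: "u \<in> H2 \<Omega>" and v: "v \<in> H2 \<Omega>"
  shows H2_lincomb: "(\<lambda>x. c * u x + d * v x) \<in> H2 \<Omega>"
    and laplacian_lincomb: "AE x in lebesgue_on \<Omega>.
      laplacian \<Omega> (\<lambda>x. c * u x + d * v x) x = c * laplacian \<Omega> u x + d * laplacian \<Omega> v x"
proof -
  note H1 = H2_H1[OF u] H2_H1[OF v]
  let ?w = "\<lambda>x. c * u x + d * v x"
  let ?D = "\<lambda>i x. c * weak_deriv \<Omega> i u x + d * weak_deriv \<Omega> i v x"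
  have H1D: "weak_deriv \<Omega> i u \<in> H1 \<Omega>" "weak_deriv \<Omega> i v \<in> H1 \<Omega>" if "i \<in> Basis" for i
    using u v that by (auto simp: H2_def)
  have ae: "AE x in lebesgue_on \<Omega>. ?D i x = weak_deriv \<Omega> i ?w x" if "i \<in> Basis" for i
    using weak_deriv_lincomb[OF H1 that, of c d] by eventually_elim simp
  have wH1: "weak_deriv \<Omega> i ?w \<in> H1 \<Omega>" if "i \<in> Basis" for i
    by (rule H1_cong_AE[OF H1_lincomb[OF H1D] weak_deriv_L2[OF H1_lincomb[OF H1]] ae])
      (use that in auto)
  then show "?w \<in> H2 \<Omega>"
    using H1_lincomb[OF H1] by (simp add: H2_def)
  have "AE x in lebesgue_on \<Omega>. weak_deriv \<Omega> i (weak_deriv \<Omega> i ?w) x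
      = c * weak_deriv \<Omega> i (weak_deriv \<Omega> i u) x + d * weak_deriv \<Omega> i (weak_deriv \<Omega> i v) x"
    if "i \<in> Basis" for i
    using weak_deriv_cong_AE[OF H1_lincomb[OF H1D[OF that]] wH1[OF that] ae[OF that] that]
      weak_deriv_lincomb[OF H1D[OF that] that, of c d]
    by eventually_elim auto
  then have "AE x in lebesgue_on \<Omega>. \<forall>i\<in>Basis. weak_deriv \<Omega> i (weak_deriv \<Omega> i ?w) x
      = c * weak_deriv \<Omega> i (weak_deriv \<Omega> i u) x + d * weak_deriv \<Omega> i (weak_deriv \<Omega> i v) x"
    by (intro eventually_ball_finite) auto
  then show "AE x in lebesgue_on \<Omega>. laplacian \<Omega> ?w x = c * laplacian \<Omega> u x + d * laplacian \<Omega> v x"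
    by eventually_elim (simp add: laplacian_def sum.distrib sum_distrib_left)
qed

text \<open>\<open>normal_trace\<close> is assembled from chosen derivatives; it is linear in its
  first function because inner products do not see the null sets on which the choices
  differ.\<close>

lemma dom_A0_lincomb:
  assumes u: "u \<in> dom_A0 \<Omega>" and v: "v \<in> dom_A0 \<Omega>"
  shows "(\<lambda>x. c * u x + d * v x) \<in> dom_A0 \<Omega>"
proof -
  let ?w = "\<lambda>x. c * u x + d * v x"
  note H2 = dom_A0_H2[OF u] dom_A0_H2[OF v]
  note H1 = H2(1)[THEN H2_H1] H2(2)[THEN H2_H1]
  have "normal_trace \<Omega> ?w z = 0" if z: "z \<in> H1 \<Omega>" for z
  proof -
    have "l2_inner \<Omega> (weak_deriv \<Omega> i ?w) (weak_deriv \<Omega> i z)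
        = c * l2_inner \<Omega> (weak_deriv \<Omega> i u) (weak_deriv \<Omega> i z)
        + d * l2_inner \<Omega> (weak_deriv \<Omega> i v) (weak_deriv \<Omega> i z)" if i: "i \<in> Basis" for i
      using l2_inner_cong_AE[OF weak_deriv_L2[OF H1_lincomb[OF H1] i]
          L2_lincomb[OF weak_deriv_L2[OF H1(1) i] weak_deriv_L2[OF H1(2) i]]
          weak_deriv_L2[OF z i] weak_deriv_lincomb[OF H1 i]]
      by (simp add: l2_inner_lincomb_left weak_deriv_L2 H1 z i)
    moreover have "l2_inner \<Omega> (laplacian \<Omega> ?w) z
        = c * l2_inner \<Omega> (laplacian \<Omega> u) z + d * l2_inner \<Omega> (laplacian \<Omega> v) z"
      using l2_inner_cong_AE[OF laplacian_L2[OF H2_lincomb[OF H2]]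
          L2_lincomb[OF laplacian_L2[OF H2(1)] laplacian_L2[OF H2(2)]] H1_L2[OF z]
          laplacian_lincomb[OF H2]]
      by (simp add: l2_inner_lincomb_left laplacian_L2 H2 H1_L2 z)
    ultimately have "normal_trace \<Omega> ?w z = c * normal_trace \<Omega> u z + d * normal_trace \<Omega> v z"
      by (simp add: normal_trace_def sum.distrib sum_distrib_left distrib_left)
    then show ?thesis
      using u v z by (simp add: dom_A0_def)
  qed
  then show ?thesis
    using H2_lincomb[OF H2] by (simp add: dom_A0_def)
qed

end


section \<open>Coordinates on the extrapolation space\<close>

locale neumann_setting = bounded_open +
  fixes \<kappa> :: real and \<phi> :: "nat \<Rightarrow> sfun" and lam :: "nat \<Rightarrow> real"
  assumes \<kappa>: "\<kappa> > 0" and basis: "neumann_eigenbasis \<Omega> \<phi> lam"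
begin

text \<open>The eigenvalue of \<A> at \<open>\<phi> (Suc k)\<close>. Eigenfunctions are numbered
  from 1, sequences in \<open>ell2\<close> from 0; hence \<open>Suc\<close> here and in all
  coefficients.\<close>

definition mu :: "nat \<Rightarrow> real" where "mu k = 1 + \<kappa> * lam (Suc k)"

lemma eigenfunction_dom: "k \<ge> 1 \<Longrightarrow> \<phi> k \<in> dom_A0 \<Omega>"
  using basis by (simp add: neumann_eigenbasis_def)

lemma mu_ge_1: "mu k \<ge> 1"
proof -
  have "lam 1 = 0" "lam 1 \<le> lam (Suc k)"
    using basis unfolding neumann_eigenbasis_def by auto
  then show ?thesis using \<kappa> by (simp add: mu_def)
qed

sublocale l2_orthonormal \<Omega> "\<lambda>k. \<phi> (Suc k)"
proof
  show "\<phi> (Suc k) \<in> L2 \<Omega>" for k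
    by (simp add: dom_A0_L2 eigenfunction_dom)
  show "l2_inner \<Omega> (\<phi> (Suc j)) (\<phi> (Suc k)) = (if j = k then 1 else 0)" for j k
    using basis by (simp add: neumann_eigenbasis_def)
qed

lemma parseval:
  assumes f: "f \<in> L2 \<Omega>"
  shows "(\<lambda>k. (l2_inner \<Omega> f (\<phi> (Suc k)))\<^sup>2) sums l2_inner \<Omega> f f"
proof -
  have "(\<lambda>n. l2_norm \<Omega> (\<lambda>x. f x - (\<Sum>k=1..n. l2_inner \<Omega> f (\<phi> k) * \<phi> k x))) \<longlonglongrightarrow> 0"
    using basis f by (simp add: neumann_eigenbasis_def)
  then have "(\<lambda>n. (l2_norm \<Omega> (\<lambda>x. f x - (\<Sum>k=1..n. l2_inner \<Omega> f (\<phi> k) * \<phi> k x)))\<^sup>2) \<longlonglongrightarrow> 0\<^sup>2"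
    by (rule tendsto_power)
  then have "(\<lambda>n. l2_inner \<Omega> f f - (\<Sum>k<n. (l2_inner \<Omega> f (\<phi> (Suc k)))\<^sup>2)) \<longlonglongrightarrow> 0"
    using l2_inner_fourier_remainder[OF f, of "{..<_}"]
    by (simp add: l2_norm_square sum.atLeast1_atMost_eq)
  then have "(\<lambda>n. l2_inner \<Omega> f f - (l2_inner \<Omega> f f - (\<Sum>k<n. (l2_inner \<Omega> f (\<phi> (Suc k)))\<^sup>2)))
      \<longlonglongrightarrow> l2_inner \<Omega> f f - 0"
    by (rule tendsto_diff[OF tendsto_const])
  then show ?thesis by (simp add: sums_def)
qed

definition fourier :: "sfun \<Rightarrow> ell2" where
  "fourier f = Abs_ell2 (\<lambda>k. l2_inner \<Omega> f (\<phi> (Suc k)))"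

lemma ell2_nth_fourier: "f \<in> L2 \<Omega> \<Longrightarrow> ell2_nth (fourier f) k = l2_inner \<Omega> f (\<phi> (Suc k))"
  using parseval[of f] by (simp add: fourier_def sums_iff)

lemma norm_fourier: "f \<in> L2 \<Omega> \<Longrightarrow> norm (fourier f) = l2_norm \<Omega> f"
  using parseval[of f] norm_ell2_square[of "fourier f"]
  by (simp add: ell2_nth_fourier sums_iff l2_norm_def real_sqrt_unique)

lemma fourier_lincomb:
  "f \<in> L2 \<Omega> \<Longrightarrow> g \<in> L2 \<Omega> \<Longrightarrow> fourier (\<lambda>x. c * f x + d * g x) = c *\<^sub>R fourier f + d *\<^sub>R fourier g"
  by (rule ell2_eqI) (simp add: ell2_nth_fourier L2_lincomb l2_inner_lincomb_left e_L2)

lemma fourier_diff: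
  "f \<in> L2 \<Omega> \<Longrightarrow> g \<in> L2 \<Omega> \<Longrightarrow> fourier (\<lambda>x. f x - g x) = fourier f - fourier g"
  using fourier_lincomb[of f g 1 "-1"] by simp

text \<open>Polarization of Parseval's identity: the squared norm of f - g is expanded once in L2
  and once in \<open>ell2\<close>.\<close>

lemma inner_fourier:
  assumes f: "f \<in> L2 \<Omega>" and g: "g \<in> L2 \<Omega>"
  shows "fourier f \<bullet> fourier g = l2_inner \<Omega> f g"
proof -
  let ?h = "\<lambda>x. f x - g x"
  have h: "?h \<in> L2 \<Omega>" by (rule L2_diff[OF f g])
  have "l2_inner \<Omega> ?h ?h = l2_inner \<Omega> ?h f - l2_inner \<Omega> ?h g"
    using l2_inner_diff_left[OF f g h]
    by (simp add: l2_inner_commute[of \<Omega> f ?h] l2_inner_commute[of \<Omega> g ?h])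
  then have "l2_inner \<Omega> ?h ?h = l2_inner \<Omega> f f + l2_inner \<Omega> g g - 2 * l2_inner \<Omega> f g"
    using f g by (simp add: l2_inner_diff_left l2_inner_commute[of \<Omega> g f])
  moreover have "(norm (fourier f - fourier g))\<^sup>2
      = (norm (fourier f))\<^sup>2 + (norm (fourier g))\<^sup>2 - 2 * (fourier f \<bullet> fourier g)"
    by (simp add: power2_norm_eq_inner inner_diff_left inner_diff_right inner_commute)
  ultimately show ?thesis
    using f g h by (simp add: fourier_diff[symmetric] norm_fourier l2_norm_square)
qed

lemma fourier_eq_iff:
  assumes f: "f \<in> L2 \<Omega>" and g: "g \<in> L2 \<Omega>"
  shows "fourier f = fourier g \<longleftrightarrow> (AE x in lebesgue_on \<Omega>. f x = g x)"
proof -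
  have "fourier f = fourier g \<longleftrightarrow> norm (fourier (\<lambda>x. f x - g x)) = 0"
    using f g by (simp add: fourier_diff)
  also have "\<dots> \<longleftrightarrow> (AE x in lebesgue_on \<Omega>. f x - g x = 0)"
    using f g by (simp add: norm_fourier L2_diff l2_norm_def l2_inner_self_eq_0_iff)
  finally show ?thesis by simp
qed

lemma fourier_surj:
  obtains w where "w \<in> L2 \<Omega>" "fourier w = a"
proof -
  obtain w where "w \<in> L2 \<Omega>" "\<And>k. l2_inner \<Omega> w (\<phi> (Suc k)) = ell2_nth a k"
    using riesz_fischer[OF summable_ell2_nth_square[of a]] by blast
  then show ?thesis
    by (intro that[of w] ell2_eqI) (simp_all add: ell2_nth_fourier)
qed

lemma A0_L2: "u \<in> dom_A0 \<Omega> \<Longrightarrow> A0 \<Omega> \<kappa> u \<in> L2 \<Omega>"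
  unfolding A0_def by (intro L2_scale laplacian_L2 dom_A0_H2)

lemma calA_L2: "u \<in> dom_A0 \<Omega> \<Longrightarrow> calA \<Omega> \<kappa> u \<in> L2 \<Omega>"
  unfolding calA_def by (intro L2_diff A0_L2 dom_A0_L2)

lemma fourier_A0: "u \<in> dom_A0 \<Omega> \<Longrightarrow> fourier (A0 \<Omega> \<kappa> u) = fourier u - fourier (calA \<Omega> \<kappa> u)"
  by (simp add: calA_def[abs_def] fourier_diff A0_L2 dom_A0_L2)

text \<open>Symmetry moves the Laplacian from u onto the eigenfunction, so \<A> acts on coefficients
  as multiplication by \<open>mu\<close>.\<close>

lemma ell2_nth_fourier_calA:
  assumes u: "u \<in> dom_A0 \<Omega>"
  shows "ell2_nth (fourier (calA \<Omega> \<kappa> u)) k = mu k * ell2_nth (fourier u) k"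
proof -
  have \<phi>: "\<phi> (Suc k) \<in> dom_A0 \<Omega>" by (simp add: eigenfunction_dom)
  have ae: "AE x in lebesgue_on \<Omega>. laplacian \<Omega> (\<phi> (Suc k)) x = - lam (Suc k) * \<phi> (Suc k) x"
  proof -
    have "AE x in lebesgue_on \<Omega>. - laplacian \<Omega> (\<phi> (Suc k)) x = lam (Suc k) * \<phi> (Suc k) x"
      using basis by (simp add: neumann_eigenbasis_def)
    then show ?thesis by eventually_elim simp
  qed
  have "l2_inner \<Omega> (laplacian \<Omega> u) (\<phi> (Suc k)) = l2_inner \<Omega> (laplacian \<Omega> (\<phi> (Suc k))) u"
    using laplacian_symmetric[OF u \<phi>] by (simp add: l2_inner_commute[of \<Omega> u])
  also have "\<dots> = l2_inner \<Omega> (\<lambda>x. - lam (Suc k) * \<phi> (Suc k) x) u"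
    by (intro l2_inner_cong_AE ae laplacian_L2 L2_scale dom_A0_H2 dom_A0_L2 \<phi> u)
  also have "\<dots> = - lam (Suc k) * l2_inner \<Omega> u (\<phi> (Suc k))"
    by (simp only: l2_inner_scale_left l2_inner_commute[of \<Omega> u])
  finally have "l2_inner \<Omega> (A0 \<Omega> \<kappa> u) (\<phi> (Suc k)) = - \<kappa> * lam (Suc k) * l2_inner \<Omega> u (\<phi> (Suc k))"
    by (simp add: A0_def l2_inner_scale_left)
  then show ?thesis
    using u fourier_A0[OF u, THEN arg_cong, of "\<lambda>a. ell2_nth a k"]
    by (simp add: ell2_nth_fourier A0_L2 dom_A0_L2 mu_def algebra_simps)
qed

text \<open>Linearity of \<A> holds only almost everywhere as functions; on coefficients, where \<A>
  is a multiplier, it is an equation.\<close>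

lemma fourier_calA_lincomb:
  assumes "u \<in> dom_A0 \<Omega>" "v \<in> dom_A0 \<Omega>"
  shows "fourier (calA \<Omega> \<kappa> (\<lambda>x. c * u x + d * v x))
    = c *\<^sub>R fourier (calA \<Omega> \<kappa> u) + d *\<^sub>R fourier (calA \<Omega> \<kappa> v)"
  using assms
  by (intro ell2_eqI)
    (simp add: ell2_nth_fourier_calA dom_A0_lincomb fourier_lincomb dom_A0_L2 algebra_simps)

text \<open>All multipliers are at least 1. Hence the graph norm in \<open>X_space\<close> is
  equivalent to the norm of the image under \<A>.\<close>

lemma norm_fourier_le_calA:
  assumes "u \<in> dom_A0 \<Omega>"
  shows "norm (fourier u) \<le> norm (fourier (calA \<Omega> \<kappa> u))"
proof (rule norm_ell2_mono)
  fix k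
  have "1 * \<bar>ell2_nth (fourier u) k\<bar> \<le> \<bar>mu k\<bar> * \<bar>ell2_nth (fourier u) k\<bar>"
    using mu_ge_1[of k] by (intro mult_right_mono) auto
  then show "\<bar>ell2_nth (fourier u) k\<bar> \<le> \<bar>ell2_nth (fourier (calA \<Omega> \<kappa> u)) k\<bar>"
    using assms by (simp add: ell2_nth_fourier_calA abs_mult)
qed

lemma calA_symmetric:
  assumes "u \<in> dom_A0 \<Omega>" "v \<in> dom_A0 \<Omega>"
  shows "l2_inner \<Omega> u (calA \<Omega> \<kappa> v) = l2_inner \<Omega> (calA \<Omega> \<kappa> u) v"
proof -
  have "fourier u \<bullet> fourier (calA \<Omega> \<kappa> v) = fourier (calA \<Omega> \<kappa> u) \<bullet> fourier v"
    using assms by (simp add: inner_ell2_def ell2_nth_fourier_calA ac_simps)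
  then show ?thesis
    using assms by (simp add: inner_fourier calA_L2 dom_A0_L2)
qed

text \<open>Common to the three functionals built from the identity, \<A> and A0. Linearity of L is
  required only after \<open>fourier\<close>, since these operators need not be linear
  pointwise.\<close>

lemma dual_ext_X_space:
  assumes z: "z \<in> L2 \<Omega>"
    and L: "\<And>v. v \<in> dom_A0 \<Omega> \<Longrightarrow> L v \<in> L2 \<Omega>"
    and lin: "\<And>u v c d. u \<in> dom_A0 \<Omega> \<Longrightarrow> v \<in> dom_A0 \<Omega> \<Longrightarrow>
      fourier (L (\<lambda>x. c * u x + d * v x)) = c *\<^sub>R fourier (L u) + d *\<^sub>R fourier (L v)"
    and bound: "\<And>v. v \<in> dom_A0 \<Omega> \<Longrightarrow> norm (fourier (L v)) \<le> norm (fourier v) + norm (fourier (calA \<Omega> \<kappa> v))"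
  shows "dual_ext \<Omega> L z \<in> X_space \<Omega> \<kappa>"
proof -
  have eq: "dual_ext \<Omega> L z v = fourier z \<bullet> fourier (L v)" if "v \<in> dom_A0 \<Omega>" for v
    using that z L by (simp add: dual_ext_def inner_fourier)
  have lin': "dual_ext \<Omega> L z (\<lambda>x. c * u x + d * v x) = c * dual_ext \<Omega> L z u + d * dual_ext \<Omega> L z v"
    if "u \<in> dom_A0 \<Omega>" "v \<in> dom_A0 \<Omega>" for u v c d
    using that by (simp add: eq dom_A0_lincomb lin inner_add_right)
  have "\<bar>dual_ext \<Omega> L z v\<bar> \<le> norm (fourier z) * (l2_norm \<Omega> v + l2_norm \<Omega> (calA \<Omega> \<kappa> v))"
    if v: "v \<in> dom_A0 \<Omega>" for v
  proof -
    have "\<bar>dual_ext \<Omega> L z v\<bar> \<le> norm (fourier z) * norm (fourier (L v))"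
      unfolding eq[OF v] by (rule Cauchy_Schwarz_ineq2)
    also have "\<dots> \<le> norm (fourier z) * (norm (fourier v) + norm (fourier (calA \<Omega> \<kappa> v)))"
      by (intro mult_left_mono bound v) simp
    finally show ?thesis
      using v by (simp add: norm_fourier dom_A0_L2 calA_L2)
  qed
  moreover have "dual_ext \<Omega> L z (u + v) = dual_ext \<Omega> L z u + dual_ext \<Omega> L z v"
    if "u \<in> dom_A0 \<Omega>" "v \<in> dom_A0 \<Omega>" for u v
    using lin'[OF that, of 1 1] by (simp add: plus_fun_def)
  moreover have "dual_ext \<Omega> L z (c *\<^sub>R v) = c * dual_ext \<Omega> L z v" if "v \<in> dom_A0 \<Omega>" for c v
    using lin'[OF that that, of c 0] by (simp add: scaleR_fun_def)
  ultimately show ?thesis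
    unfolding X_space_def by (auto simp: dual_ext_def)
qed

lemma embed_X_space: "z \<in> L2 \<Omega> \<Longrightarrow> embed_X \<Omega> z \<in> X_space \<Omega> \<kappa>"
  unfolding embed_X_def by (rule dual_ext_X_space) (auto simp: dom_A0_L2 fourier_lincomb)

lemma dual_ext_calA_X_space: "z \<in> L2 \<Omega> \<Longrightarrow> dual_ext \<Omega> (calA \<Omega> \<kappa>) z \<in> X_space \<Omega> \<kappa>"
  by (rule dual_ext_X_space) (auto simp: calA_L2 fourier_calA_lincomb)

lemma dual_ext_A0_X_space: "z \<in> L2 \<Omega> \<Longrightarrow> dual_ext \<Omega> (A0 \<Omega> \<kappa>) z \<in> X_space \<Omega> \<kappa>"
  by (rule dual_ext_X_space)
    (auto simp: A0_L2 fourier_A0 fourier_calA_lincomb fourier_lincomb dom_A0_lincomb dom_A0_L2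
      algebra_simps intro: norm_triangle_ineq4)

lemma dom_A0_fourier_sum: "finite I \<Longrightarrow> fourier_sum c I \<in> dom_A0 \<Omega>"
proof (induction I rule: finite_induct)
  case empty
  then show ?case
    using dom_A0_lincomb[OF eigenfunction_dom[of 1] eigenfunction_dom[of 1], of 0 0] by simp
next
  case (insert i I)
  then show ?case
    using dom_A0_lincomb[OF eigenfunction_dom[of "Suc i"] insert.IH, of "c i" 1] by simp
qed

section \<open>Eigenbasis coefficients of a functional in the extrapolation space\<close>

context
  fixes \<eta> assumes \<eta>: "\<eta> \<in> X_space \<Omega> \<kappa>"
begin

lemma X_space_add: "u \<in> dom_A0 \<Omega> \<Longrightarrow> v \<in> dom_A0 \<Omega> \<Longrightarrow> \<eta> (\<lambda>x. u x + v x) = \<eta> u + \<eta> v"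
  using \<eta> by (simp add: X_space_def plus_fun_def)

lemma X_space_scale: "v \<in> dom_A0 \<Omega> \<Longrightarrow> \<eta> (\<lambda>x. c * v x) = c * \<eta> v"
  using \<eta> by (simp add: X_space_def scaleR_fun_def)

lemma X_space_bound:
  obtains C where "C \<ge> 0" "\<And>v. v \<in> dom_A0 \<Omega> \<Longrightarrow> \<bar>\<eta> v\<bar> \<le> C * norm (fourier (calA \<Omega> \<kappa> v))"
proof -
  obtain C where C: "\<And>v. v \<in> dom_A0 \<Omega> \<Longrightarrow> \<bar>\<eta> v\<bar> \<le> C * (l2_norm \<Omega> v + l2_norm \<Omega> (calA \<Omega> \<kappa> v))"
    using \<eta> unfolding X_space_def by blast
  \<comment> \<open>The constant in \<open>X_space\<close> carries no sign, hence the absolute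
    value; the factor 2 absorbs the norm of v into that of its image under \<A>.\<close>
  have "\<bar>\<eta> v\<bar> \<le> 2 * \<bar>C\<bar> * norm (fourier (calA \<Omega> \<kappa> v))" if v: "v \<in> dom_A0 \<Omega>" for v
  proof -
    have "\<bar>\<eta> v\<bar> \<le> C * (norm (fourier v) + norm (fourier (calA \<Omega> \<kappa> v)))"
      using C[OF v] v by (simp add: norm_fourier dom_A0_L2 calA_L2)
    also have "\<dots> \<le> \<bar>C\<bar> * (norm (fourier v) + norm (fourier (calA \<Omega> \<kappa> v)))"
      by (intro mult_right_mono) auto
    also have "\<dots> \<le> \<bar>C\<bar> * (2 * norm (fourier (calA \<Omega> \<kappa> v)))"
      using norm_fourier_le_calA[OF v] by (intro mult_left_mono) auto
    finally show ?thesis by simp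
  qed
  then show ?thesis by (intro that[of "2 * \<bar>C\<bar>"]) auto
qed

lemma X_space_fourier_sum:
  "finite I \<Longrightarrow> \<eta> (fourier_sum c I) = (\<Sum>k\<in>I. c k * \<eta> (\<phi> (Suc k)))"
proof (induction I rule: finite_induct)
  case empty
  then show ?case
    using X_space_scale[OF eigenfunction_dom[of 1], of 0] by simp
next
  case (insert i I)
  have i: "\<phi> (Suc i) \<in> dom_A0 \<Omega>" by (simp add: eigenfunction_dom)
  have "\<eta> (\<lambda>x. c i * \<phi> (Suc i) x + fourier_sum c I x) = \<eta> (\<lambda>x. c i * \<phi> (Suc i) x) + \<eta> (fourier_sum c I)"
    using dom_A0_lincomb[OF i i, of "c i" 0] insert.hyps
    by (intro X_space_add dom_A0_fourier_sum) auto
  then show ?case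
    using insert by (simp add: X_space_scale[OF i])
qed

text \<open>Converse Hoelder argument: \<eta> is tested on the finite sum v with coefficients
  \<open>a k / mu k\<close>, chosen so that \<A> v has coefficients \<open>a k\<close> and \<eta> v
  is the sum of their squares. The bound on \<eta> then controls that sum by its own square
  root.\<close>

lemma summable_X_coefficients: "summable (\<lambda>k. (\<eta> (\<phi> (Suc k)) / mu k)\<^sup>2)"
proof -
  obtain C where C: "C \<ge> 0" "\<And>v. v \<in> dom_A0 \<Omega> \<Longrightarrow> \<bar>\<eta> v\<bar> \<le> C * norm (fourier (calA \<Omega> \<kappa> v))"
    using X_space_bound by blast
  define a where "a k = \<eta> (\<phi> (Suc k)) / mu k" for k
  have mu0: "mu k \<noteq> 0" for k using mu_ge_1[of k] by linarith
  have "(\<Sum>k<m. (a k)\<^sup>2) \<le> C\<^sup>2" for m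
  proof -
    define v where "v = fourier_sum (\<lambda>k. a k / mu k) {..<m}"
    have v: "v \<in> dom_A0 \<Omega>" unfolding v_def by (rule dom_A0_fourier_sum) simp
    have \<eta>v: "\<eta> v = (\<Sum>k<m. (a k)\<^sup>2)"
      unfolding v_def by (subst X_space_fourier_sum)
        (auto simp: a_def power2_eq_square mu0 intro!: sum.cong)
    have "l2_inner \<Omega> v (\<phi> (Suc k)) = (if k < m then a k / mu k else 0)" for k
      unfolding v_def by (subst l2_inner_fourier_sum_basis) auto
    then have nth: "ell2_nth (fourier (calA \<Omega> \<kappa> v)) k = (if k < m then a k else 0)" for k
      using v mu0 by (simp add: ell2_nth_fourier_calA ell2_nth_fourier dom_A0_L2)
    have "(norm (fourier (calA \<Omega> \<kappa> v)))\<^sup>2 = (\<Sum>k. if k < m then (a k)\<^sup>2 else 0)"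
      unfolding norm_ell2_square nth by (intro arg_cong[where f = suminf]) auto
    also have "\<dots> = (\<Sum>k<m. (a k)\<^sup>2)"
      using sums_If_finite_set[of "{..<m}" "\<lambda>k. (a k)\<^sup>2"] by (simp add: sums_iff)
    finally have n: "(norm (fourier (calA \<Omega> \<kappa> v)))\<^sup>2 = (\<Sum>k<m. (a k)\<^sup>2)" .
    then have "(norm (fourier (calA \<Omega> \<kappa> v)))\<^sup>2 \<le> C * norm (fourier (calA \<Omega> \<kappa> v))"
      using C(2)[OF v] \<eta>v by simp
    \<comment> \<open>Division by the norm; if the norm is zero, nonnegativity of C gives the
      claim.\<close>
    then have "norm (fourier (calA \<Omega> \<kappa> v)) \<le> C"
      using C(1) by (cases "norm (fourier (calA \<Omega> \<kappa> v)) = 0") (auto simp: power2_eq_square)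
    then show ?thesis
      unfolding n[symmetric] by (intro power_mono) auto
  qed
  then show ?thesis
    unfolding a_def by (rule summable_square_bounded(1))
qed

end

text \<open>The coefficients of \<open>\<A>\<^sup>-\<^sup>1 \<eta>\<close> in the eigenbasis; this identifies \<open>\<X>\<close> isometrically with
  \<open>\<ell>\<^sup>2\<close>.\<close>

definition X_coords :: "functional \<Rightarrow> ell2" where
  "X_coords \<eta> = Abs_ell2 (\<lambda>k. \<eta> (\<phi> (Suc k)) / mu k)"

lemma ell2_nth_X_coords: "\<eta> \<in> X_space \<Omega> \<kappa> \<Longrightarrow> ell2_nth (X_coords \<eta>) k = \<eta> (\<phi> (Suc k)) / mu k"
  using summable_X_coefficients by (simp add: X_coords_def)

text \<open>Fourier sums of v converge to v in the norm to which \<eta> is bounded: truncation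
  commutes with the multiplier \<open>mu\<close>, so \<A> maps the remainder to the tail of the
  square-summable coefficients of \<A> v. On the finite sums the identity is linearity.\<close>

lemma X_space_representation:
  assumes \<eta>: "\<eta> \<in> X_space \<Omega> \<kappa>" and v: "v \<in> dom_A0 \<Omega>"
  shows "\<eta> v = X_coords \<eta> \<bullet> fourier (calA \<Omega> \<kappa> v)"
proof -
  obtain C where C: "C \<ge> 0" "\<And>v. v \<in> dom_A0 \<Omega> \<Longrightarrow> \<bar>\<eta> v\<bar> \<le> C * norm (fourier (calA \<Omega> \<kappa> v))"
    using X_space_bound[OF \<eta>] by blast
  have mu0: "mu k \<noteq> 0" for k using mu_ge_1[of k] by linarith
  let ?c = "\<lambda>k. l2_inner \<Omega> v (\<phi> (Suc k))"
  let ?s = "\<lambda>n. fourier_sum ?c {..<n}"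
  let ?A = "\<lambda>u. fourier (calA \<Omega> \<kappa> u)"
  have s: "?s n \<in> dom_A0 \<Omega>" for n
    by (rule dom_A0_fourier_sum) simp
  have r: "(\<lambda>x. v x - ?s n x) \<in> dom_A0 \<Omega>" for n
    using dom_A0_lincomb[OF v s, of 1 "-1"] by simp
  have \<eta>s: "\<eta> (?s n) = (\<Sum>k<n. ell2_nth (X_coords \<eta>) k * ell2_nth (?A v) k)" for n
    by (subst X_space_fourier_sum[OF \<eta>])
      (auto simp: ell2_nth_X_coords \<eta> ell2_nth_fourier_calA v ell2_nth_fourier dom_A0_L2 mu0 intro!: sum.cong)
  have lim: "(\<lambda>n. \<eta> (?s n)) \<longlonglongrightarrow> X_coords \<eta> \<bullet> ?A v"
    unfolding \<eta>s using ell2_nth_sums_inner by (simp add: sums_def)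
  have "(\<lambda>n. \<eta> (\<lambda>x. v x - ?s n x)) \<longlonglongrightarrow> 0"
  proof (rule Lim_null_comparison)
    show "\<forall>\<^sub>F n in sequentially. norm (\<eta> (\<lambda>x. v x - ?s n x)) \<le> C * norm (?A (\<lambda>x. v x - ?s n x))"
      using C(2)[OF r] by simp
    have nth: "ell2_nth (?A (\<lambda>x. v x - ?s n x)) k = (if k < n then 0 else ell2_nth (?A v) k)" for n k
      by (simp add: ell2_nth_fourier_calA[OF r] ell2_nth_fourier_calA[OF v] fourier_diff dom_A0_L2 v s
          ell2_nth_fourier)
        (simp add: l2_inner_fourier_sum_basis)
    have "(norm (?A (\<lambda>x. v x - ?s n x)))\<^sup>2 = (norm (?A v))\<^sup>2 - (\<Sum>k<n. (ell2_nth (?A v) k)\<^sup>2)" for n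
    proof -
      have "(\<lambda>k. (ell2_nth (?A v) k)\<^sup>2 - (if k \<in> {..<n} then (ell2_nth (?A v) k)\<^sup>2 else 0))
          sums ((norm (?A v))\<^sup>2 - (\<Sum>k<n. (ell2_nth (?A v) k)\<^sup>2))"
        by (intro sums_diff ell2_nth_square_sums sums_If_finite_set) simp
      also have "(\<lambda>k. (ell2_nth (?A v) k)\<^sup>2 - (if k \<in> {..<n} then (ell2_nth (?A v) k)\<^sup>2 else 0))
          = (\<lambda>k. (ell2_nth (?A (\<lambda>x. v x - ?s n x)) k)\<^sup>2)"
        by (auto simp: nth)
      finally show ?thesis
        using ell2_nth_square_sums sums_unique2 by blast
    qed
    moreover have "(\<lambda>n. (norm (?A v))\<^sup>2 - (\<Sum>k<n. (ell2_nth (?A v) k)\<^sup>2)) \<longlonglongrightarrow> (norm (?A v))\<^sup>2 - (norm (?A v))\<^sup>2"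
      using ell2_nth_square_sums[of "?A v"] unfolding sums_def by (intro tendsto_diff tendsto_const)
    ultimately have "(\<lambda>n. (norm (?A (\<lambda>x. v x - ?s n x)))\<^sup>2) \<longlonglongrightarrow> 0"
      by simp
    then have "(\<lambda>n. sqrt ((norm (?A (\<lambda>x. v x - ?s n x)))\<^sup>2)) \<longlonglongrightarrow> sqrt 0"
      by (rule tendsto_real_sqrt)
    then show "(\<lambda>n. C * norm (?A (\<lambda>x. v x - ?s n x))) \<longlonglongrightarrow> 0"
      by (intro tendsto_mult_right_zero) simp
  qed
  moreover have "\<eta> (\<lambda>x. v x - ?s n x) + \<eta> (?s n) = \<eta> v" for n
    using X_space_add[OF \<eta> r[of n] s[of n]] by simp
  ultimately have "(\<lambda>n. \<eta> v) \<longlonglongrightarrow> 0 + X_coords \<eta> \<bullet> ?A v"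
    using tendsto_add[OF _ lim] by fastforce
  then show ?thesis by (simp add: LIMSEQ_const_iff)
qed

lemma X_coords_dual_ext_calA:
  assumes w: "w \<in> L2 \<Omega>"
  shows "X_coords (dual_ext \<Omega> (calA \<Omega> \<kappa>) w) = fourier w"
proof (rule ell2_eqI)
  fix k
  have \<phi>: "\<phi> (Suc k) \<in> dom_A0 \<Omega>" by (simp add: eigenfunction_dom)
  have mu0: "mu k \<noteq> 0" using mu_ge_1[of k] by linarith
  have "fourier (calA \<Omega> \<kappa> (\<phi> (Suc k))) = mu k *\<^sub>R fourier (\<phi> (Suc k))"
    by (rule ell2_eqI) (simp add: ell2_nth_fourier_calA[OF \<phi>] ell2_nth_fourier[OF e_L2] orthonormal)
  then have "l2_inner \<Omega> w (calA \<Omega> \<kappa> (\<phi> (Suc k))) = mu k * l2_inner \<Omega> w (\<phi> (Suc k))"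
    using w \<phi> by (metis inner_fourier inner_scaleR_right calA_L2 e_L2)
  then show "ell2_nth (X_coords (dual_ext \<Omega> (calA \<Omega> \<kappa>) w)) k = ell2_nth (fourier w) k"
    using w \<phi> mu0
    by (simp add: ell2_nth_X_coords dual_ext_calA_X_space ell2_nth_fourier) (simp add: dual_ext_def)
qed

lemma X_coords_inj:
  assumes "\<eta> \<in> X_space \<Omega> \<kappa>" "\<theta> \<in> X_space \<Omega> \<kappa>" "X_coords \<eta> = X_coords \<theta>"
  shows "\<eta> = \<theta>"
proof
  fix v
  show "\<eta> v = \<theta> v"
  proof (cases "v \<in> dom_A0 \<Omega>")
    case True
    then show ?thesis using assms by (simp add: X_space_representation)
  next
    case False
    then show ?thesis using assms by (simp add: X_space_def)
  qed
qed

text \<open>Riesz-Fischer supplies a function with the coordinates of \<eta>, and injectivity of the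
  coordinates shows that it represents \<eta>, so the choice in \<open>calA_inv\<close> is from a
  nonempty set. The chosen function is fixed only up to null sets, its coefficients are fixed
  exactly.\<close>

lemma calA_inv_spec:
  assumes \<eta>: "\<eta> \<in> X_space \<Omega> \<kappa>"
  shows calA_inv_L2: "calA_inv \<Omega> \<kappa> \<eta> \<in> L2 \<Omega>"
    and fourier_calA_inv: "fourier (calA_inv \<Omega> \<kappa> \<eta>) = X_coords \<eta>"
proof -
  obtain w where w: "w \<in> L2 \<Omega>" "fourier w = X_coords \<eta>"
    by (rule fourier_surj)
  then have "dual_ext \<Omega> (calA \<Omega> \<kappa>) w = \<eta>"
    using \<eta> by (intro X_coords_inj) (simp_all add: dual_ext_calA_X_space X_coords_dual_ext_calA)
  with w have "\<exists>w. w \<in> L2 \<Omega> \<and> dual_ext \<Omega> (calA \<Omega> \<kappa>) w = \<eta>" by blast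
  from someI_ex[OF this]
  have *: "calA_inv \<Omega> \<kappa> \<eta> \<in> L2 \<Omega>" "dual_ext \<Omega> (calA \<Omega> \<kappa>) (calA_inv \<Omega> \<kappa> \<eta>) = \<eta>"
    by (simp_all add: calA_inv_def)
  then show "calA_inv \<Omega> \<kappa> \<eta> \<in> L2 \<Omega>" "fourier (calA_inv \<Omega> \<kappa> \<eta>) = X_coords \<eta>"
    using X_coords_dual_ext_calA by metis+
qed

lemma X_norm_eq: "\<eta> \<in> X_space \<Omega> \<kappa> \<Longrightarrow> X_norm \<Omega> \<kappa> \<eta> = norm (X_coords \<eta>)"
  by (simp add: X_norm_def norm_fourier[symmetric] calA_inv_L2 fourier_calA_inv)

lemma X_coords_surj:
  obtains \<eta> where "\<eta> \<in> X_space \<Omega> \<kappa>" "X_coords \<eta> = a"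
  using fourier_surj[of a] dual_ext_calA_X_space X_coords_dual_ext_calA by metis

text \<open>Every element of \<open>X_space\<close> is \<open>dual_ext\<close> of \<A> at some L2
  function, so linear combinations can be formed in L2, where \<open>fourier\<close> is
  linear.\<close>

lemma subspace_X_space: "subspace (X_space \<Omega> \<kappa>)"
  and X_coords_add: "\<eta> \<in> X_space \<Omega> \<kappa> \<Longrightarrow> \<theta> \<in> X_space \<Omega> \<kappa> \<Longrightarrow>
    X_coords (\<eta> + \<theta>) = X_coords \<eta> + X_coords \<theta>"
  and X_coords_scaleR: "\<eta> \<in> X_space \<Omega> \<kappa> \<Longrightarrow> X_coords (c *\<^sub>R \<eta>) = c *\<^sub>R X_coords \<eta>"
proof -
  have dual: "dual_ext \<Omega> (calA \<Omega> \<kappa>) (\<lambda>x. c * w x + d * z x)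
      = c *\<^sub>R dual_ext \<Omega> (calA \<Omega> \<kappa>) w + d *\<^sub>R dual_ext \<Omega> (calA \<Omega> \<kappa>) z"
    if "w \<in> L2 \<Omega>" "z \<in> L2 \<Omega>" for c d w z
    using that by (auto simp: fun_eq_iff dual_ext_def scaleR_fun_def l2_inner_lincomb_left calA_L2)
  have ex: "\<exists>w\<in>L2 \<Omega>. dual_ext \<Omega> (calA \<Omega> \<kappa>) w = \<eta>" if "\<eta> \<in> X_space \<Omega> \<kappa>" for \<eta>
    using fourier_surj[of "X_coords \<eta>"] that
    by (metis X_coords_inj dual_ext_calA_X_space X_coords_dual_ext_calA)
  have lin: "c *\<^sub>R \<eta> + d *\<^sub>R \<theta> \<in> X_space \<Omega> \<kappa> \<and>
      X_coords (c *\<^sub>R \<eta> + d *\<^sub>R \<theta>) = c *\<^sub>R X_coords \<eta> + d *\<^sub>R X_coords \<theta>"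
    if mem: "\<eta> \<in> X_space \<Omega> \<kappa>" "\<theta> \<in> X_space \<Omega> \<kappa>" for c d \<eta> \<theta>
  proof -
    obtain w z where wz: "w \<in> L2 \<Omega>" "dual_ext \<Omega> (calA \<Omega> \<kappa>) w = \<eta>"
      "z \<in> L2 \<Omega>" "dual_ext \<Omega> (calA \<Omega> \<kappa>) z = \<theta>"
      using ex mem by meson
    then show ?thesis
      using dual[OF wz(1,3), of c d, symmetric] dual_ext_calA_X_space[OF L2_lincomb[OF wz(1,3), of c d]]
        X_coords_dual_ext_calA[OF L2_lincomb[OF wz(1,3), of c d]]
        X_coords_dual_ext_calA[OF wz(1)] X_coords_dual_ext_calA[OF wz(3)]
      by (simp add: fourier_lincomb)
  qed
  have zero: "0 \<in> X_space \<Omega> \<kappa>"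
    using lin[OF embed_X_space[OF L2_zero] embed_X_space[OF L2_zero], of 0 0] by simp
  show "subspace (X_space \<Omega> \<kappa>)"
    unfolding subspace_def using zero lin[of _ _ 1 1] lin[of _ _ _ 0] by auto
  show "X_coords (\<eta> + \<theta>) = X_coords \<eta> + X_coords \<theta>"
    if "\<eta> \<in> X_space \<Omega> \<kappa>" "\<theta> \<in> X_space \<Omega> \<kappa>" for \<eta> \<theta>
    using lin[OF that, of 1 1] by simp
  show "X_coords (c *\<^sub>R \<eta>) = c *\<^sub>R X_coords \<eta>" if "\<eta> \<in> X_space \<Omega> \<kappa>" for \<eta> c
    using lin[OF that that, of c 0] by simp
qed

end


section \<open>Integrals of exponentially stable semigroups\<close>

text \<open>Rescaling to a unit vector. In \<open>ennreal\<close> an infinite operator norm times 0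
  is 0, so a vector of norm zero is a separate case, settled by definiteness.\<close>

lemma le_op_norm:
  fixes V :: "'v::real_vector set" and F :: "'v \<Rightarrow> 'w::real_vector"
  assumes scale: "\<And>c x. x \<in> V \<Longrightarrow> c *\<^sub>R x \<in> V \<and> F (c *\<^sub>R x) = c *\<^sub>R F x \<and>
      nV (c *\<^sub>R x) = \<bar>c\<bar> * nV x \<and> nW (c *\<^sub>R F x) = \<bar>c\<bar> * nW (F x)"
    and pos: "nV x \<ge> 0" "nV x = 0 \<Longrightarrow> x = 0"
    and x: "x \<in> V"
  shows "ennreal (nW (F x)) \<le> op_norm V nV nW F * ennreal (nV x)"
proof (cases "nV x = 0")
  case True
  then have "nW (F x) = 0"
    using scale[OF x, of 0] pos(2) by simp
  then show ?thesis by simp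
next
  case False
  then have nV: "nV x > 0" using pos(1) by simp
  let ?u = "(1 / nV x) *\<^sub>R x"
  have u: "?u \<in> {u \<in> V. nV u \<le> 1}"
    using scale[OF x, of "1 / nV x"] nV by simp
  have "ennreal (nW (F x)) = ennreal (nW (F ?u)) * ennreal (nV x)"
    using scale[OF x, of "1 / nV x"] nV by (simp add: ennreal_mult''[symmetric])
  also have "\<dots> \<le> op_norm V nV nW F * ennreal (nV x)"
    unfolding op_norm_def using u by (intro mult_right_mono SUP_upper) auto
  finally show ?thesis .
qed

text \<open>A Banach space given by carrier and norm, with an isometric isomorphism J onto a Banach
  type. Nothing is known about J or the norm off V, so each transfer has to check
  membership.\<close>

locale banach_carrier =
  fixes V :: "'v::real_vector set" and nrm :: "'v \<Rightarrow> real" and J :: "'v \<Rightarrow> 'b::banach"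
  assumes subspace: "subspace V"
    and J_add: "\<And>x y. x \<in> V \<Longrightarrow> y \<in> V \<Longrightarrow> J (x + y) = J x + J y"
    and J_scaleR: "\<And>c x. x \<in> V \<Longrightarrow> J (c *\<^sub>R x) = c *\<^sub>R J x"
    and J_inj: "\<And>x y. x \<in> V \<Longrightarrow> y \<in> V \<Longrightarrow> J x = J y \<Longrightarrow> x = y"
    and J_surj: "\<And>a. \<exists>x\<in>V. J x = a"
    and nrm: "\<And>x. x \<in> V \<Longrightarrow> nrm x = norm (J x)"
begin

lemmas V_closed = subspace_0[OF subspace] subspace_add[OF subspace] subspace_diff[OF subspace]
  subspace_scale[OF subspace] subspace_sum[OF subspace]

lemma J_zero: "J 0 = 0"
  using J_scaleR[of 0 0] V_closed(1) by simp

lemma J_diff: "x \<in> V \<Longrightarrow> y \<in> V \<Longrightarrow> J (x - y) = J x - J y"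
  using J_add[of "x - y" y] V_closed(3)[of x y] by simp

lemma J_sum: "(\<And>i. i \<in> I \<Longrightarrow> f i \<in> V) \<Longrightarrow> J (\<Sum>i\<in>I. f i) = (\<Sum>i\<in>I. J (f i))"
proof (induction I rule: infinite_finite_induct)
  case (insert i I)
  then show ?case using V_closed(5)[of I f] by (simp add: J_add)
qed (simp_all add: J_zero)

lemma nrm_eq_0: "x \<in> V \<Longrightarrow> nrm x = 0 \<Longrightarrow> x = 0"
  using J_inj[of x 0] V_closed(1) by (simp add: nrm J_zero)

lemma nrm_nonneg: "x \<in> V \<Longrightarrow> 0 \<le> nrm x"
  by (simp add: nrm)

lemma nrm_scaleR: "x \<in> V \<Longrightarrow> nrm (c *\<^sub>R x) = \<bar>c\<bar> * nrm x"
  by (simp add: nrm J_scaleR V_closed(4))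

lemma J_tagged_sum:
  assumes f: "\<And>t. t \<in> {a..b} \<Longrightarrow> f t \<in> V" and p: "p tagged_division_of {a..b::real}"
  shows "(\<Sum>(x, k)\<in>p. measure lborel k *\<^sub>R f x) \<in> V"
    and "J (\<Sum>(x, k)\<in>p. measure lborel k *\<^sub>R f x) = (\<Sum>(x, k)\<in>p. measure lborel k *\<^sub>R J (f x))"
proof -
  have *: "f x \<in> V" if "(x, k) \<in> p" for x k
    using p that f by (meson tag_in_interval cbox_interval)
  then have **: "(case z of (x, k) \<Rightarrow> measure lborel k *\<^sub>R f x) \<in> V" if "z \<in> p" for z
    using *[of "fst z" "snd z"] that by (simp add: case_prod_unfold V_closed(4))
  show "(\<Sum>(x, k)\<in>p. measure lborel k *\<^sub>R f x) \<in> V"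
    using ** by (rule V_closed(5))
  show "J (\<Sum>(x, k)\<in>p. measure lborel k *\<^sub>R f x) = (\<Sum>(x, k)\<in>p. measure lborel k *\<^sub>R J (f x))"
    by (subst J_sum[OF **], assumption) (auto simp: J_scaleR * intro!: sum.cong)
qed

text \<open>A uniform mesh is the gauge with constant radius, so Riemann sums are a special case of
  gauge sums.\<close>

lemma has_riemann_integral_imp_has_integral:
  assumes f: "\<And>t. t \<in> {a..b} \<Longrightarrow> f t \<in> V" and y: "has_riemann_integral V nrm f a b y"
  shows "((\<lambda>t. J (f t)) has_integral J y) {a..b}"
proof -
  have "((\<lambda>t. J (f t)) has_integral J y) (cbox a b)"
    unfolding has_integral
  proof (intro allI impI)
    fix e :: real assume "e > 0"
    then obtain d where d: "d > 0" "\<And>p. p tagged_division_of {a..b} \<Longrightarrow> (\<lambda>x. ball x d) fine p \<Longrightarrow>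
        nrm ((\<Sum>(x, k)\<in>p. measure lborel k *\<^sub>R f x) - y) < e"
      using y unfolding has_riemann_integral_def by meson
    have "norm ((\<Sum>(x, k)\<in>p. measure lborel k *\<^sub>R J (f x)) - J y) < e"
      if p: "p tagged_division_of {a..b}" "(\<lambda>x. ball x d) fine p" for p
      using d(2)[OF p] y J_tagged_sum[OF f p(1)]
      by (simp add: has_riemann_integral_def nrm J_diff V_closed(3))
    then show "\<exists>\<gamma>. gauge \<gamma> \<and> (\<forall>p. p tagged_division_of cbox a b \<and> \<gamma> fine p \<longrightarrow>
        norm ((\<Sum>(x, k)\<in>p. measure lborel k *\<^sub>R J (f x)) - J y) < e)"
      using d(1) by (intro exI[of _ "\<lambda>x. ball x d"]) (auto simp: gauge_ball)
  qed
  then show ?thesis by simp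
qed

text \<open>A gauge integral alone would allow a radius varying with the tag; uniform continuity on
  the compact interval provides one mesh for all tags.\<close>

lemma has_riemann_integral_continuous:
  assumes f: "\<And>t. t \<in> {a..b} \<Longrightarrow> f t \<in> V" and cont: "continuous_on {a..b} (\<lambda>t. J (f t))"
    and y: "y \<in> V" "J y = integral {a..b} (\<lambda>t. J (f t))" and "a \<le> b"
  shows "has_riemann_integral V nrm f a b y"
  unfolding has_riemann_integral_def
proof (intro conjI allI impI y(1))
  fix e :: real assume "e > 0"
  \<comment> \<open>The added 1 keeps the denominator positive when a = b and makes the final
    estimate strict.\<close>
  define \<epsilon> where "\<epsilon> = e / (b - a + 1)"
  have \<epsilon>: "\<epsilon> > 0" "\<epsilon> * (b - a) < e"
    using \<open>e > 0\<close> \<open>a \<le> b\<close> by (auto simp: \<epsilon>_def field_simps)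
  let ?g = "\<lambda>t. J (f t)"
  have int: "?g integrable_on cbox a b"
    using cont by (simp add: integrable_continuous_interval)
  have "uniformly_continuous_on {a..b} ?g"
    using cont by (intro compact_uniformly_continuous) auto
  then obtain d where d: "d > 0"
    "\<And>s t. s \<in> {a..b} \<Longrightarrow> t \<in> {a..b} \<Longrightarrow> dist t s < d \<Longrightarrow> dist (?g t) (?g s) < \<epsilon>"
    using \<epsilon>(1) unfolding uniformly_continuous_on_def by meson
  show "\<exists>d>0. \<forall>p. p tagged_division_of {a..b} \<and> (\<lambda>x. ball x d) fine p \<longrightarrow>
      nrm ((\<Sum>(x, k)\<in>p. measure lborel k *\<^sub>R f x) - y) < e"
  proof (intro exI[of _ d] conjI allI impI d(1))
    fix p assume "p tagged_division_of {a..b} \<and> (\<lambda>x. ball x d) fine p"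
    then have p: "p tagged_division_of {a..b}" "(\<lambda>x. ball x d) fine p" by auto
    have piece: "norm (measure lborel k *\<^sub>R ?g x - integral k ?g) \<le> \<epsilon> * measure lborel k"
      if xk: "(x, k) \<in> p" for x k
    proof -
      obtain u v where k: "k = cbox u v"
        using tagged_division_ofD(4)[OF p(1) xk] by blast
      have sub: "k \<subseteq> {a..b}" and x: "x \<in> {a..b}"
        using tagged_division_ofD(2,3)[OF p(1) xk] by auto
      have "?g integrable_on cbox u v"
        using integrable_on_subcbox[OF int, of u v] sub k by simp
      then have "((\<lambda>t. ?g x - ?g t) has_integral (measure lborel k *\<^sub>R ?g x - integral k ?g)) (cbox u v)"
        unfolding k by (intro has_integral_diff has_integral_const integrable_integral)
      moreover have "norm (?g x - ?g t) \<le> \<epsilon>" if "t \<in> cbox u v" for t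
      proof -
        have "t \<in> ball x d" using p(2) xk that k unfolding fine_def by blast
        then have "dist (?g x) (?g t) < \<epsilon>"
          using sub that k x by (intro d(2)) auto
        then show ?thesis by (simp add: dist_norm)
      qed
      ultimately show ?thesis
        unfolding k using \<epsilon>(1) by (intro has_integral_bound) auto
    qed
    have "(\<Sum>(x, k)\<in>p. measure lborel k *\<^sub>R ?g x) - J y
        = (\<Sum>(x, k)\<in>p. measure lborel k *\<^sub>R ?g x - integral k ?g)"
      using integral_combine_tagged_division_topdown[OF int, of p] p(1)
      by (simp add: y(2) sum_subtractf case_prod_unfold)
    also have "norm \<dots> \<le> (\<Sum>(x, k)\<in>p. \<epsilon> * measure lborel k)"
      using piece by (intro sum_norm_le) auto
    also have "\<dots> = \<epsilon> * (\<Sum>(x, k)\<in>p. measure lborel k)"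
      by (simp add: sum_distrib_left case_prod_unfold)
    also have "\<dots> = \<epsilon> * (b - a)"
      using additive_content_tagged_division[of p a b] p(1) \<open>a \<le> b\<close> by simp
    finally show "nrm ((\<Sum>(x, k)\<in>p. measure lborel k *\<^sub>R f x) - y) < e"
      using \<epsilon>(2) J_tagged_sum[OF f p(1)] y(1) by (simp add: nrm J_diff V_closed(3))
  qed
qed

text \<open>The defining condition asks for integrals inside V. Surjectivity of J pulls the
  integrals computed in the Banach type back into V.\<close>

lemma has_improper_integral_iff:
  assumes f: "\<And>t. t \<ge> 0 \<Longrightarrow> f t \<in> V" and cont: "continuous_on {0..} (\<lambda>t. J (f t))"
  shows "has_improper_integral V nrm f y \<longleftrightarrow>
    y \<in> V \<and> ((\<lambda>b. integral {0..b} (\<lambda>t. J (f t))) \<longlongrightarrow> J y) at_top"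
proof safe
  assume "has_improper_integral V nrm f y"
  then obtain I where y: "y \<in> V" and I: "\<And>b. b \<ge> 0 \<Longrightarrow> has_riemann_integral V nrm f 0 b (I b)"
    and lim: "((\<lambda>b. nrm (I b - y)) \<longlongrightarrow> 0) at_top"
    unfolding has_improper_integral_def by blast
  show "y \<in> V" by (rule y)
  have "\<forall>\<^sub>F b in at_top. nrm (I b - y) = norm (integral {0..b} (\<lambda>t. J (f t)) - J y)"
    using eventually_ge_at_top[of 0]
  proof eventually_elim
    case (elim b)
    have "((\<lambda>t. J (f t)) has_integral J (I b)) {0..b}"
      using f by (intro has_riemann_integral_imp_has_integral I elim) auto
    moreover have "I b \<in> V" using I[OF elim] by (simp add: has_riemann_integral_def)
    ultimately show ?case
      using y by (simp add: nrm J_diff V_closed(3) integral_unique)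
  qed
  then have "((\<lambda>b. norm (integral {0..b} (\<lambda>t. J (f t)) - J y)) \<longlongrightarrow> 0) at_top"
    using lim by (rule Lim_transform_eventually[rotated])
  then show "((\<lambda>b. integral {0..b} (\<lambda>t. J (f t))) \<longlongrightarrow> J y) at_top"
    by (rule Lim_null[THEN iffD2, OF tendsto_norm_zero_cancel])
next
  assume y: "y \<in> V" and lim: "((\<lambda>b. integral {0..b} (\<lambda>t. J (f t))) \<longlongrightarrow> J y) at_top"
  have "\<exists>I. \<forall>b. I b \<in> V \<and> J (I b) = integral {0..b} (\<lambda>t. J (f t))"
    using J_surj by (intro choice allI) blast
  then obtain I where I: "\<And>b. I b \<in> V" "\<And>b. J (I b) = integral {0..b} (\<lambda>t. J (f t))"
    by blast
  have "has_riemann_integral V nrm f 0 b (I b)" if "b \<ge> 0" for b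
    using f that I by (intro has_riemann_integral_continuous continuous_on_subset[OF cont]) auto
  moreover have "((\<lambda>b. nrm (I b - y)) \<longlongrightarrow> 0) at_top"
    using tendsto_norm_zero[OF lim[THEN Lim_null[THEN iffD1]]] y
    by (simp add: nrm J_diff V_closed(3) I)
  ultimately show "has_improper_integral V nrm f y"
    unfolding has_improper_integral_def using y by blast
qed

lemma ex1_contraction_equation:
  assumes W: "subspace W" "W \<subseteq> V" "closed (J ` W)"
    and T: "\<And>x. x \<in> W \<Longrightarrow> T x \<in> W"
    and q: "0 \<le> q" "q < 1" "\<And>x y. x \<in> W \<Longrightarrow> y \<in> W \<Longrightarrow> nrm (T x - T y) \<le> q * nrm (x - y)"
    and r: "r \<in> W"
  shows "\<exists>!y. y \<in> W \<and> y + T y = r"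
proof -
  define inv where "inv a = (THE x. x \<in> W \<and> J x = a)" for a
  have inv: "inv (J x) = x" if "x \<in> W" for x
    unfolding inv_def using that W(2) J_inj by (intro the_equality) auto
  let ?F = "\<lambda>a. J (r - T (inv a))"
  have "\<exists>!a. a \<in> J ` W \<and> ?F a = a"
  proof (rule Banach_fix[where c = q])
    show "complete (J ` W)" using W(3) by (simp add: complete_eq_closed)
    show "J ` W \<noteq> {}" using r by blast
    show "?F ` (J ` W) \<subseteq> J ` W"
      using T r subspace_diff[OF W(1)] by (auto simp: inv)
    show "dist (?F a) (?F b) \<le> q * dist a b" if ab: "a \<in> J ` W" "b \<in> J ` W" for a b
    proof -
      obtain x y where xy: "a = J x" "x \<in> W" "b = J y" "y \<in> W" using ab by blast
      then have V: "x \<in> V" "y \<in> V" "T x \<in> V" "T y \<in> V" "r \<in> V" using T r W(2) by auto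
      have "dist (?F a) (?F b) = nrm (T x - T y)"
        using V by (simp add: xy inv nrm J_diff V_closed(3) dist_norm norm_minus_commute)
      also have "\<dots> \<le> q * nrm (x - y)" by (intro q xy)
      also have "\<dots> = q * dist a b"
        using V by (simp add: xy nrm J_diff V_closed(3) dist_norm)
      finally show ?thesis .
    qed
  qed (use q in auto)
  moreover have "?F (J y) = J y \<longleftrightarrow> y + T y = r" if "y \<in> W" for y
  proof -
    have "?F (J y) = J y \<longleftrightarrow> r - T y = y"
      using that T[OF that] r W(2) J_inj[of "r - T y" y] V_closed(3)[of r "T y"] by (auto simp: inv)
    also have "\<dots> \<longleftrightarrow> y + T y = r" by (auto simp: algebra_simps)
    finally show ?thesis .
  qed
  moreover have "x = y" if "x \<in> W" "y \<in> W" "J x = J y" for x y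
    using that W(2) J_inj by blast
  ultimately show ?thesis
    by (smt (verit, ccfv_threshold) image_iff)
qed

text \<open>Subtracting the equation of the solution from the recursion leaves T y - T (Y l), so
  each step shrinks the error by the factor q.\<close>

lemma picard_iteration_tendsto:
  assumes W: "subspace W" "W \<subseteq> V"
    and T: "\<And>x. x \<in> W \<Longrightarrow> T x \<in> W"
    and q: "0 \<le> q" "q < 1" "\<And>x y. x \<in> W \<Longrightarrow> y \<in> W \<Longrightarrow> nrm (T x - T y) \<le> q * nrm (x - y)"
    and y: "y \<in> W" "y + T y = r"
    and Y: "Y 0 \<in> W" "\<And>l. Y (Suc l) = r - T (Y l)"
  shows "(\<lambda>l. nrm (Y l - y)) \<longlonglongrightarrow> 0"
proof -
  have r: "r \<in> W" using y T subspace_add[OF W(1)] by blast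
  have YW: "Y l \<in> W" for l
    by (induction l) (auto simp: Y r T intro: subspace_diff[OF W(1)])
  have step: "nrm (Y (Suc l) - y) \<le> q * nrm (Y l - y)" for l
  proof -
    have "Y (Suc l) - y = T y - T (Y l)"
      using y(2) by (simp add: Y algebra_simps)
    then have "nrm (Y (Suc l) - y) \<le> q * nrm (y - Y l)"
      using q(3)[OF y(1) YW[of l]] by simp
    also have "nrm (y - Y l) = nrm (Y l - y)"
      using nrm_scaleR[of "Y l - y" "-1"] YW[of l] y(1) W(2) V_closed(3) by (auto simp: subset_iff)
    finally show ?thesis .
  qed
  have bound: "nrm (Y l - y) \<le> q ^ l * nrm (Y 0 - y)" for l
  proof (induction l)
    case (Suc l)
    show ?case
      using order_trans[OF step[of l] mult_left_mono[OF Suc q(1)]] by (simp add: mult.assoc)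
  qed simp
  show ?thesis
  proof (rule Lim_null_comparison)
    show "\<forall>\<^sub>F l in sequentially. norm (nrm (Y l - y)) \<le> q ^ l * nrm (Y 0 - y)"
      using bound nrm_nonneg[of "Y _ - y"] YW y(1) W(2) V_closed(3)
      by (intro always_eventually) (auto simp: subset_iff)
    show "(\<lambda>l. q ^ l * nrm (Y 0 - y)) \<longlonglongrightarrow> 0"
      using q by (intro tendsto_mult_left_zero LIMSEQ_power_zero) auto
  qed
qed

end

section \<open>The time integral of an exponentially stable semigroup\<close>

locale exp_stable_semigroup = banach_carrier V nrm J
  for V :: "'v::real_vector set" and nrm and J :: "'v \<Rightarrow> 'b::banach" +
  fixes S :: "real \<Rightarrow> 'v \<Rightarrow> 'v" and K \<alpha> :: real
  assumes semigroup: "C0_semigroup V nrm S"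
    and K: "K \<ge> 0" and \<alpha>: "\<alpha> > 0"
    and decay: "\<And>t. t \<ge> 0 \<Longrightarrow> op_norm V nrm nrm (S t) \<le> ennreal (K * exp (- \<alpha> * t))"
begin

lemma S_V: "t \<ge> 0 \<Longrightarrow> x \<in> V \<Longrightarrow> S t x \<in> V"
  using semigroup by (auto simp: C0_semigroup_def)

lemma S_add: "t \<ge> 0 \<Longrightarrow> x \<in> V \<Longrightarrow> y \<in> V \<Longrightarrow> S t (x + y) = S t x + S t y"
  and S_scaleR: "t \<ge> 0 \<Longrightarrow> x \<in> V \<Longrightarrow> S t (c *\<^sub>R x) = c *\<^sub>R S t x"
  using semigroup by (auto simp: C0_semigroup_def linear_from_def)

lemma S_diff: "t \<ge> 0 \<Longrightarrow> x \<in> V \<Longrightarrow> y \<in> V \<Longrightarrow> S t (x - y) = S t x - S t y"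
  using S_add[of t "x - y" y] V_closed(3)[of x y] by simp

lemma S_bound:
  assumes "t \<ge> 0" "x \<in> V"
  shows "nrm (S t x) \<le> K * exp (- \<alpha> * t) * nrm x"
proof -
  have "ennreal (nrm (S t x)) \<le> op_norm V nrm nrm (S t) * ennreal (nrm x)"
    using assms by (intro le_op_norm) (auto simp: V_closed S_scaleR nrm_scaleR S_V nrm_nonneg nrm_eq_0)
  also have "\<dots> \<le> ennreal (K * exp (- \<alpha> * t)) * ennreal (nrm x)"
    by (intro mult_right_mono decay assms) simp
  also have "\<dots> = ennreal (K * exp (- \<alpha> * t) * nrm x)"
    using K nrm_nonneg[OF assms(2)] by (simp add: ennreal_mult)
  finally show ?thesis
    using K nrm_nonneg[OF assms(2)] by (simp add: ennreal_le_iff)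
qed

text \<open>Strong continuity is given only from the right at 0. Factoring out the smaller of two
  times, whose operator has norm at most K, reduces any pair of times to that case and gives
  continuity on both sides.\<close>

lemma orbit_continuous:
  assumes x: "x \<in> V"
  shows "continuous_on {0..} (\<lambda>t. J (S t x))"
proof -
  have diff: "dist (J (S t x)) (J (S s x)) \<le> K * nrm (S (t - s) x - x)" if st: "0 \<le> s" "s \<le> t" for s t
  proof -
    have "S t x = S s (S (t - s) x)"
      using semigroup x st unfolding C0_semigroup_def
      by (metis add.commute diff_add_cancel diff_ge_0_iff_ge)
    then have "dist (J (S t x)) (J (S s x)) = nrm (S s (S (t - s) x - x))"
      using x st by (simp add: S_diff S_V nrm J_diff V_closed(3) dist_norm)
    also have "\<dots> \<le> K * exp (- \<alpha> * s) * nrm (S (t - s) x - x)"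
      using x st by (intro S_bound) (auto simp: S_V V_closed(3))
    also have "\<dots> \<le> K * 1 * nrm (S (t - s) x - x)"
      using x st K \<alpha> by (intro mult_right_mono mult_left_mono) (auto simp: S_V V_closed(3) nrm_nonneg)
    finally show ?thesis by simp
  qed
  have lim: "((\<lambda>t. nrm (S t x - x)) \<longlongrightarrow> 0) (at_right 0)" and S0: "S 0 x = x"
    using semigroup x by (auto simp: C0_semigroup_def)
  show ?thesis
    unfolding continuous_on_iff
  proof (intro ballI allI impI)
    fix s e :: real assume s: "s \<in> {0..}" and "e > 0"
    \<comment> \<open>The added 1 covers K = 0 and makes K e / (K + 1) strictly less than e.\<close>
    have "e / (K + 1) > 0" using \<open>e > 0\<close> K by simp
    then have "\<forall>\<^sub>F h in at_right 0. nrm (S h x - x) < e / (K + 1)"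
      using lim by (rule order_tendstoD(2)[rotated])
    then obtain d where d: "d > 0" "\<And>h. 0 < h \<Longrightarrow> h < d \<Longrightarrow> nrm (S h x - x) < e / (K + 1)"
      unfolding eventually_at_right_field by auto
    have small: "dist (J (S t x)) (J (S r x)) < e" if "0 \<le> r" "r \<le> t" "t - r < d" for r t
    proof -
      \<comment> \<open>A limit from the right says nothing at time difference 0; that case uses
        \<open>S 0 x = x\<close>.\<close>
      have "nrm (S (t - r) x - x) < e / (K + 1)"
        using d(2)[of "t - r"] that S0 nrm[of 0] J_zero V_closed(1) \<open>e / (K + 1) > 0\<close>
        by (cases "t = r") auto
      then have "K * nrm (S (t - r) x - x) \<le> K * (e / (K + 1))"
        using K by (intro mult_left_mono) auto
      also have "\<dots> < e" using \<open>e > 0\<close> K by (simp add: field_simps)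
      finally show ?thesis using diff[OF that(1,2)] by linarith
    qed
    show "\<exists>d>0. \<forall>t\<in>{0..}. dist t s < d \<longrightarrow> dist (J (S t x)) (J (S s x)) < e"
    proof (intro exI[of _ d] conjI ballI impI d(1))
      fix t assume "t \<in> {0..}" "dist t s < d"
      then show "dist (J (S t x)) (J (S s x)) < e"
        using small[of s t] small[of t s] s by (cases "s \<le> t") (auto simp: dist_real_def dist_commute)
    qed
  qed
qed

lemma orbit_integrable: "x \<in> V \<Longrightarrow> 0 \<le> a \<Longrightarrow> (\<lambda>t. J (S t x)) integrable_on {a..b}"
  by (intro integrable_continuous_interval continuous_on_subset[OF orbit_continuous]) auto

lemma orbit_integral_bound:
  assumes x: "x \<in> V" and ab: "0 \<le> a" "a \<le> b"
  shows "norm (integral {a..b} (\<lambda>t. J (S t x))) \<le> K / \<alpha> * nrm x * exp (- \<alpha> * a)"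
proof -
  \<comment> \<open>An antiderivative of the decay bound. Its value at the lower limit is where the
    constant \<open>K / \<alpha>\<close> comes from.\<close>
  let ?F = "\<lambda>t. - (K / \<alpha> * nrm x) * exp (- \<alpha> * t)"
  have "((\<lambda>t. K * exp (- \<alpha> * t) * nrm x) has_integral (?F b - ?F a)) {a..b}"
    using \<alpha> ab(2) by (intro fundamental_theorem_of_calculus)
      (auto intro!: derivative_eq_intros simp: has_real_derivative_iff_has_vector_derivative[symmetric])
  then have "norm (integral {a..b} (\<lambda>t. J (S t x))) \<le> ?F b - ?F a"
    using orbit_integrable[OF x ab(1)] S_bound[OF _ x] ab S_V[OF _ x]
    by (intro integral_norm_bound_integral[where g = "\<lambda>t. K * exp (- \<alpha> * t) * nrm x", THEN order_trans])
      (auto simp: has_integral_iff nrm[symmetric])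
  also have "\<dots> \<le> K / \<alpha> * nrm x * exp (- \<alpha> * a)"
    using K \<alpha> nrm_nonneg[OF x] by simp
  finally show ?thesis .
qed

lemma orbit_integral_converges:
  assumes x: "x \<in> V"
  obtains L where "((\<lambda>b. integral {0..b} (\<lambda>t. J (S t x))) \<longlongrightarrow> L) at_top" "norm L \<le> K / \<alpha> * nrm x"
proof -
  let ?I = "\<lambda>b. integral {0..b} (\<lambda>t. J (S t x))"
  let ?M = "K / \<alpha> * nrm x"
  have diff: "norm (?I b - ?I a) \<le> ?M * exp (- \<alpha> * a)" if "0 \<le> a" "a \<le> b" for a b
  proof -
    have "?I a + integral {a..b} (\<lambda>t. J (S t x)) = ?I b"
      using that orbit_integrable[OF x] by (intro Henstock_Kurzweil_Integration.integral_combine) auto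
    then have "?I b - ?I a = integral {a..b} (\<lambda>t. J (S t x))"
      by (simp add: algebra_simps)
    then show ?thesis using orbit_integral_bound[OF x that] by simp
  qed
  have tail: "((\<lambda>a. ?M * exp (- \<alpha> * a)) \<longlongrightarrow> 0) at_top"
  proof -
    have "filterlim (\<lambda>a. - \<alpha> * a) at_bot at_top"
      using \<alpha> by (intro filterlim_tendsto_neg_mult_at_bot[OF tendsto_const]) (auto simp: filterlim_ident)
    then show ?thesis
      by (intro tendsto_mult_right_zero filterlim_compose[OF exp_at_bot])
  qed
  \<comment> \<open>Completeness is applied along the integers; the explicit tail bound then extends
    convergence to real upper limits and, taken at 0, bounds the limit.\<close>
  have "Cauchy (\<lambda>n. ?I (real n))"
  proof (rule CauchyI)
    fix e :: real assume "e > 0"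
    have "\<forall>\<^sub>F n in sequentially. ?M * exp (- \<alpha> * real n) < e"
      using order_tendstoD(2)[OF filterlim_compose[OF tail filterlim_real_sequentially] \<open>e > 0\<close>] .
    then obtain N where N: "\<And>n. n \<ge> N \<Longrightarrow> ?M * exp (- \<alpha> * real n) < e"
      by (auto simp: eventually_sequentially)
    show "\<exists>M. \<forall>m\<ge>M. \<forall>n\<ge>M. norm (?I (real m) - ?I (real n)) < e"
    proof (intro exI[of _ N] allI impI)
      fix m n assume "N \<le> m" "N \<le> n"
      then show "norm (?I (real m) - ?I (real n)) < e"
        using N[of m] N[of n] diff[of "real m" "real n"] diff[of "real n" "real m"]
        by (cases "m \<le> n") (simp_all add: norm_minus_commute)
    qed
  qed
  then obtain L where L: "(\<lambda>n. ?I (real n)) \<longlonglongrightarrow> L"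
    using Cauchy_convergent convergent_def by blast
  have dist_L: "norm (L - ?I a) \<le> ?M * exp (- \<alpha> * a)" if "a \<ge> 0" for a
  proof (rule tendsto_upperbound)
    show "(\<lambda>n. norm (?I (real n) - ?I a)) \<longlonglongrightarrow> norm (L - ?I a)"
      by (intro tendsto_norm tendsto_diff tendsto_const L)
    show "\<forall>\<^sub>F n in sequentially. norm (?I (real n) - ?I a) \<le> ?M * exp (- \<alpha> * a)"
      using eventually_ge_at_top[of "nat \<lceil>a\<rceil>"]
    proof eventually_elim
      case (elim n)
      then show ?case using that by (intro diff) (simp_all add: nat_ceiling_le_eq)
    qed
  qed simp
  have "((\<lambda>b. ?I b - L) \<longlongrightarrow> 0) at_top"
  proof (rule Lim_null_comparison[OF _ tail])
    show "\<forall>\<^sub>F b in at_top. norm (?I b - L) \<le> ?M * exp (- \<alpha> * b)"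
      using eventually_ge_at_top[of 0] by eventually_elim (use dist_L in \<open>auto simp: norm_minus_commute\<close>)
  qed
  then have "(?I \<longlongrightarrow> L) at_top"
    by (rule Lim_null[THEN iffD2])
  moreover have "norm L \<le> ?M"
    using dist_L[of 0] by simp
  ultimately show ?thesis by (rule that)
qed

definition R :: "'v \<Rightarrow> 'v" where
  "R x = (THE r. has_improper_integral V nrm (\<lambda>t. S t x) r)"

text \<open>Convergence of the truncated integrals and uniqueness of limits show that the
  description in \<open>R\<close> has exactly one solution, which inherits the bound of the
  limit.\<close>

lemma
  assumes x: "x \<in> V"
  shows R_V: "R x \<in> V"
    and tendsto_J_R: "((\<lambda>b. integral {0..b} (\<lambda>t. J (S t x))) \<longlongrightarrow> J (R x)) at_top"
    and R_bound: "nrm (R x) \<le> K / \<alpha> * nrm x"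
proof -
  note iff = has_improper_integral_iff[of "\<lambda>t. S t x", OF S_V[OF _ x] orbit_continuous[OF x]]
  obtain L where L: "((\<lambda>b. integral {0..b} (\<lambda>t. J (S t x))) \<longlongrightarrow> L) at_top" "norm L \<le> K / \<alpha> * nrm x"
    using orbit_integral_converges[OF x] by blast
  obtain r where r: "r \<in> V" "J r = L" using J_surj by blast
  have R: "R x = r"
    unfolding R_def
  proof (rule the_equality)
    show "has_improper_integral V nrm (\<lambda>t. S t x) r"
      using L(1) r by (simp add: iff)
    fix r' assume "has_improper_integral V nrm (\<lambda>t. S t x) r'"
    then have "r' \<in> V" "((\<lambda>b. integral {0..b} (\<lambda>t. J (S t x))) \<longlongrightarrow> J r') at_top"
      by (simp_all add: iff)
    then show "r' = r"
      using L(1) r by (intro J_inj) (auto intro: tendsto_unique[OF trivial_limit_at_top_linorder])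
  qed
  show "R x \<in> V" "((\<lambda>b. integral {0..b} (\<lambda>t. J (S t x))) \<longlongrightarrow> J (R x)) at_top"
    "nrm (R x) \<le> K / \<alpha> * nrm x"
    using L r by (simp_all add: R nrm)
qed

lemma R_diff:
  assumes x: "x \<in> V" and y: "y \<in> V"
  shows "R (x - y) = R x - R y"
proof (rule J_inj)
  have xy: "x - y \<in> V" using x y by (rule V_closed(3))
  have "integral {0..b} (\<lambda>t. J (S t (x - y)))
      = integral {0..b} (\<lambda>t. J (S t x)) - integral {0..b} (\<lambda>t. J (S t y))" for b
    using orbit_integrable[of _ 0 b] x y
    by (subst Henstock_Kurzweil_Integration.integral_diff[symmetric])
      (auto simp: S_diff J_diff S_V intro!: Henstock_Kurzweil_Integration.integral_cong)
  then have "((\<lambda>b. integral {0..b} (\<lambda>t. J (S t (x - y)))) \<longlongrightarrow> J (R x) - J (R y)) at_top"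
    using tendsto_diff[OF tendsto_J_R[OF x] tendsto_J_R[OF y]] by simp
  then have "J (R (x - y)) = J (R x) - J (R y)"
    using tendsto_J_R[OF xy] tendsto_unique trivial_limit_at_top_linorder by blast
  then show "J (R (x - y)) = J (R x - R y)"
    using x y by (simp add: J_diff R_V)
qed (use x y in \<open>auto intro: R_V V_closed(3)\<close>)

end


section \<open>Control operator and spectral projectors\<close>

text \<open>Both choice predicates are the same predicate, so \<open>SOME\<close> returns the same
  function, whether or not a continuous representative exists.\<close>

lemma point_value_cong_AE:
  assumes "AE y in lebesgue_on \<Omega>. f y = g y"
  shows "point_value \<Omega> f x = point_value \<Omega> g x"
proof -
  have "(\<lambda>h. continuous_on \<Omega> h \<and> (AE y in lebesgue_on \<Omega>. h y = f y))
      = (\<lambda>h. continuous_on \<Omega> h \<and> (AE y in lebesgue_on \<Omega>. h y = g y))"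
    using assms by (intro ext conj_cong refl iffI) (auto elim: eventually_elim2)
  then show ?thesis by (simp add: point_value_def)
qed

lemma B_op_add: "B_op \<Omega> xs (u + v) = B_op \<Omega> xs u + B_op \<Omega> xs v"
  and B_op_scaleR: "B_op \<Omega> xs (c *\<^sub>R u) = c *\<^sub>R B_op \<Omega> xs u"
  by (simp_all add: B_op_def scaleR_left_distrib sum.distrib scaleR_sum_right)

lemma B_op_diff: "B_op \<Omega> xs (u - v) = B_op \<Omega> xs u - B_op \<Omega> xs v"
  using B_op_add[of \<Omega> xs "u - v" v] by simp

lemma sum_fun_apply: "(\<Sum>i\<in>I. f i) x = (\<Sum>i\<in>I. f i x)" for f :: "'i \<Rightarrow> 'a \<Rightarrow> 'b::comm_monoid_add"
  by (induction I rule: infinite_finite_induct) auto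

lemma P_N_diff: "P_N \<Omega> \<phi> N (\<eta> - \<theta>) = P_N \<Omega> \<phi> N \<eta> - P_N \<Omega> \<phi> N \<theta>"
  by (simp add: P_N_def scaleR_left_diff_distrib sum_subtractf)

lemma Q_N_diff: "Q_N \<Omega> \<phi> N (\<eta> - \<theta>) = Q_N \<Omega> \<phi> N \<eta> - Q_N \<Omega> \<phi> N \<theta>"
  by (simp add: Q_N_def P_N_diff)

lemma P_N_in_X_N: "P_N \<Omega> \<phi> N \<eta> \<in> X_N \<Omega> \<phi> N"
  unfolding P_N_def X_N_def by (intro span_sum span_scale span_base imageI)

context neumann_setting
begin

sublocale X: banach_carrier "X_space \<Omega> \<kappa>" "X_norm \<Omega> \<kappa>" X_coords
proof
  show "\<exists>\<eta>\<in>X_space \<Omega> \<kappa>. X_coords \<eta> = a" for a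
    using X_coords_surj by metis
qed (auto simp: subspace_X_space X_coords_add X_coords_scaleR X_norm_eq intro: X_coords_inj)

text \<open>By symmetry the embedded function \<A> v is the functional that represents v. Thus every
  v in \<open>dom_A0\<close> occurs inside the point values of \<open>A_cl\<close>.\<close>

lemma calA_inv_embed_calA:
  assumes v: "v \<in> dom_A0 \<Omega>"
  shows "AE x in lebesgue_on \<Omega>. calA_inv \<Omega> \<kappa> (embed_X \<Omega> (calA \<Omega> \<kappa> v)) x = v x"
proof -
  have "embed_X \<Omega> (calA \<Omega> \<kappa> v) = dual_ext \<Omega> (calA \<Omega> \<kappa>) v"
    using calA_symmetric[OF v] by (auto simp: embed_X_def dual_ext_def fun_eq_iff)
  then have "fourier (calA_inv \<Omega> \<kappa> (embed_X \<Omega> (calA \<Omega> \<kappa> v))) = fourier v"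
    using v by (simp add: fourier_calA_inv dual_ext_calA_X_space X_coords_dual_ext_calA dom_A0_L2)
  then show ?thesis
    using v by (simp add: fourier_eq_iff calA_inv_L2 embed_X_space calA_L2 dom_A0_L2)
qed

text \<open>This replaces the Sobolev embedding \<open>H\<^sup>2(\<Omega>) \<subseteq> C(\<Omega>)\<close>. The vectors \<open>p v\<close> of point values of
  \<open>v \<in> D(\<A>)\<close> satisfy \<open>B (p v) \<in> \<X>\<close> because \<open>A\<^sub>c\<^sub>l\<close>, as a generator, takes values in \<open>\<X>\<close>, while
  \<open>B u = 0\<close> for every \<open>u\<close> orthogonal to all of them.\<close>

lemma B_op_X_space:
  fixes xs :: "'m::finite \<Rightarrow> real^3"
  assumes gain: "gain > 0" and S: "closed_loop_semigroup \<Omega> \<kappa> xs gain S"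
  shows "B_op \<Omega> xs u \<in> X_space \<Omega> \<kappa>"
proof -
  define p where "p v = (\<chi> j. point_value \<Omega> v (xs j))" for v
  have Bp: "B_op \<Omega> xs (p v) \<in> X_space \<Omega> \<kappa>" if v: "v \<in> dom_A0 \<Omega>" for v
  proof -
    let ?z = "calA \<Omega> \<kappa> v"
    have pv: "point_value \<Omega> (calA_inv \<Omega> \<kappa> (embed_X \<Omega> ?z)) x = point_value \<Omega> v x" for x
      by (rule point_value_cong_AE[OF calA_inv_embed_calA[OF v]])
    \<comment> \<open>The state z = \<A> v makes the feedback term equal to B applied to the point
      values of v. The remaining term, A0 extended to L2, is known to lie in \<open>X_space\<close>
      and can be subtracted.\<close>
    have "(embed_X \<Omega> ?z, dual_ext \<Omega> (A0 \<Omega> \<kappa>) ?z - gain *\<^sub>R B_op \<Omega> xs (p v)) \<in> A_cl \<Omega> \<kappa> xs gain"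
      unfolding A_cl_def B_op_def p_def
      by (rule image_eqI[OF _ calA_L2[OF v]]) (simp add: pv)
    then have "dual_ext \<Omega> (A0 \<Omega> \<kappa>) ?z - gain *\<^sub>R B_op \<Omega> xs (p v) \<in> X_space \<Omega> \<kappa>"
      using S by (auto simp: closed_loop_semigroup_def generator_def)
    from X.V_closed(3)[OF dual_ext_A0_X_space[OF calA_L2[OF v]] this]
    have "gain *\<^sub>R B_op \<Omega> xs (p v) \<in> X_space \<Omega> \<kappa>" by simp
    from X.V_closed(4)[OF this, of "1 / gain"]
    show ?thesis using gain by simp
  qed
  obtain w z where w: "w \<in> span (p ` dom_A0 \<Omega>)"
    and z: "\<And>y. y \<in> span (p ` dom_A0 \<Omega>) \<Longrightarrow> orthogonal z y" and u: "u = w + z"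
    using orthogonal_subspace_decomp_exists[of "p ` dom_A0 \<Omega>" u] by blast
  have "B_op \<Omega> xs w \<in> X_space \<Omega> \<kappa>"
    using w
  proof (induction rule: span_induct)
    case base
    then show ?case using X.V_closed(1) B_op_scaleR[of \<Omega> xs 0 0]
      by (auto simp: subspace_def B_op_add B_op_scaleR X.V_closed)
  qed (use Bp in auto)
  moreover have "B_op \<Omega> xs z = 0"
  proof
    fix v
    have "z \<bullet> p v = 0" if "v \<in> dom_A0 \<Omega>"
      using z[of "p v"] that by (auto simp: orthogonal_def intro: span_base)
    \<comment> \<open>The functional B z sends v in \<open>dom_A0\<close> to the inner product of z
      with \<open>p v\<close>; off \<open>dom_A0\<close> every delta is 0 by convention.\<close>
    then show "B_op \<Omega> xs z v = 0 v"
      by (cases "v \<in> dom_A0 \<Omega>")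
        (auto simp: B_op_def sum_fun_apply scaleR_fun_def delta_def p_def inner_vec_def)
  qed
  ultimately show ?thesis by (simp add: u B_op_add)
qed

lemma X_N_X_space: "X_N \<Omega> \<phi> N \<subseteq> X_space \<Omega> \<kappa>"
  unfolding X_N_def
  by (intro span_minimal subspace_X_space) (auto intro!: embed_X_space dom_A0_L2 eigenfunction_dom)

lemma ell2_nth_embed_eigenfunction:
  "ell2_nth (X_coords (embed_X \<Omega> (\<phi> (Suc j)))) k = (if j = k then 1 / mu k else 0)"
proof -
  have "embed_X \<Omega> (\<phi> (Suc j)) (\<phi> (Suc k)) = (if j = k then 1 else 0)"
    by (simp add: embed_X_def dual_ext_def eigenfunction_dom orthonormal)
  then show ?thesis
    by (simp add: ell2_nth_X_coords embed_X_space e_L2)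
qed

lemma ell2_nth_P_N:
  assumes \<eta>: "\<eta> \<in> X_space \<Omega> \<kappa>"
  shows "ell2_nth (X_coords (P_N \<Omega> \<phi> N \<eta>)) k = (if k < N then ell2_nth (X_coords \<eta>) k else 0)"
proof -
  have e: "embed_X \<Omega> (\<phi> (Suc j)) \<in> X_space \<Omega> \<kappa>" for j
    by (intro embed_X_space e_L2)
  have "X_coords (P_N \<Omega> \<phi> N \<eta>) = (\<Sum>j<N. \<eta> (\<phi> (Suc j)) *\<^sub>R X_coords (embed_X \<Omega> (\<phi> (Suc j))))"
    unfolding P_N_def by (simp add: sum.atLeast1_atMost_eq X.J_sum X.V_closed(4) e X_coords_scaleR)
  then have "ell2_nth (X_coords (P_N \<Omega> \<phi> N \<eta>)) k
      = (\<Sum>j<N. \<eta> (\<phi> (Suc j)) * ell2_nth (X_coords (embed_X \<Omega> (\<phi> (Suc j)))) k)"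
    by (simp add: linear_sum[OF bounded_linear.linear[OF bounded_linear_ell2_nth]])
  then show ?thesis
    using \<eta> by (simp add: ell2_nth_embed_eigenfunction ell2_nth_X_coords if_distrib cong: if_cong)
qed

lemma P_N_X_space: "P_N \<Omega> \<phi> N \<eta> \<in> X_space \<Omega> \<kappa>"
  using P_N_in_X_N X_N_X_space by blast

lemma Q_N_X_space: "\<eta> \<in> X_space \<Omega> \<kappa> \<Longrightarrow> Q_N \<Omega> \<phi> N \<eta> \<in> X_space \<Omega> \<kappa>"
  unfolding Q_N_def by (intro X.V_closed(3) P_N_X_space)

lemma X_norm_P_N_le: "\<eta> \<in> X_space \<Omega> \<kappa> \<Longrightarrow> X_norm \<Omega> \<kappa> (P_N \<Omega> \<phi> N \<eta>) \<le> X_norm \<Omega> \<kappa> \<eta>"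
  by (simp add: X_norm_eq P_N_X_space norm_ell2_mono ell2_nth_P_N)

lemma X_norm_Q_N_le: "\<eta> \<in> X_space \<Omega> \<kappa> \<Longrightarrow> X_norm \<Omega> \<kappa> (Q_N \<Omega> \<phi> N \<eta>) \<le> X_norm \<Omega> \<kappa> \<eta>"
  by (simp add: X_norm_eq Q_N_X_space)
    (rule norm_ell2_mono, simp add: Q_N_def X.J_diff P_N_X_space ell2_nth_P_N)

text \<open>Written through vanishing coordinates, the image is an intersection of kernels of
  continuous functionals, hence closed, as Banach's theorem demands.\<close>

lemma X_coords_X_N: "X_coords ` X_N \<Omega> \<phi> N = {a. \<forall>k\<ge>N. ell2_nth a k = 0}"
proof (intro set_eqI iffI)
  fix a assume "a \<in> X_coords ` X_N \<Omega> \<phi> N"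
  then obtain \<eta> where \<eta>: "\<eta> \<in> X_N \<Omega> \<phi> N" "a = X_coords \<eta>" by blast
  have "\<eta> \<in> {\<eta> \<in> X_space \<Omega> \<kappa>. \<forall>k\<ge>N. ell2_nth (X_coords \<eta>) k = 0}"
    using \<eta>(1) unfolding X_N_def
  proof (rule subsetD[OF span_minimal, rotated 2])
    show "subspace {\<eta> \<in> X_space \<Omega> \<kappa>. \<forall>k\<ge>N. ell2_nth (X_coords \<eta>) k = 0}"
      unfolding subspace_def using X.V_closed X.J_zero by (auto simp: X_coords_add X_coords_scaleR)
    have "embed_X \<Omega> (\<phi> k) \<in> {\<eta> \<in> X_space \<Omega> \<kappa>. \<forall>k\<ge>N. ell2_nth (X_coords \<eta>) k = 0}"
      if "k \<in> {1..N}" for k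
      using that ell2_nth_embed_eigenfunction[of "k - 1"]
      by (auto intro!: embed_X_space dom_A0_L2 eigenfunction_dom)
    then show "(\<lambda>k. embed_X \<Omega> (\<phi> k)) ` {1..N} \<subseteq> {\<eta> \<in> X_space \<Omega> \<kappa>. \<forall>k\<ge>N. ell2_nth (X_coords \<eta>) k = 0}"
      by blast
  qed
  then show "a \<in> {a. \<forall>k\<ge>N. ell2_nth a k = 0}" using \<eta>(2) by auto
next
  fix a assume a: "a \<in> {a. \<forall>k\<ge>N. ell2_nth a k = 0}"
  \<comment> \<open>Any preimage of a will do: \<open>P_N\<close> moves it into \<open>X_N\<close>
    and leaves its coordinates unchanged, because those from N on are zero already.\<close>
  obtain \<eta> where \<eta>: "\<eta> \<in> X_space \<Omega> \<kappa>" "X_coords \<eta> = a" by (rule X_coords_surj)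
  then have "X_coords (P_N \<Omega> \<phi> N \<eta>) = a"
    using a by (intro ell2_eqI) (auto simp: ell2_nth_P_N)
  then show "a \<in> X_coords ` X_N \<Omega> \<phi> N" using P_N_in_X_N by blast
qed

lemma closed_X_coords_X_N: "closed (X_coords ` X_N \<Omega> \<phi> N)"
  unfolding X_coords_X_N
  by (intro closed_Collect_all closed_Collect_imp closed_Collect_eq open_Collect_const
      continuous_on_const linear_continuous_on bounded_linear_ell2_nth)

end

section \<open>Contraction estimate and Picard iteration\<close>

theorem proposition10p16:
  fixes \<Omega> :: "(real^3) set" and \<kappa> gain K0 \<alpha> :: real
    and \<phi> :: "nat \<Rightarrow> real^3 \<Rightarrow> real" and lam :: "nat \<Rightarrow> real" and N :: nat
    and xs :: "'m::finite \<Rightarrow> real^3"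
    and S :: "real \<Rightarrow> functional \<Rightarrow> functional"
    and U :: "functional \<Rightarrow> real^'m"
  assumes "bounded \<Omega>" and "C2_domain \<Omega>" and "\<kappa> > 0" and "gain > 0"
    and "neumann_eigenbasis \<Omega> \<phi> lam" and "N \<ge> 1"
    and "\<And>j. xs j \<in> \<Omega>"
    and "closed_loop_semigroup \<Omega> \<kappa> xs gain S"
    and "linear_from (X_N \<Omega> \<phi> N) U"
    and "\<And>y. y \<in> span (\<phi> ` {1..N}) \<Longrightarrow>
           P_N \<Omega> \<phi> N (embed_X \<Omega> (A0 \<Omega> \<kappa> y) + B_op \<Omega> xs (U (embed_X \<Omega> y))) = 0"
    and "K0 \<ge> 1" and "\<alpha> > 0"
    and "\<And>t. t \<ge> 0 \<Longrightarrow>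
           op_norm (X_space \<Omega> \<kappa>) (X_norm \<Omega> \<kappa>) (X_norm \<Omega> \<kappa>) (S t) \<le> ennreal (K0 * exp (- \<alpha> * t))"
    and "ennreal (K0 / \<alpha>) * op_norm UNIV norm (X_norm \<Omega> \<kappa>) (B_op \<Omega> xs)
           * op_norm (X_N \<Omega> \<phi> N) (X_norm \<Omega> \<kappa>) norm U < 1"
  shows "\<forall>y\<^sub>r \<in> X_N \<Omega> \<phi> N.
           (\<exists>!y. y \<in> X_N \<Omega> \<phi> N \<and> y + T_N \<Omega> \<kappa> \<phi> N xs S U y = y\<^sub>r) \<and>
           (\<forall>y. y \<in> X_N \<Omega> \<phi> N \<and> y + T_N \<Omega> \<kappa> \<phi> N xs S U y = y\<^sub>r \<longrightarrow>
             (\<forall>Y. Y 0 \<in> X_N \<Omega> \<phi> N \<and> (\<forall>l. Y (Suc l) = y\<^sub>r - T_N \<Omega> \<kappa> \<phi> N xs S U (Y l)) \<longrightarrow>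
               (\<lambda>l. X_norm \<Omega> \<kappa> (Y l - y)) \<longlonglongrightarrow> 0))"
proof -
  have "open \<Omega>"
    using assms(2) by (simp add: C2_domain_def)
  with assms(1,3,5) interpret neumann_setting \<Omega> \<kappa> \<phi> lam
    by unfold_locales
  interpret exp_stable_semigroup "X_space \<Omega> \<kappa>" "X_norm \<Omega> \<kappa>" X_coords S K0 \<alpha>
  proof
    show "C0_semigroup (X_space \<Omega> \<kappa>) (X_norm \<Omega> \<kappa>) S"
      using assms(8) by (simp add: closed_loop_semigroup_def)
    show "op_norm (X_space \<Omega> \<kappa>) (X_norm \<Omega> \<kappa>) (X_norm \<Omega> \<kappa>) (S t) \<le> ennreal (K0 * exp (- \<alpha> * t))"
      if "t \<ge> 0" for t
      using that by (rule assms(13))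
  qed (use assms(11,12) in auto)
  let ?W = "X_N \<Omega> \<phi> N" and ?B = "B_op \<Omega> xs" and ?T = "T_N \<Omega> \<kappa> \<phi> N xs S U"
  let ?b = "op_norm UNIV norm (X_norm \<Omega> \<kappa>) ?B" and ?u = "op_norm ?W (X_norm \<Omega> \<kappa>) norm U"
  \<comment> \<open>The hypothesis forces the product to be finite, so passing to the real number q
    loses nothing.\<close>
  define q where "q = enn2real (ennreal (K0 / \<alpha>) * ?b * ?u)"
  have q_eq: "ennreal q = ennreal (K0 / \<alpha>) * ?b * ?u"
    unfolding q_def using assms(14) by (intro ennreal_enn2real) (auto intro: less_trans)
  have q: "0 \<le> q" "q < 1"
    using assms(14) by (auto simp: q_eq[symmetric] ennreal_less_one_iff) (simp add: q_def)
  have W: "subspace ?W" "?W \<subseteq> X_space \<Omega> \<kappa>"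
    by (simp add: X_N_def, rule X_N_X_space)
  have B: "?B u \<in> X_space \<Omega> \<kappa>" for u
    by (rule B_op_X_space[OF assms(4,8)])
  have T_eq: "?T y = P_N \<Omega> \<phi> N (R (Q_N \<Omega> \<phi> N (?B (U y))))" for y
    by (simp add: T_N_def R_cl_def R_def)
  \<comment> \<open>Linearity of U is available only on \<open>X_N\<close>, so the difference has to
    be shown to stay there.\<close>
  have U_diff: "U (x - y) = U x - U y" if "x \<in> ?W" "y \<in> ?W" for x y
  proof -
    have "U (x - y + y) = U (x - y) + U y"
      using assms(9) that subspace_diff[OF W(1) that] unfolding linear_from_def by blast
    then show ?thesis by simp
  qed
  have contraction: "X_norm \<Omega> \<kappa> (?T x - ?T y) \<le> q * X_norm \<Omega> \<kappa> (x - y)" if xy: "x \<in> ?W" "y \<in> ?W" for x y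
  proof -
    have d: "x - y \<in> ?W" by (rule subspace_diff[OF W(1) xy])
    then have n: "X_norm \<Omega> \<kappa> (x - y) \<ge> 0" using W(2) by (auto intro: X.nrm_nonneg)
    let ?\<eta> = "?B (U (x - y))"
    have "?T x - ?T y = P_N \<Omega> \<phi> N (R (Q_N \<Omega> \<phi> N ?\<eta>))"
      by (simp add: T_eq P_N_diff[symmetric] R_diff[symmetric] Q_N_diff[symmetric] Q_N_X_space B
          U_diff xy B_op_diff)
    then have "X_norm \<Omega> \<kappa> (?T x - ?T y) \<le> X_norm \<Omega> \<kappa> (R (Q_N \<Omega> \<phi> N ?\<eta>))"
      by (simp add: X_norm_P_N_le R_V Q_N_X_space B)
    also have "\<dots> \<le> K0 / \<alpha> * X_norm \<Omega> \<kappa> (Q_N \<Omega> \<phi> N ?\<eta>)"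
      by (intro R_bound Q_N_X_space B)
    also have "\<dots> \<le> K0 / \<alpha> * X_norm \<Omega> \<kappa> ?\<eta>"
      using K \<alpha> by (intro mult_left_mono X_norm_Q_N_le B) auto
    \<comment> \<open>From here the estimate continues in \<open>ennreal\<close>: the norms of B and
      U enter separately and either might be infinite, while finiteness is known for the product
      only.\<close>
    finally have "ennreal (X_norm \<Omega> \<kappa> (?T x - ?T y)) \<le> ennreal (K0 / \<alpha>) * ennreal (X_norm \<Omega> \<kappa> ?\<eta>)"
      using K \<alpha> X.nrm_nonneg[OF B] by (simp add: ennreal_mult[symmetric] ennreal_leI)
    also have "\<dots> \<le> ennreal (K0 / \<alpha>) * (?b * ennreal (norm (U (x - y))))"
      by (intro mult_left_mono le_op_norm) (auto simp: B_op_scaleR X.nrm_scaleR B)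
    also have "\<dots> \<le> ennreal (K0 / \<alpha>) * (?b * (?u * ennreal (X_norm \<Omega> \<kappa> (x - y))))"
    proof (intro mult_left_mono le_op_norm)
      show "c *\<^sub>R z \<in> ?W \<and> U (c *\<^sub>R z) = c *\<^sub>R U z \<and> X_norm \<Omega> \<kappa> (c *\<^sub>R z) = \<bar>c\<bar> * X_norm \<Omega> \<kappa> z
          \<and> norm (c *\<^sub>R U z) = \<bar>c\<bar> * norm (U z)" if "z \<in> ?W" for c z
        using that assms(9) W subspace_scale[OF W(1)]
        by (auto simp: linear_from_def X.nrm_scaleR)
      show "X_norm \<Omega> \<kappa> (x - y) = 0 \<Longrightarrow> x - y = 0"
        using X.nrm_eq_0[of "x - y"] d W(2) by blast
      show "0 \<le> X_norm \<Omega> \<kappa> (x - y)" "x - y \<in> ?W"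
        by (rule n, rule d)
    qed simp_all
    also have "\<dots> = ennreal q * ennreal (X_norm \<Omega> \<kappa> (x - y))"
      by (simp add: q_eq mult.assoc)
    finally show ?thesis
      using q n by (simp add: ennreal_mult[symmetric])
  qed
  have T_W: "?T y \<in> ?W" for y
    unfolding T_eq by (rule P_N_in_X_N)
  show ?thesis
  proof (intro ballI conjI allI impI)
    fix y\<^sub>r assume "y\<^sub>r \<in> ?W"
    then show "\<exists>!y. y \<in> ?W \<and> y + ?T y = y\<^sub>r"
      by (intro X.ex1_contraction_equation[OF W closed_X_coords_X_N T_W q contraction])
  next
    fix y\<^sub>r y Y
    assume "y \<in> ?W \<and> y + ?T y = y\<^sub>r" "Y 0 \<in> ?W \<and> (\<forall>l. Y (Suc l) = y\<^sub>r - ?T (Y l))"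
    then show "(\<lambda>l. X_norm \<Omega> \<kappa> (Y l - y)) \<longlonglongrightarrow> 0"
      by (intro X.picard_iteration_tendsto[OF W T_W q contraction, of y y\<^sub>r Y]) auto
  qed
qed

end
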